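(* Let $D\subset\mathbb{C}$ be a domain, let $A\subset D$ be a closed polar set, and let $f$ be holomorphic on $D\setminus A$. Then the set $\Gamma_f\cup(A\times\mathbb{C})$ is complete pluripolar in $D\times\mathbb{C}$. Moreover, if $f$ does not extend holomorphically over $A$, then the set $\Gamma_f\cup(A'\times\mathbb{C})$ is complete pluripolar in $D\times\mathbb{C}$, where $A'$ denotes the set of accumulation (density) points of $A$ in $D$.
   Context: $\Gamma_f=\{(z,f(z)):z\in D\setminus A\}$ is the graph of $f$ over $D\setminus A$. A set $E\subset\Omega$ ($\Omega\subset\mathbb{C}^n$ open) is complete pluripolar in $\Omega$ if there exists a plurisubharmonic function $u$ on $\Omega$ with $\{z\in\Omega:u(z)=-\infty\}=E$. "$f$ does not extend holomorphically over $A$" is understood as: for no point $a\in A$ does $f$ extend holomorphically to a neighbourhood of $a$. *)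

theory Defs
  imports "HOL-Complex_Analysis.Complex_Analysis"
begin

definition usc_on :: "'a::topological_space set \<Rightarrow> ('a \<Rightarrow> ereal) \<Rightarrow> bool" where
  "usc_on U u \<longleftrightarrow> (\<forall>x\<in>U. \<forall>c. u x < c \<longrightarrow> (\<forall>\<^sub>F y in at x within U. u y < c))"

text \<open>Sub-mean value inequality along the loop gamma over [0, 2 pi]:
  u(c) <= (1/2pi) * integral of u(gamma t) dt. Since u is bounded above on the loop, the
  (possibly -\<infinity>) mean is written as M - (1/2pi) nn-integral of (M - u(gamma t)) dt for any
  real upper bound M of u on the loop.\<close>
definition submean :: "('a \<Rightarrow> ereal) \<Rightarrow> 'a \<Rightarrow> (real \<Rightarrow> 'a) \<Rightarrow> bool" where
  "submean u c \<gamma> \<longleftrightarrow>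
     (\<forall>M::real. (\<forall>t\<in>{0..2*pi}. u (\<gamma> t) \<le> ereal M) \<longrightarrow>
        u c \<le> ereal M - ereal (1 / (2*pi)) *
          enn2ereal (\<integral>\<^sup>+ t. e2ennreal (ereal M - u (\<gamma> t)) * indicator {0..2*pi} t \<partial>lborel))"

definition subharmonic_on :: "complex set \<Rightarrow> (complex \<Rightarrow> ereal) \<Rightarrow> bool" where
  "subharmonic_on U u \<longleftrightarrow> usc_on U u \<and> (\<forall>z\<in>U. u z \<noteq> \<infinity>) \<and>
     (\<forall>a r. 0 < r \<and> cball a r \<subseteq> U \<longrightarrow> submean u a (\<lambda>t. a + of_real r * exp (\<i> * of_real t)))"

definition polar :: "complex set \<Rightarrow> bool" where
  "polar E \<longleftrightarrow> (\<forall>z\<in>E. \<exists>r>0. \<exists>u. subharmonic_on (ball z r) u \<and> (\<exists>w\<in>ball z r. u w \<noteq> -\<infinity>)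
       \<and> E \<inter> ball z r \<subseteq> {w. u w = -\<infinity>})"

definition psh_on :: "(complex \<times> complex) set \<Rightarrow> (complex \<times> complex \<Rightarrow> ereal) \<Rightarrow> bool" where
  "psh_on \<Omega> u \<longleftrightarrow> usc_on \<Omega> u \<and> (\<forall>z\<in>\<Omega>. u z \<noteq> \<infinity>) \<and>
     (\<forall>a b. (\<forall>w. cmod w \<le> 1 \<longrightarrow> (fst a + w * fst b, snd a + w * snd b) \<in> \<Omega>) \<longrightarrow>
        submean u a (\<lambda>t. (fst a + exp (\<i> * of_real t) * fst b, snd a + exp (\<i> * of_real t) * snd b)))"

definition complete_pluripolar :: "(complex \<times> complex) set \<Rightarrow> (complex \<times> complex) set \<Rightarrow> bool" where
  "complete_pluripolar \<Omega> E \<longleftrightarrow> (\<exists>u. psh_on \<Omega> u \<and> {z\<in>\<Omega>. u z = -\<infinity>} = E)"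

end

theory Submission
  imports Defs
begin

text \<open>The sub-mean inequality for a continuous real function is a local property, so continuous
  plurisubharmonic functions may be glued by taking maxima locally. The function with pole set \<open>E\<close>
  is a series of such functions \<open>u\<^sub>k\<close>: negative on the \<open>k\<close>-th compact set of an exhaustion,
  at most \<open>-1\<close> on more and more of \<open>E\<close>, and at least \<open>-2\<^sup>-\<^sup>k\<close> on more and more of its complement.

  A compact polar set has Chebyshev constant zero: otherwise nearly extremal Vandermonde products
  produce Green potentials that are bounded off the set, and these violate the maximum principle for
  subharmonic functions. So for every \<open>e > 0\<close> there is a monic polynomial \<open>p\<close> of some degree \<open>n\<close> with
  zeros in \<open>A\<close> and \<open>|p| < e\<^sup>n\<close> near a given compact part of \<open>A\<close>. Cauchy integrals along circles that
  avoid \<open>A\<close> and lie in this region split off the singularities of \<open>p\<^sup>m f\<close>, leaving a holomorphic \<open>H\<close>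
  with \<open>p\<^sup>m f - H = O(e\<^sup>n\<^sup>m)\<close>. Hence \<open>log |p\<^sup>m w - H| / (n m)\<close> is at most about \<open>log e\<close> on the graph and on
  \<open>A \<times> \<complex>\<close>, while elsewhere it is bounded below independently of \<open>e\<close>. Maxima with multiples of an
  exhaustion function of \<open>D\<close> make it globally defined.

  Near an isolated point \<open>a\<close> of \<open>A\<close> where \<open>f\<close> is unbounded there are paths in \<open>{|f| > R}\<close> that come
  arbitrarily close to \<open>a\<close>. The logarithm defined by such a path gives a harmonic function on
  \<open>{|f| \<le> R}\<close> which is \<open>\<le> -1\<close> away from \<open>a\<close> and almost \<open>0\<close> near \<open>a\<close>; the maximum with this function
  removes the pole along \<open>{a} \<times> \<complex>\<close>.\<close>

section \<open>Circle means and the local sub-mean inequality\<close>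

text \<open>The mechanism is a separation of scales. On the graph and on
  \<open>A \<times> UNIV\<close> the normalised logarithm can be pushed to an arbitrary
  \<open>- M\<close>, while its upper bound \<open>N1\<close> and its lower bound
  \<open>- N2\<close> off these sets are fixed before \<open>M\<close>. Subtracting a constant and
  dividing by a number of size \<open>M\<close> leaves at most \<open>-1\<close> on the set and
  almost \<open>0\<close> off it. The constants of the singularity splitting are uncontrolled as
  \<open>e\<close> shrinks, but they do not depend on the power \<open>m\<close>, so a large
  \<open>m\<close> absorbs them. The second obstacle is that \<open>A\<close> may have infinitely
  many isolated points. Each term of the series therefore frees only finitely many vertical lines,
  those over well isolated points in a compact set, and every isolated point is freed from some term
  on. Freeing one more line calls the previous construction with a larger compact set off the graph,
  a larger range of \<open>w\<close> and a smaller tolerance, so the induction has to quantify over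
  all such data. Non-extension enters only as unboundedness of \<open>f\<close> near each isolated
  point; poles and essential singularities are treated alike.\<close>

definition circ_mean :: "(complex \<Rightarrow> real) \<Rightarrow> real" where
  "circ_mean g = integral {0..2*pi} (\<lambda>t. g (exp (\<i> * of_real t))) / (2*pi)"

lemma circ_integrable:
  assumes "continuous_on (sphere 0 1) g"
  shows "(\<lambda>t. g (exp (\<i> * complex_of_real t)) :: real) integrable_on {0..2*pi}"
  by (intro integrable_continuous_real continuous_on_compose2[OF assms] continuous_intros) auto

lemma circ_mean_mono:
  assumes "continuous_on (sphere 0 1) g" "continuous_on (sphere 0 1) h"
    "\<And>z. norm z = 1 \<Longrightarrow> g z \<le> h z"
  shows "circ_mean g \<le> circ_mean h"
  unfolding circ_mean_def
  by (intro divide_right_mono integral_le circ_integrable assms) (use assms in auto)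

lemma circ_mean_add:
  assumes "continuous_on (sphere 0 1) g" "continuous_on (sphere 0 1) h"
  shows "circ_mean (\<lambda>z. g z + h z) = circ_mean g + circ_mean h"
  unfolding circ_mean_def
  by (subst integral_add) (auto intro!: circ_integrable assms simp: add_divide_distrib)

lemma circ_mean_cmult: "circ_mean (\<lambda>z. c * g z) = c * circ_mean g"
  unfolding circ_mean_def by (simp add: integral_mult_right)

lemma circ_mean_const [simp]: "circ_mean (\<lambda>z. c) = c"
  unfolding circ_mean_def by simp

lemma circ_mean_diff:
  assumes "continuous_on (sphere 0 1) g" "continuous_on (sphere 0 1) h"
  shows "circ_mean (\<lambda>z. g z - h z) = circ_mean g - circ_mean h"
  unfolding circ_mean_def
  by (subst integral_diff) (auto intro!: circ_integrable assms simp: diff_divide_distrib)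

lemma circ_mean_cong:
  assumes "\<And>z. norm z = 1 \<Longrightarrow> g z = h z"
  shows "circ_mean g = circ_mean h"
  unfolding circ_mean_def using assms by simp

lemma circ_mean_Re_holomorphic:
  assumes "continuous_on (cball 0 1) g" "g holomorphic_on ball 0 1"
  shows "circ_mean (\<lambda>z. Re (g z)) = Re (g 0)"
proof -
  have "((\<lambda>u. g u / (u - 0)) has_contour_integral (2 * of_real pi * \<i>) * g 0) (circlepath 0 1)"
    using assms by (intro Cauchy_integral_circlepath) auto
  then have "((\<lambda>u. g u / u) has_contour_integral (2 * of_real pi * \<i>) * g 0) (part_circlepath 0 1 0 (2*pi))"
    by (simp add: circlepath_def)
  then have "((\<lambda>t. g (0 + of_real 1 * cis t) / (0 + of_real 1 * cis t) * of_real 1 * \<i> * cis t) has_integral (2 * of_real pi * \<i>) * g 0) {0..2*pi}"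
    by (subst (asm) has_contour_integral_part_circlepath_iff) auto
  then have "((\<lambda>t. \<i> * g (cis t)) has_integral (2 * of_real pi * \<i>) * g 0) {0..2*pi}"
    by (rule has_integral_eq[rotated]) (auto simp: field_simps)
  then have "((\<lambda>t. (-\<i>) * (\<i> * g (cis t))) has_integral (-\<i>) * ((2 * of_real pi * \<i>) * g 0)) {0..2*pi}"
    by (rule has_integral_mult_right)
  then have "((\<lambda>t. g (cis t)) has_integral of_real (2 * pi) * g 0) {0..2*pi}"
    by (simp add: mult.assoc[symmetric]) (simp add: mult_ac)
  then have "((\<lambda>t. Re (g (cis t))) has_integral Re (of_real (2 * pi) * g 0)) {0..2*pi}"
    by (rule has_integral_linear[OF _ bounded_linear_Re, unfolded o_def])
  then have "integral {0..2*pi} (\<lambda>t. Re (g (cis t))) = 2 * pi * Re (g 0)"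
    by (simp add: integral_unique)
  then show ?thesis unfolding circ_mean_def by (simp add: cis_conv_exp)
qed

section \<open>Trigonometric approximation and the maximum principle on the disc\<close>

text \<open>Real trigonometric polynomials, written as boundary values of \<open>Re p\<close> so
  that each comes with its harmonic extension to the disc, whose value at \<open>0\<close> is the
  circle mean.\<close>

definition trig_poly :: "(complex \<Rightarrow> real) \<Rightarrow> bool" where
  "trig_poly g \<longleftrightarrow> (\<exists>p. \<forall>z\<in>sphere 0 1. g z = Re (poly p z))"

lemma trig_poly_const: "trig_poly (\<lambda>z. c)"
  unfolding trig_poly_def by (rule exI[of _ "[:of_real c:]"]) auto

lemma trig_poly_add: "trig_poly f \<Longrightarrow> trig_poly g \<Longrightarrow> trig_poly (\<lambda>z. f z + g z)"
  unfolding trig_poly_def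
  by (elim exE, rule_tac x = "p + pa" in exI) auto

lemma trig_poly_sum: "finite I \<Longrightarrow> (\<And>i. i \<in> I \<Longrightarrow> trig_poly (f i)) \<Longrightarrow> trig_poly (\<lambda>z. \<Sum>i\<in>I. f i z)"
  by (induction I rule: finite_induct) (auto intro: trig_poly_const trig_poly_add)

text \<open>On the unit circle \<open>cnj z\<close> is the inverse of \<open>z\<close>, so only one
  power survives; a power of \<open>cnj z\<close> is turned into a power of \<open>z\<close> by
  conjugation, which leaves the real part unchanged.\<close>

lemma trig_poly_monomial: "trig_poly (\<lambda>z. Re (c * z ^ i * cnj z ^ j))"
proof (cases "i \<ge> j")
  case True
  show ?thesis unfolding trig_poly_def
  proof (intro exI ballI)
    fix z :: complex assume "z \<in> sphere 0 1"
    then have "z * cnj z = 1" by (simp add: complex_norm_square[symmetric])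
    then have "z ^ j * cnj z ^ j = 1" by (metis power_mult_distrib power_one)
    moreover have "z ^ i = z ^ (i - j) * z ^ j" using True by (simp add: power_add[symmetric])
    ultimately have "c * z ^ i * cnj z ^ j = c * z ^ (i - j)" by (simp add: mult.assoc)
    then show "Re (c * z ^ i * cnj z ^ j) = Re (poly (monom c (i - j)) z)"
      by (simp only: poly_monom)
  qed
next
  case False
  show ?thesis unfolding trig_poly_def
  proof (intro exI ballI)
    fix z :: complex assume "z \<in> sphere 0 1"
    then have "z * cnj z = 1" by (simp add: complex_norm_square[symmetric])
    then have "z ^ i * cnj z ^ i = 1" by (metis power_mult_distrib power_one)
    have "cnj z ^ j = cnj z ^ i * cnj z ^ (j - i)" using False by (simp add: power_add[symmetric])
    then have "c * z ^ i * cnj z ^ j = c * (z ^ i * cnj z ^ i) * cnj z ^ (j - i)"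
      by (simp only: mult.assoc)
    also have "\<dots> = c * cnj z ^ (j - i)" using \<open>z ^ i * cnj z ^ i = 1\<close> by simp
    also have "\<dots> = cnj (cnj c * z ^ (j - i))" by simp
    finally have "c * z ^ i * cnj z ^ j = cnj (cnj c * z ^ (j - i))" .
    then show "Re (c * z ^ i * cnj z ^ j) = Re (poly (monom (cnj c) (j - i)) z)"
      by (simp only: poly_monom cnj.simps)
  qed
qed

text \<open>A product of real parts is \<open>Re (a * b / 2) + Re (a * cnj b / 2)\<close>; only the
  mixed term leaves the polynomials, and it is expanded into monomials in \<open>z\<close> and
  \<open>cnj z\<close>.\<close>

lemma trig_poly_mult:
  assumes "trig_poly f" "trig_poly g"
  shows "trig_poly (\<lambda>z. f z * g z)"
proof -
  obtain p q where p: "\<forall>z\<in>sphere 0 1. f z = Re (poly p z)" and q: "\<forall>z\<in>sphere 0 1. g z = Re (poly q z)"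
    using assms unfolding trig_poly_def by auto
  have ReRe: "Re a * Re b = Re (a * b / 2) + Re (a * cnj b / 2)" for a b
    by (simp add: field_simps)
  have "trig_poly (\<lambda>z. \<Sum>i\<le>degree p. \<Sum>j\<le>degree q. Re (coeff p i * cnj (coeff q j) / 2 * z ^ i * cnj z ^ j))"
    by (intro trig_poly_sum trig_poly_monomial) auto
  moreover have "(\<Sum>i\<le>degree p. \<Sum>j\<le>degree q. Re (coeff p i * cnj (coeff q j) / 2 * z ^ i * cnj z ^ j))
      = Re (poly p z * cnj (poly q z) / 2)" for z
  proof -
    have "poly p z * cnj (poly q z) / 2 = (\<Sum>i\<le>degree p. coeff p i * z ^ i) * (\<Sum>j\<le>degree q. cnj (coeff q j) * cnj z ^ j) / 2"
      by (simp add: poly_altdef)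
    also have "\<dots> = (\<Sum>i\<le>degree p. \<Sum>j\<le>degree q. coeff p i * cnj (coeff q j) / 2 * z ^ i * cnj z ^ j)"
      by (simp add: sum_product sum_divide_distrib mult_ac)
    finally show ?thesis by (simp only: Re_sum)
  qed
  ultimately have 1: "trig_poly (\<lambda>z. Re (poly p z * cnj (poly q z) / 2))" by (simp only:)
  have 2: "trig_poly (\<lambda>z. Re (poly p z * poly q z / 2))"
    unfolding trig_poly_def by (rule exI[of _ "smult (1/2) (p * q)"]) auto
  have 3: "trig_poly (\<lambda>z. Re (poly p z * poly q z / 2) + Re (poly p z * cnj (poly q z) / 2))"
    using trig_poly_add[OF 2 1] .
  have "(\<forall>z\<in>sphere 0 1. f z * g z = Re (poly p z * poly q z / 2) + Re (poly p z * cnj (poly q z) / 2))"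
    using p q ReRe by simp
  then show ?thesis using 3 unfolding trig_poly_def by metis
qed

text \<open>Stone-Weierstrass, with \<open>Re\<close> and \<open>Im\<close> separating the points of
  the circle. It takes the place of a Poisson integral: approximate harmonic extensions of the
  boundary values suffice below.\<close>

lemma trig_poly_approx:
  assumes "continuous_on (sphere 0 1) g" "e > 0"
  obtains p where "\<And>z. norm z = 1 \<Longrightarrow> \<bar>g z - Re (poly p z)\<bar> < e"
proof -
  have "\<exists>h. trig_poly h \<and> (\<forall>x\<in>sphere (0::complex) 1. \<bar>g x - h x\<bar> < e)"
  proof (rule Stone_Weierstrass_HOL[where P = trig_poly])
    fix f assume "trig_poly f"
    then obtain p where "\<forall>z\<in>sphere 0 1. f z = Re (poly p z)" unfolding trig_poly_def by auto
    then show "continuous_on (sphere 0 1) f"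
      by (subst continuous_on_cong[OF refl, where g = "\<lambda>z. Re (poly p z)"]) (auto intro!: continuous_intros)
  next
    fix x y :: complex assume xy: "x \<in> sphere 0 1 \<and> y \<in> sphere 0 1 \<and> x \<noteq> y"
    have "trig_poly Re" unfolding trig_poly_def by (rule exI[of _ "[:0,1:]"]) auto
    moreover have "trig_poly Im" unfolding trig_poly_def by (rule exI[of _ "[:0,-\<i>:]"]) auto
    ultimately show "\<exists>f. trig_poly f \<and> f x \<noteq> f y" using xy complex_eqI by blast
  qed (use assms trig_poly_const trig_poly_add trig_poly_mult in auto)
  then show ?thesis using that unfolding trig_poly_def by force
qed

text \<open>The cross term is the real part of a holomorphic function vanishing at \<open>0\<close>
  and averages out. The exact excess \<open>r\<^sup>2\<close> over the value at the centre makes a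
  weak mean inequality strict.\<close>

lemma circ_mean_norm_square:
  "circ_mean (\<lambda>z. (norm (w + of_real r * z))\<^sup>2) = (norm w)\<^sup>2 + r\<^sup>2"
proof -
  have "circ_mean (\<lambda>z. (norm (w + of_real r * z))\<^sup>2) = circ_mean (\<lambda>z. Re ((norm w)\<^sup>2 + r\<^sup>2 + 2 * r * (cnj w * z)))"
  proof (rule circ_mean_cong)
    fix z :: complex assume z: "norm z = 1"
    then have "(Re z)\<^sup>2 + (Im z)\<^sup>2 = 1" by (metis cmod_power2 power_one)
    then have "r\<^sup>2 * (Re z)\<^sup>2 + r\<^sup>2 * (Im z)\<^sup>2 = r\<^sup>2" by (metis distrib_left mult.right_neutral)
    then show "(norm (w + of_real r * z))\<^sup>2 = Re ((norm w)\<^sup>2 + r\<^sup>2 + 2 * r * (cnj w * z))"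
      by (simp add: cmod_power2 power2_sum power_mult_distrib algebra_simps) 
  qed
  also have "\<dots> = (norm w)\<^sup>2 + r\<^sup>2"
    by (subst circ_mean_Re_holomorphic) (auto intro!: continuous_intros holomorphic_intros)
  finally show ?thesis .
qed

text \<open>Adding \<open>e\<close> times the squared norm makes the mean inequality strict, so a
  maximum point cannot lie in the open disc; then \<open>e\<close> tends to
  \<open>0\<close>.\<close>

lemma submean_disc_max_boundary:
  assumes cont: "continuous_on (cball 0 1) \<phi>"
    and sub: "\<And>z. norm z < 1 \<Longrightarrow> \<exists>r>0. \<forall>\<rho>. 0 < \<rho> \<and> \<rho> < r \<longrightarrow> \<phi> z \<le> circ_mean (\<lambda>\<zeta>. \<phi> (z + of_real \<rho> * \<zeta>))"
    and bd: "\<And>z. norm z = 1 \<Longrightarrow> \<phi> z \<le> c"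
  shows "\<phi> 0 \<le> (c::real)"
proof (rule field_le_epsilon)
  fix e :: real assume e: "e > 0"
  let ?f = "\<lambda>z. \<phi> z + e * (norm z)\<^sup>2"
  have contf: "continuous_on (cball 0 1) ?f" by (intro continuous_intros cont)
  obtain x where x: "x \<in> cball 0 1" "\<forall>y\<in>cball 0 1. ?f y \<le> ?f x"
    using continuous_attains_sup[OF compact_cball _ contf] by auto
  have "norm x = 1"
  proof (rule ccontr)
    assume "norm x \<noteq> 1"
    then have x1: "norm x < 1" using x by auto
    obtain r where r: "r > 0" "\<And>\<rho>. 0 < \<rho> \<Longrightarrow> \<rho> < r \<Longrightarrow> \<phi> x \<le> circ_mean (\<lambda>\<zeta>. \<phi> (x + of_real \<rho> * \<zeta>))"
      using sub[OF x1] by auto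
    define \<rho> where "\<rho> = min (r/2) ((1 - norm x)/2)"
    have \<rho>: "\<rho> > 0" "\<rho> < r" "norm x + \<rho> \<le> 1" using r x1 unfolding \<rho>_def by (auto simp: min_def field_simps)
    have inb: "x + of_real \<rho> * \<zeta> \<in> cball 0 1" if "norm \<zeta> = 1" for \<zeta>
    proof -
      have "norm (x + of_real \<rho> * \<zeta>) \<le> norm x + norm (of_real \<rho> * \<zeta>)" by (rule norm_triangle_ineq)
      then show ?thesis using \<rho> that by (simp add: norm_mult)
    qed
    have c1: "continuous_on (sphere 0 1) (\<lambda>\<zeta>. \<phi> (x + of_real \<rho> * \<zeta>))"
      by (rule continuous_on_compose2[OF cont]) (use inb in \<open>auto intro!: continuous_intros\<close>)
    have c2: "continuous_on (sphere 0 1) (\<lambda>\<zeta>. e * (norm (x + of_real \<rho> * \<zeta>))\<^sup>2)"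
      by (intro continuous_intros)
    have "circ_mean (\<lambda>\<zeta>. ?f (x + of_real \<rho> * \<zeta>)) \<le> circ_mean (\<lambda>\<zeta>. ?f x)"
      using x inb by (intro circ_mean_mono continuous_on_add c1 c2) auto
    moreover have "circ_mean (\<lambda>\<zeta>. ?f (x + of_real \<rho> * \<zeta>)) = circ_mean (\<lambda>\<zeta>. \<phi> (x + of_real \<rho> * \<zeta>)) + e * ((norm x)\<^sup>2 + \<rho>\<^sup>2)"
      by (subst circ_mean_add[OF c1 c2], subst circ_mean_cmult, subst circ_mean_norm_square) simp
    moreover have "\<phi> x \<le> circ_mean (\<lambda>\<zeta>. \<phi> (x + of_real \<rho> * \<zeta>))" using r(2) \<rho> by auto
    ultimately have "e * \<rho>\<^sup>2 \<le> 0" by (simp add: algebra_simps)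
    then show False using e \<rho> by (simp add: mult_le_0_iff)
  qed
  then have "?f x \<le> c + e" using bd[of x] by simp
  moreover have "?f 0 \<le> ?f x" using x(2) by (rule bspec) simp
  ultimately show "\<phi> 0 \<le> c + e" by simp
qed

text \<open>Subtract a harmonic polynomial that is within \<open>e/2\<close> of
  \<open>\<phi>\<close> on the circle. The difference keeps the local inequality, so the maximum
  principle bounds it at \<open>0\<close> by \<open>e/2\<close>; the polynomial at \<open>0\<close>
  is its own circle mean, which is within \<open>e/2\<close> of that of
  \<open>\<phi>\<close>.\<close>

lemma submean_disc_local_to_global:
  assumes cont: "continuous_on (cball 0 1) \<phi>"
    and sub: "\<And>z. norm z < 1 \<Longrightarrow> \<exists>r>0. \<forall>\<rho>. 0 < \<rho> \<and> \<rho> < r \<longrightarrow> \<phi> z \<le> circ_mean (\<lambda>\<zeta>. \<phi> (z + of_real \<rho> * \<zeta>))"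
  shows "\<phi> 0 \<le> circ_mean \<phi>"
proof (rule field_le_epsilon)
  fix e :: real assume e: "e > 0"
  have cs: "continuous_on (sphere 0 1) \<phi>" using cont by (rule continuous_on_subset) auto
  obtain p where p: "\<And>z. norm z = 1 \<Longrightarrow> \<bar>\<phi> z - Re (poly p z)\<bar> < e/2"
    using trig_poly_approx[OF cs, of "e/2"] e by auto
  have "\<phi> 0 - Re (poly p 0) \<le> e/2"
  proof (rule submean_disc_max_boundary[where \<phi> = "\<lambda>z. \<phi> z - Re (poly p z)"])
    show "continuous_on (cball 0 1) (\<lambda>z. \<phi> z - Re (poly p z))" by (intro continuous_intros cont)
    show "\<phi> z - Re (poly p z) \<le> e/2" if "norm z = 1" for z using p[OF that] by linarith
    fix z :: complex assume z: "norm z < 1"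
    obtain r where r: "r > 0" "\<And>\<rho>. 0 < \<rho> \<Longrightarrow> \<rho> < r \<Longrightarrow> \<phi> z \<le> circ_mean (\<lambda>\<zeta>. \<phi> (z + of_real \<rho> * \<zeta>))"
      using sub[OF z] by auto
    show "\<exists>r>0. \<forall>\<rho>. 0 < \<rho> \<and> \<rho> < r \<longrightarrow> \<phi> z - Re (poly p z) \<le> circ_mean (\<lambda>\<zeta>. \<phi> (z + of_real \<rho> * \<zeta>) - Re (poly p (z + of_real \<rho> * \<zeta>)))"
    proof (intro exI[of _ "min r (1 - norm z)"] conjI allI impI)
      fix \<rho> assume \<rho>: "0 < \<rho> \<and> \<rho> < min r (1 - norm z)"
      have inb: "z + of_real \<rho> * \<zeta> \<in> cball 0 1" if "norm \<zeta> = 1" for \<zeta>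
      proof -
        have "norm (z + of_real \<rho> * \<zeta>) \<le> norm z + norm (of_real \<rho> * \<zeta>)" by (rule norm_triangle_ineq)
        then show ?thesis using \<rho> that by (simp add: norm_mult)
      qed
      have c1: "continuous_on (sphere 0 1) (\<lambda>\<zeta>. \<phi> (z + of_real \<rho> * \<zeta>))"
        by (rule continuous_on_compose2[OF cont]) (use inb in \<open>auto intro!: continuous_intros\<close>)
      have c2: "continuous_on (sphere 0 1) (\<lambda>\<zeta>. Re (poly p (z + of_real \<rho> * \<zeta>)))"
        by (intro continuous_intros)
      have "circ_mean (\<lambda>\<zeta>. Re (poly p (z + of_real \<rho> * \<zeta>))) = Re (poly p z)"
        by (subst circ_mean_Re_holomorphic) (auto intro!: continuous_intros holomorphic_intros)
      then show "\<phi> z - Re (poly p z) \<le> circ_mean (\<lambda>\<zeta>. \<phi> (z + of_real \<rho> * \<zeta>) - Re (poly p (z + of_real \<rho> * \<zeta>)))"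
        using r(2)[of \<rho>] \<rho> by (subst circ_mean_diff[OF c1 c2]) auto
    qed (use r z in auto)
  qed
  moreover have "Re (poly p 0) = circ_mean (\<lambda>z. Re (poly p z))"
    by (subst circ_mean_Re_holomorphic) (auto intro!: continuous_intros holomorphic_intros)
  moreover have "circ_mean (\<lambda>z. Re (poly p z)) \<le> circ_mean (\<lambda>z. \<phi> z + e/2)"
  proof (intro circ_mean_mono)
    show "Re (poly p z) \<le> \<phi> z + e/2" if "norm z = 1" for z using p[OF that] by linarith
  qed (auto intro!: continuous_intros cs)
  moreover have "circ_mean (\<lambda>z. \<phi> z + e/2) = circ_mean \<phi> + e/2"
    by (subst circ_mean_add[OF cs]) auto
  ultimately show "\<phi> 0 \<le> circ_mean \<phi> + e" by linarith
qed

section \<open>Means of extended real functions along a loop\<close>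

lemma nn_integral_continuous_interval:
  fixes f :: "real \<Rightarrow> real"
  assumes cont: "continuous_on {a..b} f" and nonneg: "\<And>t. t \<in> {a..b} \<Longrightarrow> 0 \<le> f t"
  shows "(\<integral>\<^sup>+ t. ennreal (f t) * indicator {a..b} t \<partial>lborel) = ennreal (integral {a..b} f)"
proof -
  let ?g = "\<lambda>t. indicator {a..b} t *\<^sub>R f t"
  have "(f has_integral integral {a..b} f) {a..b}"
    using cont by (intro integrable_integral integrable_continuous_real)
  then have "((\<lambda>t. if t \<in> {a..b} then f t else 0) has_integral integral {a..b} f) UNIV"
    by (simp only: has_integral_restrict_UNIV)
  moreover have "(\<lambda>t. if t \<in> {a..b} then f t else 0) = ?g" by (auto simp: fun_eq_iff)
  ultimately have "(?g has_integral integral {a..b} f) UNIV" by simp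
  moreover have "?g \<in> borel_measurable borel"
    using cont by (intro borel_measurable_continuous_on_indicator) auto
  ultimately have "(\<integral>\<^sup>+ t. ennreal (?g t) \<partial>lborel) = ennreal (integral {a..b} f)"
    using nonneg by (intro nn_integral_has_integral_lborel) (auto simp: indicator_def)
  moreover have "(\<integral>\<^sup>+ t. ennreal (?g t) \<partial>lborel) = (\<integral>\<^sup>+ t. ennreal (f t) * indicator {a..b} t \<partial>lborel)"
    by (intro nn_integral_cong) (auto simp: indicator_def)
  ultimately show ?thesis by simp
qed

text \<open>Only monotonicity of the nonnegative integral enters, so a continuous majorant on the
  loop can replace \<open>u\<close>, of which no measurability is known.\<close>

lemma submean_le_integral:
  assumes sub: "submean u c \<gamma>" and cont: "continuous_on {0..2*pi} k"
    and le: "\<And>t. t \<in> {0..2*pi} \<Longrightarrow> u (\<gamma> t) \<le> ereal (k t)"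
  shows "u c \<le> ereal (integral {0..2*pi} k / (2*pi))"
proof -
  have "bounded (k ` {0..2*pi})" using cont by (intro compact_imp_bounded compact_continuous_image) auto
  then obtain M where M: "\<And>t. t \<in> {0..2*pi} \<Longrightarrow> k t \<le> M"
    unfolding bounded_real by (force simp: abs_le_iff)
  have "u (\<gamma> t) \<le> ereal M" if "t \<in> {0..2*pi}" for t
    using le[OF that] M[OF that] by (meson ereal_less_eq(3) order_trans)
  then have *: "u c \<le> ereal M - ereal (1 / (2*pi)) *
          enn2ereal (\<integral>\<^sup>+ t. e2ennreal (ereal M - u (\<gamma> t)) * indicator {0..2*pi} t \<partial>lborel)"
    (is "_ \<le> _ - _ * enn2ereal ?J") using sub unfolding submean_def by blast
  have "ennreal (integral {0..2*pi} (\<lambda>t. M - k t)) = (\<integral>\<^sup>+ t. ennreal (M - k t) * indicator {0..2*pi} t \<partial>lborel)"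
    by (rule nn_integral_continuous_interval[symmetric]) (use M cont in \<open>auto intro!: continuous_intros\<close>)
  also have "\<dots> \<le> ?J"
  proof (intro nn_integral_mono)
    fix t
    show "ennreal (M - k t) * indicator {0..2*pi} t \<le> e2ennreal (ereal M - u (\<gamma> t)) * indicator {0..2*pi} t"
    proof (cases "t \<in> {0..2*pi}")
      case True
      have "ereal (M - k t) \<le> ereal M - u (\<gamma> t)" using le[OF True]
        by (cases "u (\<gamma> t)") auto
      then have "e2ennreal (ereal (M - k t)) \<le> e2ennreal (ereal M - u (\<gamma> t))" by (rule e2ennreal_mono)
      then show ?thesis using True by (simp add: e2ennreal_ereal)
    qed simp
  qed
  finally have "ennreal (integral {0..2*pi} (\<lambda>t. M - k t)) \<le> ?J" .
  moreover have "integral {0..2*pi} (\<lambda>t. M - k t) = 2 * pi * M - integral {0..2*pi} k"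
    using cont by (subst integral_diff) (auto intro!: integrable_continuous_real)
  moreover have "integral {0..2*pi} (\<lambda>t. M - k t) \<ge> 0" using M by (intro integral_nonneg integrable_continuous_real continuous_intros cont) auto
  ultimately have "ereal (2 * pi * M - integral {0..2*pi} k) \<le> enn2ereal ?J"
    by (metis enn2ereal_ennreal less_eq_ennreal.rep_eq)
  then show ?thesis using *
    by (cases "enn2ereal ?J"; cases "u c") (auto simp: field_simps)
qed

text \<open>Monotone convergence for the increasing functions \<open>M' - S n\<close>; the result
  for \<open>M'\<close> is then carried over to the arbitrary bound \<open>M\<close> demanded by
  \<open>submean\<close>.\<close>

lemma submean_decreasing_limit:
  fixes S :: "nat \<Rightarrow> 'a \<Rightarrow> real"
  assumes cont: "\<And>n. continuous_on {0..2*pi} (\<lambda>t. S n (\<gamma> t))"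
    and dec: "\<And>n t. t \<in> {0..2*pi} \<Longrightarrow> S (Suc n) (\<gamma> t) \<le> S n (\<gamma> t)"
    and lim: "\<And>t. t \<in> {0..2*pi} \<Longrightarrow> (\<lambda>n. ereal (S n (\<gamma> t))) \<longlonglongrightarrow> u (\<gamma> t)"
    and limc: "(\<lambda>n. ereal (S n c)) \<longlonglongrightarrow> u c" and uc: "u c \<noteq> \<infinity>"
    and sub: "\<And>n. S n c \<le> integral {0..2*pi} (\<lambda>t. S n (\<gamma> t)) / (2*pi)"
  shows "submean u c \<gamma>"
  unfolding submean_def
proof (intro allI impI)
  fix M :: real assume M: "\<forall>t\<in>{0..2*pi}. u (\<gamma> t) \<le> ereal M"
  have decseq: "decseq (\<lambda>n. S n (\<gamma> t))" if "t \<in> {0..2*pi}" for t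
    using dec[OF that] by (intro decseq_SucI)
  have "bounded ((\<lambda>t. S 0 (\<gamma> t)) ` {0..2*pi})" using cont by (intro compact_imp_bounded compact_continuous_image) auto
  then obtain M0 where M0: "\<And>t. t \<in> {0..2*pi} \<Longrightarrow> S 0 (\<gamma> t) \<le> M0"
    unfolding bounded_real by (force simp: abs_le_iff)
  \<comment> \<open>\<open>M\<close> bounds only the limit \<open>u\<close>; \<open>M'\<close> also
    bounds every \<open>S n\<close> on the loop, which keeps all integrands nonnegative.\<close>
  define M' where "M' = max M M0"
  have M': "S n (\<gamma> t) \<le> M'" if "t \<in> {0..2*pi}" for n t
    using M0[OF that] decseqD[OF decseq[OF that], of 0 n] unfolding M'_def by simp
  let ?J = "\<lambda>M. \<integral>\<^sup>+ t. e2ennreal (ereal M - u (\<gamma> t)) * indicator {0..2*pi} t \<partial>lborel"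
  let ?g = "\<lambda>n t. ennreal (M' - S n (\<gamma> t)) * indicator {0..2*pi} t"
  have meas: "?g n \<in> borel_measurable lborel" for n
  proof -
    have "(\<lambda>t. indicator {0..2*pi} t *\<^sub>R (M' - S n (\<gamma> t))) \<in> borel_measurable borel"
      by (intro borel_measurable_continuous_on_indicator continuous_intros cont) auto
    then have "(\<lambda>t. ennreal (indicator {0..2*pi} t *\<^sub>R (M' - S n (\<gamma> t)))) \<in> borel_measurable lborel"
      by measurable
    moreover have "(\<lambda>t. ennreal (indicator {0..2*pi} t *\<^sub>R (M' - S n (\<gamma> t)))) = ?g n"
      by (auto simp: indicator_def fun_eq_iff)
    ultimately show ?thesis by simp
  qed
  have incg: "incseq ?g"
    by (intro incseq_SucI le_funI) (auto simp: indicator_def intro!: ennreal_leI dec)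
  have limg: "(\<lambda>n. ?g n t) \<longlonglongrightarrow> e2ennreal (ereal M' - u (\<gamma> t)) * indicator {0..2*pi} t" for t
  proof (cases "t \<in> {0..2*pi}")
    case True
    have "u (\<gamma> t) \<noteq> \<infinity>" using M True by fastforce
    then have "(\<lambda>n. ereal M' - ereal (S n (\<gamma> t))) \<longlonglongrightarrow> ereal M' - u (\<gamma> t)"
      by (intro tendsto_diff_ereal_general lim True tendsto_const) auto
    then have "(\<lambda>n. e2ennreal (ereal M' - ereal (S n (\<gamma> t)))) \<longlonglongrightarrow> e2ennreal (ereal M' - u (\<gamma> t))"
      by (intro tendsto_e2ennrealI)
    then show ?thesis using True by (simp add: e2ennreal_ereal)
  qed simp
  have sup: "(SUP n. ?g n t) = e2ennreal (ereal M' - u (\<gamma> t)) * indicator {0..2*pi} t" for t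
    using LIMSEQ_unique[OF LIMSEQ_SUP limg] incg by (simp add: mono_def le_fun_def)
  have J: "?J M' = (SUP n. integral\<^sup>N lborel (?g n))"
    using nn_integral_monotone_convergence_SUP[OF incg meas] by (simp add: sup)
  have gn: "integral\<^sup>N lborel (?g n) = ennreal (2 * pi * M' - integral {0..2*pi} (\<lambda>t. S n (\<gamma> t)))" for n
  proof -
    have "integral\<^sup>N lborel (?g n) = ennreal (integral {0..2*pi} (\<lambda>t. M' - S n (\<gamma> t)))"
      by (rule nn_integral_continuous_interval) (use M' in \<open>auto intro!: continuous_intros cont\<close>)
    also have "integral {0..2*pi} (\<lambda>t. M' - S n (\<gamma> t)) = 2 * pi * M' - integral {0..2*pi} (\<lambda>t. S n (\<gamma> t))"
      using cont by (subst integral_diff) (auto intro!: integrable_continuous_real)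
    finally show ?thesis .
  qed
  have decc: "S n c \<le> M'" for n
  proof -
    have "integral {0..2*pi} (\<lambda>t. S n (\<gamma> t)) \<le> integral {0..2*pi} (\<lambda>t. M')"
      using M' by (intro integral_le integrable_continuous_real cont) auto
    then have "integral {0..2*pi} (\<lambda>t. S n (\<gamma> t)) / (2 * pi) \<le> M'" by (simp add: field_simps)
    then show ?thesis using sub[of n] by linarith
  qed
  have main: "enn2ereal (?J M') \<le> ereal (2 * pi) * (ereal M' - u c)"
  proof -
    have l1: "(\<lambda>n. ereal (2 * pi) * (ereal M' - ereal (S n c))) \<longlonglongrightarrow> ereal (2 * pi) * (ereal M' - u c)"
      by (intro tendsto_cmult_ereal tendsto_diff_ereal_general limc tendsto_const) (use uc in auto)
    have "incseq (\<lambda>n. integral\<^sup>N lborel (?g n))"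
      using incg by (auto simp: mono_def le_fun_def intro!: nn_integral_mono)
    then have "(\<lambda>n. integral\<^sup>N lborel (?g n)) \<longlonglongrightarrow> ?J M'" unfolding J by (rule LIMSEQ_SUP)
    then have l2: "(\<lambda>n. enn2ereal (integral\<^sup>N lborel (?g n))) \<longlonglongrightarrow> enn2ereal (?J M')"
      by (rule tendsto_enn2erealI)
    have "enn2ereal (integral\<^sup>N lborel (?g n)) \<le> ereal (2 * pi) * (ereal M' - ereal (S n c))" for n
    proof -
      have "2 * pi * M' - integral {0..2*pi} (\<lambda>t. S n (\<gamma> t)) \<le> 2 * pi * (M' - S n c)"
        using sub[of n] by (simp add: field_simps)
      moreover have "2 * pi * (M' - S n c) \<ge> 0" using decc[of n] by simp
      ultimately have "integral\<^sup>N lborel (?g n) \<le> ennreal (2 * pi * (M' - S n c))"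
        unfolding gn by (intro ennreal_leI)
      then have "enn2ereal (integral\<^sup>N lborel (?g n)) \<le> ereal (2 * pi * (M' - S n c))"
        using \<open>2 * pi * (M' - S n c) \<ge> 0\<close> by (metis enn2ereal_ennreal less_eq_ennreal.rep_eq)
      then show ?thesis by simp
    qed
    then show ?thesis by (intro LIMSEQ_le[OF l2 l1]) auto
  qed
  \<comment> \<open>Splitting the integral for \<open>M'\<close> into two summands needs
    measurability of the one with \<open>M\<close>; it is inherited from the limit of the
    \<open>?g n\<close> by subtracting a constant.\<close>
  have um: "(\<lambda>t. e2ennreal (ereal M - u (\<gamma> t)) * indicator {0..2*pi} t) \<in> borel_measurable lborel"
  proof -
    have "(\<lambda>t. (SUP n. ?g n t)) \<in> borel_measurable lborel" by (intro borel_measurable_SUP meas) auto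
    then have "(\<lambda>t. e2ennreal (ereal M' - u (\<gamma> t)) * indicator {0..2*pi} t) \<in> borel_measurable lborel"
      by (simp add: sup)
    then have "(\<lambda>t. e2ennreal (ereal M' - u (\<gamma> t)) * indicator {0..2*pi} t - ennreal (M' - M) * indicator {0..2*pi} t) \<in> borel_measurable lborel"
      by measurable
    moreover have "e2ennreal (ereal M' - u (\<gamma> t)) * indicator {0..2*pi} t - ennreal (M' - M) * indicator {0..2*pi} t
        = e2ennreal (ereal M - u (\<gamma> t)) * indicator {0..2*pi} t" for t
    proof (cases "t \<in> {0..2*pi}")
      case True
      have "u (\<gamma> t) \<le> ereal M" using M True by auto
      then show ?thesis using True unfolding M'_def
        by (cases "u (\<gamma> t)") (auto simp: e2ennreal_ereal ennreal_minus max_def e2ennreal_infty)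
    qed simp
    ultimately show ?thesis by simp
  qed
  have "?J M' = (\<integral>\<^sup>+ t. ennreal (M' - M) * indicator {0..2*pi} t + e2ennreal (ereal M - u (\<gamma> t)) * indicator {0..2*pi} t \<partial>lborel)"
  proof (intro nn_integral_cong)
    fix t
    show "e2ennreal (ereal M' - u (\<gamma> t)) * indicator {0..2*pi} t = ennreal (M' - M) * indicator {0..2*pi} t + e2ennreal (ereal M - u (\<gamma> t)) * indicator {0..2*pi} t"
    proof (cases "t \<in> {0..2*pi}")
      case True
      have "u (\<gamma> t) \<le> ereal M" using M True by auto
      then show ?thesis using True unfolding M'_def
        by (cases "u (\<gamma> t)") (auto simp: e2ennreal_ereal ennreal_plus[symmetric] max_def e2ennreal_infty simp del: ennreal_plus)
    qed simp
  qed
  also have "\<dots> = ennreal (2 * pi * (M' - M)) + ?J M"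
    using um unfolding M'_def
    by (subst nn_integral_add) (auto simp: nn_integral_cmult_indicator ennreal_mult'[symmetric] mult_ac)
  finally have JJ: "enn2ereal (?J M') = ereal (2 * pi * (M' - M)) + enn2ereal (?J M)"
    by (simp add: plus_ennreal.rep_eq M'_def)
  have main2: "ereal (2 * pi * (M' - M)) + enn2ereal (?J M) \<le> ereal (2 * pi) * (ereal M' - u c)"
    using main JJ by simp
  show "u c \<le> ereal M - ereal (1 / (2*pi)) * enn2ereal (?J M)"
    using main2 uc by (cases "enn2ereal (?J M)"; cases "u c") (auto simp: field_simps)
qed

section \<open>Plurisubharmonicity along complex lines\<close>

definition cline :: "complex \<times> complex \<Rightarrow> complex \<times> complex \<Rightarrow> complex \<Rightarrow> complex \<times> complex" where
  "cline a b \<zeta> = (fst a + \<zeta> * fst b, snd a + \<zeta> * snd b)"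

lemma fst_cline [simp]: "fst (cline a b \<zeta>) = fst a + \<zeta> * fst b"
  and snd_cline [simp]: "snd (cline a b \<zeta>) = snd a + \<zeta> * snd b"
  and cline_0 [simp]: "cline a b 0 = a"
  by (auto simp: cline_def)

lemma dist_cline: "dist a (cline a b \<zeta>) = norm \<zeta> * norm b"
proof -
  have "dist a (cline a b \<zeta>) = sqrt ((norm \<zeta>)\<^sup>2 * ((norm (fst b))\<^sup>2 + (norm (snd b))\<^sup>2))"
    by (cases a; cases b) (simp add: dist_prod_def dist_norm norm_mult power_mult_distrib algebra_simps)
  then show ?thesis by (cases b) (simp add: real_sqrt_mult norm_prod_def)
qed

lemma cline_cline: "cline (cline a b z) (\<rho> *\<^sub>R b) \<zeta> = cline a b (z + of_real \<rho> * \<zeta>)"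
  by (cases a; cases b) (simp add: cline_def scaleR_conv_of_real algebra_simps)

lemma continuous_on_cline [continuous_intros]:
  "continuous_on S g \<Longrightarrow> continuous_on S (\<lambda>\<zeta>. cline a b (g \<zeta>))"
  unfolding cline_def by (intro continuous_intros)

lemma cline_in_ball: "norm b < r \<Longrightarrow> norm \<zeta> \<le> 1 \<Longrightarrow> cline x b \<zeta> \<in> ball x r"
  using mult_right_mono[of "norm \<zeta>" 1 "norm b"] by (simp add: dist_cline)

lemma cline_ball_subset: "norm b < r \<Longrightarrow> cball 0 1 \<subseteq> {\<zeta>. cline x b \<zeta> \<in> ball x r}"
  by (intro subsetI CollectI cline_in_ball) (simp_all add: mem_cball_0)

text \<open>The vector \<open>b\<close> encodes both the direction and the radius of a disc in a
  complex line through \<open>x\<close>; continuity near \<open>x\<close> makes every mean an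
  integral of a continuous function.\<close>

definition submean_at :: "(complex \<times> complex \<Rightarrow> real) \<Rightarrow> complex \<times> complex \<Rightarrow> bool" where
  "submean_at \<phi> x \<longleftrightarrow> (\<exists>r>0. continuous_on (ball x r) \<phi> \<and>
     (\<forall>b. norm b < r \<longrightarrow> \<phi> x \<le> circ_mean (\<lambda>\<zeta>. \<phi> (cline x b \<zeta>))))"

lemma continuous_on_circle_cline:
  assumes "continuous_on (ball x r) \<phi>" "norm b < r"
  shows "continuous_on (cball 0 1) (\<lambda>\<zeta>. \<phi> (cline x b \<zeta>))"
    and "continuous_on (sphere 0 1) (\<lambda>\<zeta>. \<phi> (cline x b \<zeta>))"
proof -
  show "continuous_on (cball 0 1) (\<lambda>\<zeta>. \<phi> (cline x b \<zeta>))"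
  proof (rule continuous_on_compose2[OF assms(1)])
    show "continuous_on (cball 0 1) (cline x b)"
      using continuous_on_cline[OF continuous_on_id] by simp
    show "cline x b ` cball 0 1 \<subseteq> ball x r"
      using cline_in_ball[OF assms(2)] by (metis image_subsetI mem_cball_0)
  qed
  then show "continuous_on (sphere 0 1) (\<lambda>\<zeta>. \<phi> (cline x b \<zeta>))"
    by (rule continuous_on_subset) auto
qed

text \<open>A function touching \<open>u\<close> from below at \<open>x\<close> hands its mean
  inequality over to \<open>u\<close>. All gluing rests on this: where a maximum switches, one local
  minorant with equality at the point is enough.\<close>

lemma submean_atI_support:
  assumes "submean_at \<phi> x" "open S" "x \<in> S" "continuous_on S u" "u x \<le> \<phi> x"
    "\<And>y. y \<in> S \<Longrightarrow> \<phi> y \<le> u y"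
  shows "submean_at u x"
proof -
  obtain r where r: "r > 0" "continuous_on (ball x r) \<phi>"
    "\<And>b. norm b < r \<Longrightarrow> \<phi> x \<le> circ_mean (\<lambda>\<zeta>. \<phi> (cline x b \<zeta>))"
    using assms(1) unfolding submean_at_def by auto
  obtain s where s: "s > 0" "ball x s \<subseteq> S" using assms(2,3) openE by blast
  define t where "t = min r s"
  have t: "t > 0" "ball x t \<subseteq> ball x r" "ball x t \<subseteq> S" using r s unfolding t_def by auto
  have cu: "continuous_on (ball x t) u" using assms(4) t continuous_on_subset by blast
  have cp: "continuous_on (ball x t) \<phi>" using r(2) t continuous_on_subset by blast
  have "u x \<le> circ_mean (\<lambda>\<zeta>. u (cline x b \<zeta>))" if b: "norm b < t" for b
  proof -
    have "u x \<le> circ_mean (\<lambda>\<zeta>. \<phi> (cline x b \<zeta>))" using r(3)[of b] assms(5) b t_def by simp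
    also have "\<dots> \<le> circ_mean (\<lambda>\<zeta>. u (cline x b \<zeta>))"
    proof (intro circ_mean_mono continuous_on_circle_cline(2)[OF cp b] continuous_on_circle_cline(2)[OF cu b])
      show "\<phi> (cline x b z) \<le> u (cline x b z)" if "norm z = 1" for z
        by (intro assms(6) subsetD[OF t(3)] cline_in_ball[OF b]) (simp add: that)
    qed
    finally show ?thesis .
  qed
  then show ?thesis unfolding submean_at_def using t cu by blast
qed

lemma submean_at_const: "submean_at (\<lambda>y. c) x"
  unfolding submean_at_def by (rule exI[of _ 1]) auto

lemma submean_at_add:
  assumes "submean_at \<phi> x" "submean_at \<psi> x"
  shows "submean_at (\<lambda>y. \<phi> y + \<psi> y) x"
proof -
  obtain r where r: "r > 0" "continuous_on (ball x r) \<phi>"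
    "\<And>b. norm b < r \<Longrightarrow> \<phi> x \<le> circ_mean (\<lambda>\<zeta>. \<phi> (cline x b \<zeta>))"
    using assms(1) unfolding submean_at_def by auto
  obtain s where s: "s > 0" "continuous_on (ball x s) \<psi>"
    "\<And>b. norm b < s \<Longrightarrow> \<psi> x \<le> circ_mean (\<lambda>\<zeta>. \<psi> (cline x b \<zeta>))"
    using assms(2) unfolding submean_at_def by auto
  show ?thesis unfolding submean_at_def
  proof (intro exI[of _ "min r s"] conjI allI impI)
    have "continuous_on (ball x (min r s)) \<phi>" "continuous_on (ball x (min r s)) \<psi>"
      using r(2) s(2) by (auto elim!: continuous_on_subset)
    then show "continuous_on (ball x (min r s)) (\<lambda>y. \<phi> y + \<psi> y)" by (intro continuous_intros)
    fix b :: "complex \<times> complex" assume b: "norm b < min r s"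
    then have b': "norm b < r" "norm b < s" by auto
    show "\<phi> x + \<psi> x \<le> circ_mean (\<lambda>\<zeta>. \<phi> (cline x b \<zeta>) + \<psi> (cline x b \<zeta>))"
      unfolding circ_mean_add[OF continuous_on_circle_cline(2)[OF r(2) b'(1)] continuous_on_circle_cline(2)[OF s(2) b'(2)]]
      using r(3)[OF b'(1)] s(3)[OF b'(2)] by (rule add_mono)
  qed (use r s in auto)
qed

lemma submean_at_cmult:
  assumes "submean_at \<phi> x" "c \<ge> 0"
  shows "submean_at (\<lambda>y. c * \<phi> y) x"
proof -
  obtain r where r: "r > 0" "continuous_on (ball x r) \<phi>"
    "\<And>b. norm b < r \<Longrightarrow> \<phi> x \<le> circ_mean (\<lambda>\<zeta>. \<phi> (cline x b \<zeta>))"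
    using assms(1) unfolding submean_at_def by auto
  show ?thesis unfolding submean_at_def
    using r assms(2) by (intro exI[of _ r]) (auto simp: circ_mean_cmult intro!: continuous_intros mult_left_mono)
qed

lemma submean_at_cong:
  assumes "submean_at \<phi> x" "open S" "x \<in> S" "\<And>y. y \<in> S \<Longrightarrow> \<phi> y = u y"
  shows "submean_at u x"
proof -
  obtain r where r: "r > 0" "continuous_on (ball x r) \<phi>"
    using assms(1) unfolding submean_at_def by auto
  have "continuous_on (ball x r \<inter> S) \<phi>" using r(2) by (rule continuous_on_subset) auto
  then have "continuous_on (ball x r \<inter> S) u"
    by (rule iffD1[OF continuous_on_cong[OF refl], rotated]) (simp add: assms(4))
  then show ?thesis
    using assms(2-4) r(1) by (intro submean_atI_support[OF assms(1), where S = "ball x r \<inter> S"]) (simp_all add: open_Int)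
qed

lemma submean_at_max:
  assumes "submean_at \<phi> x" "submean_at \<psi> x"
  shows "submean_at (\<lambda>y. max (\<phi> y) (\<psi> y)) x"
proof -
  obtain r where r: "r > 0" "continuous_on (ball x r) \<phi>"
    using assms(1) unfolding submean_at_def by auto
  obtain s where s: "s > 0" "continuous_on (ball x s) \<psi>"
    using assms(2) unfolding submean_at_def by auto
  have "continuous_on (ball x (min r s)) \<phi>" "continuous_on (ball x (min r s)) \<psi>"
      using r(2) s(2) by (auto elim!: continuous_on_subset)
  then have c: "continuous_on (ball x (min r s)) (\<lambda>y. max (\<phi> y) (\<psi> y))" by (intro continuous_intros)
  show ?thesis
  proof (cases "\<phi> x \<ge> \<psi> x")
    case True
    show ?thesis by (rule submean_atI_support[OF assms(1) open_ball _ c]) (use True r s in auto)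
  next
    case False
    show ?thesis by (rule submean_atI_support[OF assms(2) open_ball _ c]) (use False r s in auto)
  qed
qed

section \<open>Holomorphic functions along complex lines\<close>

text \<open>For open \<open>S\<close> this is holomorphy in two variables, stated along complex
  lines because all means are taken there.\<close>

definition hol_lines :: "(complex \<times> complex) set \<Rightarrow> (complex \<times> complex \<Rightarrow> complex) \<Rightarrow> bool" where
  "hol_lines S F \<longleftrightarrow> continuous_on S F \<and>
     (\<forall>a b. (\<lambda>\<zeta>. F (cline a b \<zeta>)) holomorphic_on {\<zeta>. cline a b \<zeta> \<in> S})"

lemma hol_lines_subset: "hol_lines S F \<Longrightarrow> T \<subseteq> S \<Longrightarrow> hol_lines T F"
  unfolding hol_lines_def
  by (elim conjE, intro conjI allI) (erule continuous_on_subset, assumption, erule allE, erule allE, erule holomorphic_on_subset, blast)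

lemma hol_lines_fst:
  assumes "g holomorphic_on S" "open S"
  shows "hol_lines (S \<times> UNIV) (\<lambda>y. g (fst y))"
  unfolding hol_lines_def
proof (intro conjI allI)
  show "continuous_on (S \<times> UNIV) (\<lambda>y. g (fst y))"
    by (rule continuous_on_compose2[OF holomorphic_on_imp_continuous_on[OF assms(1)]]) (auto intro!: continuous_intros)
  show "(\<lambda>\<zeta>. g (fst (cline a b \<zeta>))) holomorphic_on {\<zeta>. cline a b \<zeta> \<in> S \<times> UNIV}" for a b
  proof -
    have "(g \<circ> (\<lambda>\<zeta>. fst a + \<zeta> * fst b)) holomorphic_on {\<zeta>. cline a b \<zeta> \<in> S \<times> UNIV}"
      by (rule holomorphic_on_compose_gen[OF _ assms(1)])
         (auto simp: mem_Times_iff intro!: holomorphic_intros)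
    then show ?thesis by (simp add: o_def)
  qed
qed

lemma hol_lines_snd: "hol_lines S (\<lambda>y. snd y)"
  unfolding hol_lines_def by (auto intro!: continuous_intros holomorphic_intros)

lemma hol_lines_mult: "hol_lines S F \<Longrightarrow> hol_lines S G \<Longrightarrow> hol_lines S (\<lambda>y. F y * G y)"
  unfolding hol_lines_def by (elim conjE, intro conjI allI continuous_on_mult holomorphic_on_mult; blast)

lemma hol_lines_diff: "hol_lines S F \<Longrightarrow> hol_lines S G \<Longrightarrow> hol_lines S (\<lambda>y. F y - G y)"
  unfolding hol_lines_def by (elim conjE, intro conjI allI continuous_on_diff holomorphic_on_diff; blast)

lemma cline_ball_preimage:
  "b \<noteq> 0 \<Longrightarrow> {\<zeta>. cline x b \<zeta> \<in> ball x r} = ball 0 (r / norm b)"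
  by (auto simp: dist_cline field_simps)

lemma submean_at_Re:
  assumes "hol_lines S F" "open S" "x \<in> S"
  shows "submean_at (\<lambda>y. Re (F y)) x"
proof -
  obtain r where r: "r > 0" "ball x r \<subseteq> S" using assms openE by blast
  have h: "hol_lines (ball x r) F" using hol_lines_subset[OF assms(1) r(2)] .
  show ?thesis unfolding submean_at_def
  proof (intro exI[of _ r] conjI allI impI)
    show c: "continuous_on (ball x r) (\<lambda>y. Re (F y))" using h unfolding hol_lines_def by (auto intro: continuous_intros)
    fix b :: "complex \<times> complex" assume b: "norm b < r"
    have "(\<lambda>\<zeta>. F (cline x b \<zeta>)) holomorphic_on {\<zeta>. cline x b \<zeta> \<in> ball x r}" using h unfolding hol_lines_def by blast
    moreover have "cball 0 1 \<subseteq> {\<zeta>. cline x b \<zeta> \<in> ball x r}" by (rule cline_ball_subset[OF b])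
    ultimately have "(\<lambda>\<zeta>. F (cline x b \<zeta>)) holomorphic_on cball 0 1" using holomorphic_on_subset by blast
    then have "circ_mean (\<lambda>\<zeta>. Re (F (cline x b \<zeta>))) = Re (F (cline x b 0))"
      by (intro circ_mean_Re_holomorphic holomorphic_on_imp_continuous_on) (auto elim!: holomorphic_on_subset)
    then show "Re (F x) \<le> circ_mean (\<lambda>\<zeta>. Re (F (cline x b \<zeta>)))" by simp
  qed (use r in auto)
qed

text \<open>A zero-free function on a convex set has a holomorphic logarithm, and
  \<open>ln (norm F)\<close> is the real part of it.\<close>

lemma ln_norm_circ_mean:
  assumes F: "F holomorphic_on S" and nz: "\<And>z. z \<in> S \<Longrightarrow> F z \<noteq> 0"
    and S: "open S" "convex S" "cball 0 1 \<subseteq> S"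
  shows "circ_mean (\<lambda>\<zeta>. ln (norm (F \<zeta>))) = ln (norm (F 0))"
proof -
  have "contractible S" using S(2) by (rule convex_imp_contractible)
  then obtain g where g: "g holomorphic_on S" "\<And>z. z \<in> S \<Longrightarrow> F z = exp (g z)"
    using contractible_imp_holomorphic_log[OF F _ nz] by metis
  have eq: "ln (norm (F z)) = Re (g z)" if "z \<in> S" for z using g(2)[OF that] by simp
  have gc: "g holomorphic_on cball 0 1" using g S holomorphic_on_subset by blast
  have "circ_mean (\<lambda>\<zeta>. ln (norm (F \<zeta>))) = circ_mean (\<lambda>\<zeta>. Re (g \<zeta>))"
    by (intro circ_mean_cong eq subsetD[OF S(3)]) simp
  also have "\<dots> = Re (g 0)"
    by (intro circ_mean_Re_holomorphic holomorphic_on_imp_continuous_on gc holomorphic_on_subset[OF gc] ball_subset_cball)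
  finally show ?thesis using eq[OF subsetD[OF S(3)], of 0] by simp
qed

lemma submean_at_ln_norm:
  assumes "hol_lines S F" "open S" "x \<in> S" "F x \<noteq> 0"
  shows "submean_at (\<lambda>y. ln (norm (F y))) x" "submean_at (\<lambda>y. - ln (norm (F y))) x"
proof -
  have "open (S \<inter> F -` (-{0}))" using assms unfolding hol_lines_def
    by (intro continuous_open_preimage) auto
  moreover have "x \<in> S \<inter> F -` (-{0})" using assms by simp
  ultimately obtain r where r: "r > 0" "ball x r \<subseteq> S \<inter> F -` (-{0})" by (rule openE)
  have h: "hol_lines (ball x r) F" using hol_lines_subset[OF assms(1)] r(2) by auto
  have nz: "F y \<noteq> 0" if "y \<in> ball x r" for y using that r by auto
  have m: "circ_mean (\<lambda>\<zeta>. ln (norm (F (cline x b \<zeta>)))) = ln (norm (F x))" if b: "norm b < r" for b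
  proof (cases "b = 0")
    case True
    then show ?thesis by (simp add: cline_def)
  next
    case False
    let ?S = "{\<zeta>. cline x b \<zeta> \<in> ball x r}"
    have "circ_mean (\<lambda>\<zeta>. ln (norm (F (cline x b \<zeta>)))) = ln (norm (F (cline x b 0)))"
    proof (rule ln_norm_circ_mean[where S = ?S])
      show "(\<lambda>\<zeta>. F (cline x b \<zeta>)) holomorphic_on ?S" using h unfolding hol_lines_def by blast
      show "open ?S" "convex ?S" unfolding cline_ball_preimage[OF False] by auto
      show "cball 0 1 \<subseteq> ?S" by (rule cline_ball_subset[OF b])
    qed (use nz in auto)
    then show ?thesis by simp
  qed
  have c: "continuous_on (ball x r) (\<lambda>y. ln (norm (F y)))"
    by (intro continuous_intros conjunct1[OF h[unfolded hol_lines_def]]) (use nz in auto)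
  show "submean_at (\<lambda>y. ln (norm (F y))) x"
    unfolding submean_at_def using r m c by (intro exI[of _ r]) auto
  have "circ_mean (\<lambda>\<zeta>. - ln (norm (F (cline x b \<zeta>)))) = - ln (norm (F x))" if b: "norm b < r" for b
    using m[OF b] circ_mean_cmult[of "-1"] by simp
  then show "submean_at (\<lambda>y. - ln (norm (F y))) x"
    unfolding submean_at_def using r c by (intro exI[of _ r]) (auto intro!: continuous_intros)
qed

definition cpsh_on :: "(complex \<times> complex) set \<Rightarrow> (complex \<times> complex \<Rightarrow> real) \<Rightarrow> bool" where
  "cpsh_on \<Omega> u \<longleftrightarrow> continuous_on \<Omega> u \<and> (\<forall>x\<in>\<Omega>. submean_at u x)"

text \<open>Along the line, \<open>submean_at\<close> supplies small circles around every point of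
  the open disc, so the local-to-global principle in one variable applies.\<close>

lemma cpsh_on_circ_mean:
  assumes u: "cpsh_on \<Omega> u" and sub: "\<And>w. norm w \<le> 1 \<Longrightarrow> cline a b w \<in> \<Omega>"
  shows "u a \<le> circ_mean (\<lambda>\<zeta>. u (cline a b \<zeta>))"
proof -
  have "u (cline a b 0) \<le> circ_mean (\<lambda>\<zeta>. u (cline a b \<zeta>))"
  proof (rule submean_disc_local_to_global)
    show "continuous_on (cball 0 1) (\<lambda>\<zeta>. u (cline a b \<zeta>))"
    proof (rule continuous_on_compose2[where g = u and t = \<Omega>])
      show "continuous_on \<Omega> u" using u unfolding cpsh_on_def by blast
      show "continuous_on (cball 0 1) (cline a b)"
        using continuous_on_cline[OF continuous_on_id] by simp
      show "cline a b ` cball 0 1 \<subseteq> \<Omega>" by (intro image_subsetI sub) simp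
    qed
    fix z :: complex assume z: "norm z < 1"
    have "submean_at u (cline a b z)" using u sub[of z] z unfolding cpsh_on_def by simp
    then obtain r where r: "r > 0" "\<And>b'. norm b' < r \<Longrightarrow> u (cline a b z) \<le> circ_mean (\<lambda>\<zeta>. u (cline (cline a b z) b' \<zeta>))"
      unfolding submean_at_def by blast
    show "\<exists>r>0. \<forall>\<rho>. 0 < \<rho> \<and> \<rho> < r \<longrightarrow> u (cline a b z) \<le> circ_mean (\<lambda>\<zeta>. u (cline a b (z + of_real \<rho> * \<zeta>)))"
    \<comment> \<open>The summand \<open>1\<close> avoids a division by zero for
      \<open>b = 0\<close>.\<close>
    proof (intro exI[of _ "r / (norm b + 1)"] conjI allI impI)
      have n: "norm b + 1 > 0" by (simp add: add_nonneg_pos)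
      show "r / (norm b + 1) > 0" using r(1) n by simp
      fix \<rho> assume \<rho>: "0 < \<rho> \<and> \<rho> < r / (norm b + 1)"
      then have "\<rho> * (norm b + 1) < r" using n by (simp add: field_simps)
      moreover have "\<rho> * norm b \<le> \<rho> * (norm b + 1)" using \<rho> by simp
      ultimately have "\<rho> * norm b < r" by (rule le_less_trans[rotated])
      then have "norm (\<rho> *\<^sub>R b) < r" using \<rho> by simp
      from r(2)[OF this] show "u (cline a b z) \<le> circ_mean (\<lambda>\<zeta>. u (cline a b (z + of_real \<rho> * \<zeta>)))"
        by (simp only: cline_cline)
    qed
  qed
  then show ?thesis by simp
qed

lemma cpsh_on_add: "cpsh_on \<Omega> u \<Longrightarrow> cpsh_on \<Omega> v \<Longrightarrow> cpsh_on \<Omega> (\<lambda>x. u x + v x)"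
  unfolding cpsh_on_def by (blast intro: continuous_on_add submean_at_add)

lemma cpsh_on_const: "cpsh_on \<Omega> (\<lambda>x. c)"
  unfolding cpsh_on_def by (blast intro: continuous_on_const submean_at_const)

lemma cpsh_on_cmult: "cpsh_on \<Omega> u \<Longrightarrow> 0 \<le> c \<Longrightarrow> cpsh_on \<Omega> (\<lambda>x. c * u x)"
  unfolding cpsh_on_def using submean_at_cmult continuous_on_mult[OF continuous_on_const] by blast

lemma cpsh_on_max: "cpsh_on \<Omega> u \<Longrightarrow> cpsh_on \<Omega> v \<Longrightarrow> cpsh_on \<Omega> (\<lambda>x. max (u x) (v x))"
  unfolding cpsh_on_def by (blast intro: continuous_on_max submean_at_max)

lemma cpsh_on_sum: "(\<And>k. k \<in> I \<Longrightarrow> cpsh_on \<Omega> (u k)) \<Longrightarrow> cpsh_on \<Omega> (\<lambda>x. \<Sum>k\<in>I. u k x)"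
  by (induction I rule: infinite_finite_induct) (auto intro: cpsh_on_const cpsh_on_add)

text \<open>On \<open>X j\<close> the terms from index \<open>j\<close> on are nonpositive, so the
  partial sums decrease there: the limit exists, is upper semicontinuous as an infimum of continuous
  functions, and inherits the mean inequality because every closed disc lies in one
  \<open>X j\<close>. Infinitely many terms below \<open>-1\<close> force the value
  \<open>-\<infinity>\<close>; the geometric lower bounds exclude it.\<close>

lemma complete_pluripolar_series:
  fixes u :: "nat \<Rightarrow> complex \<times> complex \<Rightarrow> real"
  assumes \<Omega>: "open \<Omega>" and X: "\<And>k. X k \<subseteq> interior (X (Suc k))"
    and cover: "\<And>C. compact C \<Longrightarrow> C \<subseteq> \<Omega> \<Longrightarrow> \<exists>k. C \<subseteq> X k"
    and u: "\<And>k. cpsh_on \<Omega> (u k)" and neg: "\<And>k x. x \<in> X k \<Longrightarrow> u k x \<le> 0"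
    and E: "E \<subseteq> \<Omega>" "\<And>x. x \<in> E \<Longrightarrow> eventually (\<lambda>k. u k x \<le> -1) sequentially"
      "\<And>x. x \<in> \<Omega> - E \<Longrightarrow> eventually (\<lambda>k. u k x \<ge> -((1/2)^k)) sequentially"
  shows "complete_pluripolar \<Omega> E"
proof -
  define S where "S = (\<lambda>n x. \<Sum>k<n. u k x)"
  define U where "U x = lim (\<lambda>n. ereal (S n x))" for x
  have cpS: "cpsh_on \<Omega> (S n)" for n unfolding S_def by (rule cpsh_on_sum) (rule u)
  have Xmono: "X i \<subseteq> X j" if "i \<le> j" for i j
    by (rule lift_Suc_mono_le[of X, OF _ that]) (use X interior_subset in blast)
  have neg': "u k x \<le> 0" if "x \<in> X j" "j \<le> k" for x j k
    using neg[of x k] Xmono[OF that(2)] that(1) by blast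
  have dec: "S (Suc n) x \<le> S n x" if "x \<in> X j" "j \<le> n" for x j n
    using neg'[OF that] unfolding S_def by simp
  have decseq: "decseq (\<lambda>n. S (j + n) x)" if "x \<in> X j" for x j
    using dec[OF that, of "j + _"] by (intro decseq_SucI) simp
  have limU: "(\<lambda>n. ereal (S n x)) \<longlonglongrightarrow> U x" if "x \<in> X j" for x j
  proof -
    have "decseq (\<lambda>n. ereal (S (n + j) x))" using decseq[OF that] by (simp add: decseq_def add.commute)
    then have "(\<lambda>n. ereal (S (n + j) x)) \<longlonglongrightarrow> (INF n. ereal (S (n + j) x))" by (rule LIMSEQ_INF)
    then have "(\<lambda>n. ereal (S n x)) \<longlonglongrightarrow> (INF n. ereal (S (n + j) x))" by (rule LIMSEQ_offset)
    then show ?thesis unfolding U_def by (simp add: limI)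
  qed
  have Ule: "U x \<le> ereal (S n x)" if "x \<in> X j" "j \<le> n" for x j n
  proof (rule LIMSEQ_le_const2[OF limU[OF that(1)]])
    have "S m x \<le> S n x" if "m \<ge> n" for m
      using decseqD[OF decseq[OF \<open>x \<in> X j\<close>], of "n - j" "m - j"] \<open>j \<le> n\<close> that by simp
    then show "\<exists>N. \<forall>m\<ge>N. ereal (S m x) \<le> ereal (S n x)" by auto
  qed
  have inX: "\<exists>j. x \<in> X j" if "x \<in> \<Omega>" for x using cover[of "{x}"] that by auto
  have "psh_on \<Omega> U"
    unfolding psh_on_def
  proof (intro conjI ballI allI impI)
    show "usc_on \<Omega> U"
      unfolding usc_on_def
    proof (intro ballI allI impI)
      fix x c assume x: "x \<in> \<Omega>" and c: "U x < c"
      obtain j where j: "x \<in> X j" using inX[OF x] by auto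
      have "eventually (\<lambda>n. ereal (S n x) < c) sequentially"
        using order_tendstoD(2)[OF limU[OF j] c] .
      then obtain n0 where n0: "\<And>n. n \<ge> n0 \<Longrightarrow> ereal (S n x) < c" unfolding eventually_sequentially by auto
      \<comment> \<open>Points near \<open>x\<close> are only known to lie in
        \<open>X (Suc j)\<close>, where the sums decrease from index \<open>Suc j\<close>
        on.\<close>
      define n where "n = max n0 (Suc j)"
      have "continuous_on \<Omega> (\<lambda>y. ereal (S n y))"
        using cpS[of n] unfolding cpsh_on_def by (intro continuous_intros) auto
      then have "((\<lambda>y. ereal (S n y)) \<longlongrightarrow> ereal (S n x)) (at x within \<Omega>)"
        using x unfolding continuous_on_def by blast
      then have "eventually (\<lambda>y. ereal (S n y) < c) (at x within \<Omega>)"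
        by (rule order_tendstoD(2)) (use n0 n_def in auto)
      moreover have "eventually (\<lambda>y. y \<in> interior (X (Suc j))) (at x within \<Omega>)"
        using X[of j] j by (intro eventually_at_topological[THEN iffD2]) (auto intro!: exI[of _ "interior (X (Suc j))"])
      ultimately show "eventually (\<lambda>y. U y < c) (at x within \<Omega>)"
      proof eventually_elim
        case (elim y)
        then have "y \<in> X (Suc j)" using interior_subset by blast
        then have "U y \<le> ereal (S n y)" by (rule Ule) (simp add: n_def)
        then show ?case using elim by (rule_tac le_less_trans)
      qed
    qed
    fix x assume "x \<in> \<Omega>"
    then obtain j where "x \<in> X j" using inX by blast
    then have "U x \<le> ereal (S j x)" by (rule Ule) simp
    then show "U x \<noteq> \<infinity>" by auto
  next
    fix a b :: "complex \<times> complex"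
    assume "\<forall>w. cmod w \<le> 1 \<longrightarrow> (fst a + w * fst b, snd a + w * snd b) \<in> \<Omega>"
    then have disc: "cline a b w \<in> \<Omega>" if "norm w \<le> 1" for w using that by (simp add: cline_def)
    have "compact (cline a b ` cball 0 1)"
      using continuous_on_cline[OF continuous_on_id] by (intro compact_continuous_image compact_cball) simp
    moreover have "cline a b ` cball 0 1 \<subseteq> \<Omega>" by (intro image_subsetI disc) simp
    ultimately obtain j where j: "cline a b ` cball 0 1 \<subseteq> X j" using cover by blast
    have jX: "cline a b w \<in> X j" if "norm w \<le> 1" for w using j that by (simp add: image_subset_iff)
    let ?\<gamma> = "\<lambda>t. cline a b (exp (\<i> * complex_of_real t))"
    have g: "?\<gamma> t \<in> X j" for t by (rule jX) simp
    have a: "a \<in> X j" using jX[of 0] by simp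
    have "submean U a ?\<gamma>"
    proof (rule submean_decreasing_limit[where S = "\<lambda>n. S (n + j)"])
      fix n
      show "continuous_on {0..2*pi} (\<lambda>t. S (n + j) (?\<gamma> t))"
      proof (rule continuous_on_compose2[where g = "S (n + j)" and t = \<Omega>])
        show "continuous_on \<Omega> (S (n + j))" using cpS unfolding cpsh_on_def by blast
        show "continuous_on {0..2*pi} ?\<gamma>" by (intro continuous_intros)
        show "?\<gamma> ` {0..2*pi} \<subseteq> \<Omega>" by (intro image_subsetI disc) simp
      qed
      show "S (n + j) a \<le> integral {0..2*pi} (\<lambda>t. S (n + j) (?\<gamma> t)) / (2*pi)"
        using cpsh_on_circ_mean[OF cpS disc, of "n + j"] unfolding circ_mean_def by simp
      show "S (Suc n + j) (?\<gamma> t) \<le> S (n + j) (?\<gamma> t)" for t using dec[OF g, of "n + j" t] by simp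
    next
      show "(\<lambda>n. ereal (S (n + j) (?\<gamma> t))) \<longlonglongrightarrow> U (?\<gamma> t)" for t
        using limU[OF g] by (rule LIMSEQ_ignore_initial_segment)
      show "(\<lambda>n. ereal (S (n + j) a)) \<longlonglongrightarrow> U a"
        using limU[OF a] by (rule LIMSEQ_ignore_initial_segment)
      have "U a \<le> ereal (S j a)" by (rule Ule[OF a]) simp
      then show "U a \<noteq> \<infinity>" by auto
    qed
    then show "submean U a (\<lambda>t. (fst a + exp (\<i> * complex_of_real t) * fst b, snd a + exp (\<i> * complex_of_real t) * snd b))"
      by (simp add: cline_def)
  qed
  moreover have "U x = -\<infinity>" if xE: "x \<in> E" for x
  proof -
    have "x \<in> \<Omega>" using xE E by auto
    then obtain j where j: "x \<in> X j" using inX by blast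
    obtain n0 where n0: "\<And>n. n \<ge> n0 \<Longrightarrow> u n x \<le> -1" using E(2)[OF xE] unfolding eventually_sequentially by auto
    define m where "m = max j n0"
    have S: "S (m + n) x \<le> S m x - real n" for n
    proof (induction n)
      case (Suc n)
      have "u (m + n) x \<le> -1" by (rule n0) (simp add: m_def)
      then show ?case using Suc unfolding S_def by simp
    qed simp
    have "U x \<le> ereal B" for B
    proof -
      obtain n where n: "real n \<ge> S m x - B" using real_arch_simple by blast
      have "U x \<le> ereal (S (m + n) x)" by (rule Ule[OF j]) (simp add: m_def)
      also have "\<dots> \<le> ereal B" using S[of n] n by simp
      finally show ?thesis .
    qed
    then show ?thesis by (rule ereal_bot)
  qed
  moreover have "U x \<noteq> -\<infinity>" if xE: "x \<in> \<Omega> - E" for x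
  proof -
    have "x \<in> \<Omega>" using xE E by auto
    then obtain j where j: "x \<in> X j" using inX by blast
    obtain m where m: "\<And>n. n \<ge> m \<Longrightarrow> u n x \<ge> -((1/2)^n)" using E(3)[OF xE] unfolding eventually_sequentially by auto
    \<comment> \<open>The last summand is the part of the geometric series not yet spent; with it
      the induction closes.\<close>
    have S: "S (m + n) x \<ge> S m x - 2 * (1/2)^m + 2 * (1/2)^(m+n)" for n
    proof (induction n)
      case (Suc n)
      have "u (m + n) x \<ge> -((1/2)^(m+n))" by (rule m) simp
      then show ?case using Suc unfolding S_def by simp
    qed simp
    have "S n x \<ge> S m x - 2 * (1/2)^m" if "n \<ge> m" for n
      using S[of "n - m"] that by (simp add: order_trans[rotated])
    then have "ereal (S m x - 2 * (1/2)^m) \<le> U x"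
      by (intro LIMSEQ_le_const[OF limU[OF j]]) auto
    then show ?thesis by auto
  qed
  ultimately have "{z \<in> \<Omega>. U z = -\<infinity>} = E" using E(1) by blast
  then show ?thesis using \<open>psh_on \<Omega> U\<close> unfolding complete_pluripolar_def by blast
qed

section \<open>Chebyshev polynomials of polar sets\<close>

text \<open>The monic polynomial with the listed zeros. A list records multiplicities, so products
  and powers are concatenations.\<close>

definition lprod :: "complex list \<Rightarrow> complex \<Rightarrow> complex" where
  "lprod xs z = (\<Prod>x\<leftarrow>xs. z - x)"

lemma lprod_append: "lprod (xs @ ys) z = lprod xs z * lprod ys z"
  unfolding lprod_def by simp

lemma lprod_Cons: "lprod (x # xs) z = (z - x) * lprod xs z"
  and lprod_Nil: "lprod [] z = 1"
  unfolding lprod_def by simp_all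

lemma lprod_replicate: "lprod (concat (replicate m xs)) z = lprod xs z ^ m"
  by (induction m) (simp_all add: lprod_append lprod_Nil)

lemma lprod_holomorphic [holomorphic_intros]: "lprod xs holomorphic_on S"
proof (induction xs)
  case Nil
  then show ?case by (simp add: lprod_Nil[abs_def])
next
  case (Cons x xs)
  have "lprod (x # xs) = (\<lambda>z. (z - x) * lprod xs z)" by (simp add: lprod_Cons fun_eq_iff)
  then show ?case using Cons by (auto intro!: holomorphic_intros)
qed

lemma norm_lprod_le:
  assumes "\<And>x. x \<in> set xs \<Longrightarrow> norm (z - x) \<le> R" "R \<ge> 1" "length xs \<le> n"
  shows "norm (lprod xs z) \<le> R ^ n"
proof -
  have "norm (lprod xs z) \<le> R ^ length xs"
    using assms(1)
  proof (induction xs)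
    case (Cons x xs)
    then have "norm (z - x) * norm (lprod xs z) \<le> R * R ^ length xs"
      using assms(2) by (intro mult_mono) auto
    then show ?case by (simp add: lprod_Cons norm_mult)
  qed (simp add: lprod_Nil)
  also have "\<dots> \<le> R ^ n" using assms by (intro power_increasing)
  finally show ?thesis .
qed

lemma norm_lprod_ge:
  assumes "\<And>x. x \<in> set xs \<Longrightarrow> d \<le> norm (z - x)" "0 \<le> d" "d \<le> 1" "length xs \<le> n"
  shows "d ^ n \<le> norm (lprod xs z)"
proof -
  have "d ^ n \<le> d ^ length xs" using assms by (intro power_decreasing)
  also have "\<dots> \<le> norm (lprod xs z)"
    using assms(1)
  proof (induction xs)
    case (Cons x xs)
    then have "d * d ^ length xs \<le> norm (z - x) * norm (lprod xs z)"
      using assms(2) by (intro mult_mono) auto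
    then show ?case by (simp add: lprod_Cons norm_mult)
  qed (simp add: lprod_Nil)
  finally show ?thesis .
qed

lemma bounded_norm_diff:
  assumes "bounded K"
  obtains R :: real where "R \<ge> 1" "\<And>x y. x \<in> K \<Longrightarrow> y \<in> K \<Longrightarrow> norm (x - y) \<le> R"
proof
  show "max 1 (diameter K) \<ge> 1" by simp
  show "norm (x - y) \<le> max 1 (diameter K)" if "x \<in> K" "y \<in> K" for x y
    using diameter_bounded_bound[OF assms that] by (simp add: dist_norm)
qed

text \<open>The length is only bounded by \<open>n\<close>, so that the empty set is included.\<close>

definition cheb_zero :: "complex set \<Rightarrow> bool" where
  "cheb_zero K \<longleftrightarrow> (\<forall>c>0. \<exists>n\<ge>1. \<exists>xs. length xs \<le> n \<and> set xs \<subseteq> K \<and> (\<forall>z\<in>K. norm (lprod xs z) \<le> c ^ n))"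

lemma cheb_zero_empty: "cheb_zero {}"
  unfolding cheb_zero_def by auto

text \<open>Take the \<open>n2\<close>-th power of the first polynomial times the
  \<open>n1\<close>-th power of the second. On either set one factor is small and the other is
  bounded by a power of \<open>R\<close>; the choice \<open>e = c\<^sup>2 / R\<close> pays for that
  power, the product having formal degree \<open>2 * n1 * n2\<close>.\<close>

lemma cheb_zero_Un:
  assumes "cheb_zero K1" "cheb_zero K2" "bounded K1" "bounded K2"
  shows "cheb_zero (K1 \<union> K2)"
  unfolding cheb_zero_def
proof (intro allI impI)
  fix c :: real assume c: "c > 0"
  obtain R where R: "R \<ge> 1" "\<And>x y. x \<in> K1 \<union> K2 \<Longrightarrow> y \<in> K1 \<union> K2 \<Longrightarrow> norm (x - y) \<le> R"
    using bounded_norm_diff[of "K1 \<union> K2"] assms by auto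
  define e where "e = c\<^sup>2 / R"
  have e: "e > 0" using c R unfolding e_def by simp
  obtain n1 xs1 where 1: "n1 \<ge> 1" "length xs1 \<le> n1" "set xs1 \<subseteq> K1" "\<And>z. z \<in> K1 \<Longrightarrow> norm (lprod xs1 z) \<le> e ^ n1"
    using assms(1) e unfolding cheb_zero_def by metis
  obtain n2 xs2 where 2: "n2 \<ge> 1" "length xs2 \<le> n2" "set xs2 \<subseteq> K2" "\<And>z. z \<in> K2 \<Longrightarrow> norm (lprod xs2 z) \<le> e ^ n2"
    using assms(2) e unfolding cheb_zero_def by metis
  define xs where "xs = concat (replicate n2 xs1) @ concat (replicate n1 xs2)"
  have l: "norm (lprod xs z) = norm (lprod xs1 z) ^ n2 * norm (lprod xs2 z) ^ n1" for z
    unfolding xs_def by (simp add: lprod_append lprod_replicate norm_mult norm_power)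
  have ee: "(e * R) ^ (n1 * n2) = c ^ (2 * n1 * n2)"
    using R unfolding e_def by (simp add: power_mult mult.assoc)
  show "\<exists>n\<ge>1. \<exists>xs. length xs \<le> n \<and> set xs \<subseteq> K1 \<union> K2 \<and> (\<forall>z\<in>K1 \<union> K2. norm (lprod xs z) \<le> c ^ n)"
  proof (intro exI[of _ "2 * n1 * n2"] exI[of _ xs] conjI ballI)
    show "2 * n1 * n2 \<ge> 1" using 1 2 by simp
    have "length xs = n2 * length xs1 + n1 * length xs2" unfolding xs_def by (simp add: length_concat sum_list_replicate)
    also have "\<dots> \<le> n2 * n1 + n1 * n2" using 1 2 by (intro add_mono mult_left_mono) auto
    finally show "length xs \<le> 2 * n1 * n2" by (simp add: algebra_simps)
    show "set xs \<subseteq> K1 \<union> K2" unfolding xs_def using 1 2 by auto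
    fix z assume z: "z \<in> K1 \<union> K2"
    have b1: "norm (lprod xs1 z) \<le> R ^ n1" by (rule norm_lprod_le) (use 1 R z in auto)
    have b2: "norm (lprod xs2 z) \<le> R ^ n2" by (rule norm_lprod_le) (use 2 R z in auto)
    have "norm (lprod xs1 z) ^ n2 * norm (lprod xs2 z) ^ n1 \<le> (e * R) ^ (n1 * n2)"
    proof (cases "z \<in> K1")
      case True
      have "norm (lprod xs1 z) ^ n2 * norm (lprod xs2 z) ^ n1 \<le> (e ^ n1) ^ n2 * (R ^ n2) ^ n1"
        using 1(4)[OF True] b2 e by (intro mult_mono power_mono) auto
      then show ?thesis by (simp add: power_mult_distrib power_mult[symmetric] mult.commute)
    next
      case False
      then have "z \<in> K2" using z by auto
      have "norm (lprod xs1 z) ^ n2 * norm (lprod xs2 z) ^ n1 \<le> (R ^ n1) ^ n2 * (e ^ n2) ^ n1"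
        using 2(4)[OF \<open>z \<in> K2\<close>] b1 R e by (intro mult_mono power_mono) auto
      then show ?thesis by (simp add: power_mult_distrib power_mult[symmetric] mult.commute)
    qed
    then show "norm (lprod xs z) \<le> c ^ (2 * n1 * n2)" by (simp add: l ee)
  qed
qed

lemma cheb_zero_UN:
  assumes "finite I" "\<And>i. i \<in> I \<Longrightarrow> cheb_zero (K i)" "\<And>i. i \<in> I \<Longrightarrow> bounded (K i)"
  shows "cheb_zero (\<Union>i\<in>I. K i)"
  using assms by (induction I rule: finite_induct) (auto intro!: cheb_zero_Un cheb_zero_empty bounded_UN)

section \<open>Lagrange interpolation and nearly extremal Vandermonde products\<close>

text \<open>The difference of the two sides is a polynomial of degree below \<open>card S\<close>
  vanishing on \<open>S\<close>. The use: at every \<open>z\<close> some summand has modulus at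
  least \<open>1 / card S\<close>.\<close>

lemma lagrange_partition_of_unity:
  fixes S :: "complex set"
  assumes "finite S" "S \<noteq> {}"
  shows "(\<Sum>x\<in>S. \<Prod>y\<in>S-{x}. (z - y) / (x - y)) = 1"
proof -
  define P where "P = (\<Sum>x\<in>S. \<Prod>y\<in>S-{x}. smult (1 / (x - y)) [:- y, 1:]) - 1"
  have Pz: "poly P w = (\<Sum>x\<in>S. \<Prod>y\<in>S-{x}. (w - y) / (x - y)) - 1" for w
  proof -
    have "poly (smult (1 / (x - y)) [:- y, 1:]) w = (w - y) / (x - y)" for x y by (simp add: diff_divide_distrib)
    then show ?thesis unfolding P_def by (simp only: poly_diff poly_sum poly_prod poly_1)
  qed
  have root: "poly P w = 0" if w: "w \<in> S" for w
  proof -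
    have "(\<Sum>x\<in>S. \<Prod>y\<in>S-{x}. (w - y) / (x - y)) = (\<Sum>x\<in>S. if x = w then 1 else 0)"
    proof (rule sum.cong[OF refl])
      fix x assume x: "x \<in> S"
      show "(\<Prod>y\<in>S-{x}. (w - y) / (x - y)) = (if x = w then 1 else 0)"
      proof (cases "x = w")
        case True
        have "(w - y) / (x - y) = 1" if "y \<in> S - {x}" for y using that True by auto
        then show ?thesis using True by (simp add: prod.neutral)
      next
        case False
        then have "w \<in> S - {x}" using w by simp
        then have "(\<Prod>y\<in>S-{x}. (w - y) / (x - y)) = 0" using assms(1) by (intro prod_zero) auto
        then show ?thesis using False by simp
      qed
    qed
    then show ?thesis using w assms by (simp add: Pz)
  qed
  have "degree (\<Prod>y\<in>S-{x}. smult (1 / (x - y)) [:- y, 1:]) \<le> card S - 1" if "x \<in> S" for x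
  proof -
    have "degree (\<Prod>y\<in>S-{x}. smult (1 / (x - y)) [:- y, 1:]) \<le> (\<Sum>y\<in>S-{x}. degree (smult (1 / (x - y)) [:- y, 1:]))"
      using degree_prod_sum_le[of "S-{x}" "\<lambda>y. smult (1 / (x - y)) [:- y, 1:]"] assms(1)
      by (simp only: o_def finite_Diff)
    also have "\<dots> \<le> (\<Sum>y\<in>S-{x}. 1)" by (intro sum_mono) simp
    finally show ?thesis using that assms by simp
  qed
  then have "degree (\<Sum>x\<in>S. \<Prod>y\<in>S-{x}. smult (1 / (x - y)) [:- y, 1:]) \<le> card S - 1"
    using assms by (intro degree_sum_le) auto
  then have deg: "degree P \<le> card S - 1" unfolding P_def by (intro degree_diff_le) auto
  have "P = 0"
  proof (rule ccontr)
    assume "P \<noteq> 0"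
    then have "card {w. poly P w = 0} \<le> degree P" by (rule card_poly_roots_bound)
    moreover have "card S \<le> card {w. poly P w = 0}"
      using root poly_roots_finite[OF \<open>P \<noteq> 0\<close>] by (intro card_mono) auto
    moreover have "card S > 0" using assms by (simp add: card_gt_0_iff)
    ultimately show False using deg by linarith
  qed
  then have "poly P z = 0" by simp
  then show ?thesis by (simp add: Pz)
qed

text \<open>Every unordered pair occurs twice, so this is the squared modulus of the Vandermonde
  determinant of \<open>S\<close>.\<close>

definition vdm :: "complex set \<Rightarrow> real" where
  "vdm S = (\<Prod>x\<in>S. \<Prod>y\<in>S-{x}. norm (x - y))"

lemma vdm_insert:
  assumes "finite S" "x \<notin> S"
  shows "vdm (insert x S) = (\<Prod>y\<in>S. norm (x - y))\<^sup>2 * vdm S"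
proof -
  have "(\<Prod>y\<in>insert x S-{x'}. norm (x' - y)) = norm (x' - x) * (\<Prod>y\<in>S-{x'}. norm (x' - y))" if "x' \<in> S" for x'
  proof -
    have "insert x S - {x'} = insert x (S - {x'})" using assms that by auto
    then show ?thesis using assms by simp
  qed
  then have "(\<Prod>x'\<in>S. \<Prod>y\<in>insert x S-{x'}. norm (x' - y)) = (\<Prod>x'\<in>S. norm (x' - x)) * vdm S"
    unfolding vdm_def by (simp add: prod.distrib)
  moreover have "insert x S - {x} = S" using assms by auto
  ultimately show ?thesis using assms unfolding vdm_def
    by (simp add: power2_eq_square norm_minus_commute mult_ac)
qed

lemma vdm_pos: "finite S \<Longrightarrow> vdm S > 0"
  unfolding vdm_def by (intro prod_pos ballI) auto

text \<open>Choose \<open>S\<close> with \<open>vdm S\<close> above half of the supremum. Exchanging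
  \<open>x\<close> for \<open>z\<close> multiplies \<open>vdm\<close> by the square of the ratio of
  the two products, so this square is below \<open>2\<close>. Thus the Lagrange polynomials of
  \<open>S\<close> are bounded by \<open>2\<close> on \<open>K\<close>.\<close>

lemma near_fekete_set:
  fixes K :: "complex set"
  assumes K: "bounded K" "infinite K" and N: "N \<ge> 1"
  obtains S where "finite S" "S \<subseteq> K" "card S = N"
    "\<And>x z. x \<in> S \<Longrightarrow> z \<in> K \<Longrightarrow> (\<Prod>y\<in>S-{x}. norm (z - y)) \<le> 2 * (\<Prod>y\<in>S-{x}. norm (x - y))"
proof -
  obtain R where R: "R \<ge> 1" "\<And>x y. x \<in> K \<Longrightarrow> y \<in> K \<Longrightarrow> norm (x - y) \<le> R"
    using bounded_norm_diff[OF K(1)] by metis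
  let ?V = "{vdm S |S. finite S \<and> S \<subseteq> K \<and> card S = N}"
  have bdd: "bdd_above ?V"
  proof (rule bdd_aboveI)
    fix v assume "v \<in> ?V"
    then obtain S where S: "v = vdm S" "finite S" "S \<subseteq> K" "card S = N" by auto
    have "(\<Prod>y\<in>S-{x}. norm (x - y)) \<le> R ^ N" if "x \<in> S" for x
    proof -
      have "(\<Prod>y\<in>S-{x}. norm (x - y)) \<le> (\<Prod>y\<in>S-{x}. R)"
      proof (intro prod_mono conjI norm_ge_zero R(2))
        show "x \<in> K" "\<And>y. y \<in> S - {x} \<Longrightarrow> y \<in> K" using S(3) that by blast+
      qed
      also have "\<dots> = R ^ (N - 1)" using S that by simp
      also have "\<dots> \<le> R ^ N" using R(1) by (intro power_increasing) auto
      finally show ?thesis .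
    qed
    then have "vdm S \<le> (\<Prod>x\<in>S. R ^ N)"
      unfolding vdm_def by (intro prod_mono conjI prod_nonneg norm_ge_zero)
    then show "v \<le> (R ^ N) ^ N" using S by simp
  qed
  obtain S0 where "finite S0" "card S0 = N" "S0 \<subseteq> K" using infinite_arbitrarily_large[OF K(2)] by blast
  then have ne: "vdm S0 \<in> ?V" and pos: "vdm S0 > 0" using vdm_pos[of S0] by blast+
  have "Sup ?V > 0" using cSup_upper[OF ne bdd] pos by simp
  then have "Sup ?V / 2 < Sup ?V" by simp
  moreover have "?V \<noteq> {}" using ne by blast
  ultimately obtain v where "v \<in> ?V" "Sup ?V / 2 < v" using less_cSupD[of ?V "Sup ?V / 2"] by blast
  then obtain S where S: "finite S" "S \<subseteq> K" "card S = N" "Sup ?V / 2 < vdm S" by blast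
  then have S4: "Sup ?V < 2 * vdm S" by linarith
  show ?thesis
  proof (rule that[OF S(1-3)])
    fix x z assume x: "x \<in> S" and z: "z \<in> K"
    let ?S = "S - {x}"
    show "(\<Prod>y\<in>?S. norm (z - y)) \<le> 2 * (\<Prod>y\<in>?S. norm (x - y))" (is "?p \<le> 2 * ?q")
    proof (cases "z \<in> ?S")
      case True
      then have "?p = 0" using S by (intro prod_zero) auto
      then show ?thesis by (simp add: prod_nonneg)
    next
      case False
      have "insert x ?S = S" using x by auto
      then have vS: "vdm S = ?q\<^sup>2 * vdm ?S" using vdm_insert[of ?S x] S by simp
      have "card (insert z ?S) = N" using False x S N by simp
      then have "vdm (insert z ?S) \<in> ?V" using S z by blast
      then have "vdm (insert z ?S) \<le> Sup ?V" using bdd by (intro cSup_upper)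
      then have "?p\<^sup>2 * vdm ?S < 2 * (?q\<^sup>2 * vdm ?S)" using S4 vS vdm_insert[OF _ False] S(1) by simp
      then have "?p\<^sup>2 < 2 * ?q\<^sup>2" using vdm_pos[of ?S] S(1) by simp
      also have "2 * ?q\<^sup>2 \<le> (2 * ?q)\<^sup>2" by (simp add: power_mult_distrib)
      finally have lt: "?p\<^sup>2 < (2 * ?q)\<^sup>2" .
      have "0 \<le> 2 * ?q" by (simp add: prod_nonneg)
      with less_imp_le[OF lt] show ?thesis by (rule power2_le_imp_le)
    qed
  qed
qed

section \<open>Green potentials against subharmonic functions\<close>

lemma usc_on_subset: "usc_on U u \<Longrightarrow> S \<subseteq> U \<Longrightarrow> usc_on S u"
  unfolding usc_on_def by (meson at_le filter_leD subsetD)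

lemma usc_on_add_continuous:
  assumes "usc_on S u" "continuous_on S h"
  shows "usc_on S (\<lambda>x. u x + ereal (h x))"
  unfolding usc_on_def
proof (intro ballI allI impI)
  fix x c assume x: "x \<in> S" and c: "u x + ereal (h x) < c"
  obtain k where k: "u x + ereal (h x) < ereal k" "ereal k < c" using ereal_dense2[OF c] by auto
  have "u x < ereal (k - h x)" using k(1) by (cases "u x") auto
  then obtain m where m: "u x < ereal m" "ereal m < ereal (k - h x)" using ereal_dense2 by blast
  have 1: "eventually (\<lambda>y. u y < ereal m) (at x within S)" using assms(1) x m(1) unfolding usc_on_def by blast
  have "(h \<longlongrightarrow> h x) (at x within S)" using assms(2) x unfolding continuous_on_def by blast
  then have 2: "eventually (\<lambda>y. h y < k - m) (at x within S)" using m(2) by (intro order_tendstoD(2)) auto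
  show "eventually (\<lambda>y. u y + ereal (h y) < c) (at x within S)"
    using 1 2
  proof eventually_elim
    case (elim y)
    then have "u y + ereal (h y) < ereal k" by (cases "u y") auto
    then show ?case using k(2) by (rule less_trans)
  qed
qed

lemma usc_on_attains_sup:
  assumes S: "compact S" "S \<noteq> {}" and v: "usc_on S v"
  shows "\<exists>x\<in>S. \<forall>y\<in>S. v y \<le> (v x :: ereal)"
proof (rule ccontr)
  assume "\<not> ?thesis"
  then have *: "\<exists>y\<in>S. v x < v y" if "x \<in> S" for x using that by (metis not_le)
  have "\<exists>G y. open G \<and> x \<in> G \<and> y \<in> S \<and> (\<forall>z\<in>G \<inter> S. v z < v y)" if x: "x \<in> S" for x
  proof -
    obtain y where y: "y \<in> S" "v x < v y" using *[OF x] by auto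
    then have "eventually (\<lambda>z. v z < v y) (at x within S)" using v x unfolding usc_on_def by blast
    then obtain G where "open G" "x \<in> G" "\<forall>z\<in>G. z \<noteq> x \<longrightarrow> z \<in> S \<longrightarrow> v z < v y"
      unfolding eventually_at_topological by auto
    then show ?thesis using y by (intro exI[of _ G] exI[of _ y]) auto
  qed
  then obtain G y where Oy: "\<And>x. x \<in> S \<Longrightarrow> open (G x)" "\<And>x. x \<in> S \<Longrightarrow> x \<in> G x" "\<And>x. x \<in> S \<Longrightarrow> y x \<in> S"
    "\<And>x z. x \<in> S \<Longrightarrow> z \<in> G x \<inter> S \<Longrightarrow> v z < v (y x)" by metis
  have "S \<subseteq> (\<Union>x\<in>S. G x)" using Oy(2) by blast
  then obtain C where C: "C \<subseteq> S" "finite C" "S \<subseteq> (\<Union>x\<in>C. G x)"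
    using compactE_image[OF S(1), of S G] Oy(1) by metis
  have "C \<noteq> {}" using C S by auto
  define m where "m = Max ((\<lambda>x. v (y x)) ` C)"
  have "m \<in> (\<lambda>x. v (y x)) ` C" unfolding m_def using C \<open>C \<noteq> {}\<close> by (intro Max_in) auto
  then obtain x0 where x0: "x0 \<in> C" "m = v (y x0)" by auto
  have "y x0 \<in> S" using x0 C Oy by auto
  then obtain x1 where x1: "x1 \<in> C" "y x0 \<in> G x1" using C by blast
  have "v (y x0) < v (y x1)" using Oy(4)[of x1 "y x0"] x1 C \<open>y x0 \<in> S\<close> by auto
  moreover have "v (y x1) \<le> m" unfolding m_def using C x1 by (intro Max_ge) auto
  ultimately show False using x0 by simp
qed

text \<open>Hence the quotient of the two norms is \<open>1\<close> on the circle of radius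
  \<open>R\<close> and exceeds \<open>1\<close> inside, for \<open>a\<close> inside: its logarithm
  is the Green function of the disc with pole \<open>a\<close>.\<close>

lemma blaschke_norm_square:
  fixes a z :: complex
  shows "(norm (of_real (R\<^sup>2) - cnj a * z))\<^sup>2 - (R * norm (z - a))\<^sup>2 = (R\<^sup>2 - (norm z)\<^sup>2) * (R\<^sup>2 - (norm a)\<^sup>2)"
  unfolding power_mult_distrib cmod_power2 by (simp add: algebra_simps power2_eq_square)

text \<open>Some Lagrange polynomial of \<open>S\<close> has modulus at least \<open>1 / N\<close>
  at \<open>z\<close>, so the product over \<open>S - {x}\<close> at \<open>z\<close> is at least
  \<open>1 / N\<close> times that at \<open>x\<close>, which \<open>low\<close> bounds. The missing
  factor \<open>norm (z - x)\<close> costs only \<open>d\<close>.\<close>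

lemma near_fekete_lower_bound:
  fixes S :: "complex set"
  assumes "finite S" "card S = N" "N \<ge> 1" "0 < c"
    and low: "\<And>x. x \<in> S \<Longrightarrow> c ^ (N - 1) \<le> 2 * (\<Prod>y\<in>S-{x}. norm (x - y))"
    and d: "\<And>x. x \<in> S \<Longrightarrow> d \<le> norm (z - x)" "0 < d"
  shows "d * c ^ (N - 1) / (2 * real N) \<le> (\<Prod>y\<in>S. norm (z - y))"
proof -
  have S: "S \<noteq> {}" using assms by auto
  have "\<exists>x\<in>S. 1 / real N \<le> norm (\<Prod>y\<in>S-{x}. (z - y) / (x - y))"
  proof (rule ccontr)
    assume "\<not> ?thesis"
    then have "(\<Sum>x\<in>S. norm (\<Prod>y\<in>S-{x}. (z - y) / (x - y))) < (\<Sum>x\<in>S. 1 / real N)"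
      using assms S by (intro sum_strict_mono) auto
    also have "\<dots> = 1" using assms by simp
    finally have "norm (\<Sum>x\<in>S. \<Prod>y\<in>S-{x}. (z - y) / (x - y)) < 1"
      by (rule le_less_trans[OF norm_sum])
    then show False using lagrange_partition_of_unity[OF assms(1) S, of z] by simp
  qed
  then obtain x where x: "x \<in> S" "1 / real N \<le> norm (\<Prod>y\<in>S-{x}. (z - y) / (x - y))" by auto
  let ?p = "\<Prod>y\<in>S-{x}. norm (z - y)" and ?q = "\<Prod>y\<in>S-{x}. norm (x - y)"
  have q: "?q > 0" by (intro prod_pos) auto
  have "norm (\<Prod>y\<in>S-{x}. (z - y) / (x - y)) = ?p / ?q"
    by (simp add: prod_dividef prod_norm[symmetric] norm_divide)
  then have "1 / real N \<le> ?p / ?q" using x(2) by (simp only:)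
  then have "?q * (1 / real N) \<le> ?p" using q by (simp only: pos_le_divide_eq mult.commute)
  then have "?q / real N \<le> ?p" by simp
  moreover have "c ^ (N - 1) / 2 \<le> ?q" using low[OF x(1)] by simp
  ultimately have "c ^ (N - 1) / 2 / real N \<le> ?p"
    using assms(3) by (meson divide_right_mono of_nat_0_le_iff order_trans)
  then have "d * (c ^ (N - 1) / 2 / real N) \<le> norm (z - x) * ?p"
    using d(1)[OF x(1)] d(2) assms(4) by (intro mult_mono) auto
  also have "\<dots> = (\<Prod>y\<in>S. norm (z - y))" using assms(1) x(1) by (simp add: prod.remove[of S x])
  finally show ?thesis by (simp add: mult.commute)
qed

text \<open>Let \<open>g\<close> be the mean of the Green functions of a disc with poles in a
  near-Fekete set \<open>S\<close>. It vanishes on the bounding circle, is at least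
  \<open>\<kappa>\<close> at \<open>w\<close>, and positivity of the Chebyshev constant bounds it by
  \<open>Cg\<close> at distance \<open>\<delta>\<close> from \<open>K\<close>; neither constant
  depends on \<open>\<delta>\<close> or on \<open>card S\<close>. As \<open>u\<close> is very
  negative near \<open>K\<close>, the maximum of \<open>u + \<mu> * g\<close>, with a quadratic term
  for strictness, is attained at a point where the mean inequality fails.\<close>

lemma cheb_zero_minus_infinity_set:
  assumes K: "compact K" "K \<subseteq> ball z0 r" and u: "subharmonic_on (ball z0 r) u"
    and w: "w \<in> ball z0 r" "u w \<noteq> -\<infinity>" and KI: "\<And>x. x \<in> K \<Longrightarrow> u x = -\<infinity>"
  shows "cheb_zero K"
proof (rule ccontr)
  assume "\<not> cheb_zero K"
  then obtain c0 where c0: "c0 > 0" "\<And>n xs. n \<ge> 1 \<Longrightarrow> length xs \<le> n \<Longrightarrow> set xs \<subseteq> K \<Longrightarrow> \<exists>z\<in>K. \<not> norm (lprod xs z) \<le> c0 ^ n"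
    unfolding cheb_zero_def by meson
  \<comment> \<open>With \<open>c \<le> 1\<close> the exponent \<open>N - 1\<close> may be replaced
    by \<open>N\<close> in the upper bound for \<open>g\<close>.\<close>
  define c where "c = min c0 1"
  have c: "c > 0" "c \<le> 1" using c0 unfolding c_def by auto
  have cs: "\<exists>z\<in>K. c ^ card S \<le> (\<Prod>y\<in>S. norm (z - y))" if S: "finite S" "S \<subseteq> K" "card S \<ge> 1" for S
  proof -
    obtain xs where xs: "set xs = S" "distinct xs" using finite_distinct_list[OF S(1)] by auto
    have "length xs = card S" using xs distinct_card by fastforce
    then obtain z where z: "z \<in> K" "\<not> norm (lprod xs z) \<le> c0 ^ card S"
      using c0(2)[of "card S" xs] S xs by auto
    have "lprod xs z = (\<Prod>y\<in>S. z - y)" unfolding lprod_def using xs by (metis prod.distinct_set_conv_list)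
    then have "norm (lprod xs z) = (\<Prod>y\<in>S. norm (z - y))" by (simp add: prod_norm)
    moreover have "c ^ card S \<le> c0 ^ card S" using c c0 by (intro power_mono) (auto simp: c_def)
    ultimately show ?thesis using z by force
  qed
  have Kne: "K \<noteq> {}" using c0(2)[of 1 "[]"] by auto
  have Kinf: "infinite K"
  proof
    assume fin: "finite K"
    then have "card K \<ge> 1" using Kne by (simp add: Suc_le_eq card_gt_0_iff)
    then obtain z where "z \<in> K" "c ^ card K \<le> (\<Prod>y\<in>K. norm (z - y))" using cs[OF fin] by auto
    moreover have "(\<Prod>y\<in>K. norm (z - y)) = 0" using fin \<open>z \<in> K\<close> by (intro prod_zero) auto
    ultimately show False using zero_less_power[OF c(1), of "card K"] by linarith
  qed
  have "compact (insert w K)" "insert w K \<subseteq> ball z0 r" using K w by auto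
  then obtain s where s: "s < r" "insert w K \<subseteq> cball z0 s" "0 < s"
  proof -
    have r0: "r > 0" using w by (auto simp: dist_commute intro: le_less_trans[OF zero_le_dist])
    obtain m where m: "m \<in> insert w K" "\<And>y. y \<in> insert w K \<Longrightarrow> dist z0 y \<le> dist z0 m"
      using distance_attains_sup[OF \<open>compact (insert w K)\<close>, of z0] by auto
    have "dist z0 m < r" using m(1) \<open>insert w K \<subseteq> ball z0 r\<close> by auto
    then show ?thesis using m(2) r0 by (intro that[of "max (dist z0 m) (r/2)"]) (auto simp: le_max_iff_disj)
  qed
  define R where "R = (s + r) / 2"
  have R: "s < R" "R < r" "0 < R" using s unfolding R_def by auto
  have Ksub: "\<And>a. a \<in> K \<Longrightarrow> norm (a - z0) \<le> s" and ws: "norm (w - z0) \<le> s"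
    using s(2) by (auto simp: dist_norm norm_minus_commute)
  have cbR: "cball z0 R \<subseteq> ball z0 r" using R by auto
  have usc: "usc_on (ball z0 r) u" and uinf: "\<And>z. z \<in> ball z0 r \<Longrightarrow> u z \<noteq> \<infinity>"
    and sm: "\<And>a \<rho>. 0 < \<rho> \<Longrightarrow> cball a \<rho> \<subseteq> ball z0 r \<Longrightarrow> submean u a (\<lambda>t. a + of_real \<rho> * exp (\<i> * of_real t))"
    using u unfolding subharmonic_on_def by auto
  obtain B where B: "\<And>z. z \<in> cball z0 R \<Longrightarrow> u z \<le> ereal B"
  proof -
    obtain x where x: "x \<in> cball z0 R" "\<And>y. y \<in> cball z0 R \<Longrightarrow> u y \<le> u x"
      using usc_on_attains_sup[OF compact_cball _ usc_on_subset[OF usc cbR]] R by (auto simp: not_less)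
    then have "u x \<noteq> \<infinity>" using uinf cbR by blast
    then have "u x \<le> ereal (real_of_ereal (u x))" by (cases "u x") auto
    then show ?thesis using x(2) that order_trans by blast
  qed
  obtain \<omega> where \<omega>: "u w = ereal \<omega>" using w uinf by (cases "u w") auto
  \<comment> \<open>A lower bound for the excess over \<open>1\<close> of the squared Blaschke
    quotients at \<open>w\<close>: all points lie within \<open>s\<close> of \<open>z0\<close>, and
    \<open>norm (w - a) \<le> 2 * R\<close>.\<close>
  define \<kappa>1 where "\<kappa>1 = (R\<^sup>2 - s\<^sup>2)\<^sup>2 / (R * (2 * R))\<^sup>2"
  define \<kappa> where "\<kappa> = ln (1 + \<kappa>1) / 2"
  have "R\<^sup>2 - s\<^sup>2 > 0" using R s by (simp add: power_strict_mono)
  then have \<kappa>1: "\<kappa>1 > 0" using R unfolding \<kappa>1_def by simp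
  then have \<kappa>: "\<kappa> > 0" unfolding \<kappa>_def by simp
  \<comment> \<open>The quadratic term contributes at most \<open>\<kappa> / 2\<close>, half of what
    \<open>g\<close> gains at \<open>w\<close>.\<close>
  define \<epsilon> where "\<epsilon> = \<kappa> / (2 * R\<^sup>2)"
  have \<epsilon>: "\<epsilon> > 0" "\<epsilon> * R\<^sup>2 = \<kappa> / 2" using \<kappa> R unfolding \<epsilon>_def by auto
  define t where "t = \<bar>B - \<omega>\<bar>"
  have t: "t \<ge> 0" "t \<ge> B - \<omega>" unfolding t_def by simp_all
  \<comment> \<open>Large enough for the remaining half of the gain to exceed
    \<open>B - \<omega>\<close>, so that \<open>w\<close> beats every point of the bounding
    circle.\<close>
  define \<mu> where "\<mu> = 2 * (t + 1) / \<kappa>"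
  have \<mu>: "\<mu> > 0" using \<kappa> t unfolding \<mu>_def by simp
  have \<mu>\<kappa>: "\<mu> * \<kappa> = 2 * (t + 1)" "\<mu> * (\<kappa> / 2) = t + 1" using \<kappa> unfolding \<mu>_def by simp_all
  have \<mu>2: "\<omega> + \<mu> * \<kappa> > B + \<mu> * (\<kappa> / 2)" unfolding \<mu>\<kappa> using t by simp
  \<comment> \<open>The summand \<open>1\<close> will absorb
    \<open>(ln (2 * N) - ln \<delta>) / N\<close> once \<open>N\<close> is large. So
    \<open>Cg\<close> can be fixed before \<open>T\<close>, hence before
    \<open>\<delta>\<close>.\<close>
  define Cg where "Cg = ln (2 * R) - ln c + 1"
  define T where "T = \<bar>\<mu> * (Cg + \<kappa> / 2)\<bar> + \<bar>\<omega>\<bar> + 1"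
  have T: "- T + \<mu> * (Cg + \<kappa> / 2) < \<omega>" "- T < \<omega>" unfolding T_def by auto
  define V where "V = {z \<in> ball z0 r. u z < ereal (- T)}"
  have "open V"
  proof (subst open_subopen, intro ballI)
    fix x assume "x \<in> V"
    then have x: "x \<in> ball z0 r" "u x < ereal (- T)" unfolding V_def by auto
    then have "eventually (\<lambda>y. u y < ereal (- T)) (at x within ball z0 r)" using usc unfolding usc_on_def by blast
    then obtain G where G: "open G" "x \<in> G" "\<And>y. y \<in> G \<Longrightarrow> y \<noteq> x \<Longrightarrow> y \<in> ball z0 r \<Longrightarrow> u y < ereal (- T)"
      unfolding eventually_at_topological by auto
    have "u y < ereal (- T)" if "y \<in> G \<inter> ball z0 r" for y
      using G(3)[of y] x that by (cases "y = x") auto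
    then have "G \<inter> ball z0 r \<subseteq> V" unfolding V_def by blast
    then show "\<exists>T. open T \<and> x \<in> T \<and> T \<subseteq> V"
      using x G(1,2) by (intro exI[of _ "G \<inter> ball z0 r"]) (simp add: open_Int)
  qed
  moreover have "K \<subseteq> V" unfolding V_def using KI K(2) by auto
  ultimately obtain \<delta> where \<delta>: "\<delta> > 0" "{x. infdist x K \<le> \<delta>} \<subseteq> V"
    using compact_in_open_separated[OF Kne K(1)] by metis
  obtain N where N: "N \<ge> 1" "real N \<ge> ln (2 * N) - ln \<delta>"
  proof -
    obtain n where n: "real n \<ge> 2 * (ln 4 - ln \<delta>)" using real_arch_simple by blast
    define N where "N = max n 1"
    have N: "N \<ge> 1" "real N \<ge> 2 * (ln 4 - ln \<delta>)" using n unfolding N_def by auto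
    have "ln (2 * real N) = ln (real N / 2) + ln 4" using ln_mult[of "real N / 2" 4] N by simp
    also have "\<dots> \<le> real N / 2 + ln 4" using ln_le_minus_one[of "real N / 2"] N by simp
    finally show ?thesis using N that[of N] by simp
  qed
  obtain S where S: "finite S" "S \<subseteq> K" "card S = N"
    "\<And>x z. x \<in> S \<Longrightarrow> z \<in> K \<Longrightarrow> (\<Prod>y\<in>S-{x}. norm (z - y)) \<le> 2 * (\<Prod>y\<in>S-{x}. norm (x - y))"
    using near_fekete_set[OF compact_imp_bounded[OF K(1)] Kinf N(1)] by metis
  have low: "c ^ (N - 1) \<le> 2 * (\<Prod>y\<in>S-{x}. norm (x - y))" if x: "x \<in> S" for x
  proof (cases "N = 1")
    case True
    then have "S = {x}" using S(3) x card_1_singletonE by blast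
    then show ?thesis using True by simp
  next
    case False
    have "card (S - {x}) = N - 1" using S x by simp
    moreover have "N - 1 \<ge> 1" using False N by simp
    ultimately obtain z where "z \<in> K" "c ^ (N - 1) \<le> (\<Prod>y\<in>S-{x}. norm (z - y))"
      using cs[of "S - {x}"] S by auto
    then show ?thesis using S(4)[OF x, of z] by linarith
  qed
  define \<Phi> where "\<Phi> z = (\<Prod>a\<in>S. (of_real (R\<^sup>2) - cnj (a - z0) * (z - z0)) / (of_real R * (z - a)))" for z
  define g where "g z = ln (norm (\<Phi> z)) / N" for z
  have factor: "norm ((of_real (R\<^sup>2) - cnj (a - z0) * (z - z0)) / (of_real R * (z - a))) =
      norm (of_real (R\<^sup>2) - cnj (a - z0) * (z - z0)) / (R * norm (z - a))" for a z
    using R by (simp add: norm_divide norm_mult)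
  have bl: "(norm (of_real (R\<^sup>2) - cnj (a - z0) * (z - z0)))\<^sup>2 = (R * norm (z - a))\<^sup>2 + (R\<^sup>2 - (norm (z - z0))\<^sup>2) * (R\<^sup>2 - (norm (a - z0))\<^sup>2)" for a z
    using blaschke_norm_square[of R "a - z0" "z - z0"] by simp
  have numpos: "norm (of_real (R\<^sup>2) - cnj (a - z0) * (z - z0)) > 0" if "a \<in> S" "norm (z - z0) \<le> R" for a z
  proof -
    have a: "norm (a - z0) < R" using Ksub[of a] S(2) that(1) R(1) by auto
    have "norm (cnj (a - z0) * (z - z0)) < R * R"
      unfolding norm_mult complex_mod_cnj
      using mult_left_mono[OF that(2), of "norm (a - z0)"] mult_strict_right_mono[OF a R(3)] by simp
    then have "norm (complex_of_real (R\<^sup>2)) \<noteq> norm (cnj (a - z0) * (z - z0))"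
      unfolding norm_of_real by (simp add: power2_eq_square)
    then have "of_real (R\<^sup>2) \<noteq> cnj (a - z0) * (z - z0)" by (rule contrapos_nn) (simp only:)
    then show ?thesis by simp
  qed
  have wS: "w \<notin> S" using \<omega> KI S(2) by force
  have lng: "g z = (\<Sum>a\<in>S. ln (norm (of_real (R\<^sup>2) - cnj (a - z0) * (z - z0)) / (R * norm (z - a)))) / N"
    if "norm (z - z0) \<le> R" "z \<notin> S" for z
  proof -
    have "norm (\<Phi> z) = (\<Prod>a\<in>S. norm (of_real (R\<^sup>2) - cnj (a - z0) * (z - z0)) / (R * norm (z - a)))"
      unfolding \<Phi>_def by (simp only: prod_norm[symmetric] factor)
    moreover have pos: "norm (of_real (R\<^sup>2) - cnj (a - z0) * (z - z0)) / (R * norm (z - a)) > 0" if "a \<in> S" for a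
      using numpos[OF that \<open>norm (z - z0) \<le> R\<close>] that \<open>z \<notin> S\<close> R(3) by (intro divide_pos_pos mult_pos_pos) auto
    ultimately have "ln (norm (\<Phi> z)) = (\<Sum>a\<in>S. ln (norm (of_real (R\<^sup>2) - cnj (a - z0) * (z - z0)) / (R * norm (z - a))))"
      by (simp only:) (intro ln_prod S(1) pos[THEN less_imp_neq, THEN not_sym])
    then show ?thesis unfolding g_def by (simp only:)
  qed
  have \<Phi>nz: "\<Phi> z \<noteq> 0" if "norm (z - z0) \<le> R" "z \<notin> S" for z
  proof -
    have "(of_real (R\<^sup>2) - cnj (a - z0) * (z - z0)) / (of_real R * (z - a)) \<noteq> 0" if "a \<in> S" for a
      using numpos[OF that \<open>norm (z - z0) \<le> R\<close>] that \<open>z \<notin> S\<close> R(3) by auto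
    then show ?thesis unfolding \<Phi>_def using S(1) by simp
  qed
  have gw: "g w \<ge> \<kappa>"
  proof -
    have "\<kappa> \<le> ln (norm (of_real (R\<^sup>2) - cnj (a - z0) * (w - z0)) / (R * norm (w - a)))" (is "_ \<le> ln ?f") if a: "a \<in> S" for a
    proof -
      have wa: "norm (w - a) > 0" using a wS by auto
      have as: "norm (a - z0) \<le> s" using Ksub S(2) a by auto
      have "norm (w - a) \<le> norm (w - z0) + norm (a - z0)" using norm_triangle_ineq4[of "w - z0" "a - z0"] by simp
      then have w2: "norm (w - a) \<le> 2 * R" using ws as R by simp
      have "?f\<^sup>2 = ((R * norm (w - a))\<^sup>2 + (R\<^sup>2 - (norm (w - z0))\<^sup>2) * (R\<^sup>2 - (norm (a - z0))\<^sup>2)) / (R * norm (w - a))\<^sup>2"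
        unfolding power_divide bl ..
      also have "\<dots> = 1 + (R\<^sup>2 - (norm (w - z0))\<^sup>2) * (R\<^sup>2 - (norm (a - z0))\<^sup>2) / (R * norm (w - a))\<^sup>2"
        using wa R(3) by (simp add: add_divide_distrib)
      finally have f2: "?f\<^sup>2 = 1 + (R\<^sup>2 - (norm (w - z0))\<^sup>2) * (R\<^sup>2 - (norm (a - z0))\<^sup>2) / (R * norm (w - a))\<^sup>2" .
      have "\<kappa>1 \<le> (R\<^sup>2 - (norm (w - z0))\<^sup>2) * (R\<^sup>2 - (norm (a - z0))\<^sup>2) / (R * norm (w - a))\<^sup>2"
        unfolding \<kappa>1_def
      proof (rule frac_le)
        have 1: "R\<^sup>2 - s\<^sup>2 \<le> R\<^sup>2 - (norm (w - z0))\<^sup>2" "R\<^sup>2 - s\<^sup>2 \<le> R\<^sup>2 - (norm (a - z0))\<^sup>2"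
          using ws as by (simp_all add: power_mono)
        then show "(R\<^sup>2 - s\<^sup>2)\<^sup>2 \<le> (R\<^sup>2 - (norm (w - z0))\<^sup>2) * (R\<^sup>2 - (norm (a - z0))\<^sup>2)"
          unfolding power2_eq_square[of "R\<^sup>2 - s\<^sup>2"] using \<open>R\<^sup>2 - s\<^sup>2 > 0\<close> by (intro mult_mono) auto
        show "0 \<le> (R\<^sup>2 - (norm (w - z0))\<^sup>2) * (R\<^sup>2 - (norm (a - z0))\<^sup>2)" using 1 \<open>R\<^sup>2 - s\<^sup>2 > 0\<close> by (intro mult_nonneg_nonneg) auto
        show "0 < (R * norm (w - a))\<^sup>2" using wa R(3) by simp
        show "(R * norm (w - a))\<^sup>2 \<le> (R * (2 * R))\<^sup>2" using w2 R(3) by (intro power_mono mult_left_mono) auto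
      qed
      then have "1 + \<kappa>1 \<le> ?f\<^sup>2" using f2 by simp
      then have "ln (1 + \<kappa>1) \<le> ln (?f\<^sup>2)" using \<kappa>1 by (intro ln_mono) auto
      moreover have "?f > 0" using numpos[OF a, of w] ws R wa by (intro divide_pos_pos mult_pos_pos) auto
      ultimately show ?thesis unfolding \<kappa>_def by (simp add: ln_realpow)
    qed
    then have "(\<Sum>a\<in>S. \<kappa>) \<le> (\<Sum>a\<in>S. ln (norm (of_real (R\<^sup>2) - cnj (a - z0) * (w - z0)) / (R * norm (w - a))))"
      by (rule sum_mono)
    then have "real N * \<kappa> \<le> g w * N" using lng[of w] ws R wS S(3) N(1) by simp
    then show ?thesis using N(1) by (simp add: mult.commute)
  qed
  have gR: "g z = 0" if z: "norm (z - z0) = R" for z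
  proof -
    have zS: "z \<notin> S" using Ksub S(2) R z by force
    have "norm (of_real (R\<^sup>2) - cnj (a - z0) * (z - z0)) / (R * norm (z - a)) = 1" if a: "a \<in> S" for a
    proof -
      have "(norm (of_real (R\<^sup>2) - cnj (a - z0) * (z - z0)))\<^sup>2 = (R * norm (z - a))\<^sup>2" unfolding bl by (simp add: z)
      then have "norm (of_real (R\<^sup>2) - cnj (a - z0) * (z - z0)) = R * norm (z - a)"
        by (rule power2_eq_imp_eq[OF _ norm_ge_zero mult_nonneg_nonneg[OF less_imp_le[OF R(3)] norm_ge_zero]])
      then show ?thesis using a zS R(3) by auto
    qed
    then have "(\<Sum>a\<in>S. ln (norm (of_real (R\<^sup>2) - cnj (a - z0) * (z - z0)) / (R * norm (z - a)))) = (\<Sum>a\<in>S. 0)"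
      by (intro sum.cong) auto
    then show ?thesis using lng[of z] z zS by simp
  qed
  have gup: "g z \<le> Cg" if z: "norm (z - z0) \<le> R" "infdist z K \<ge> \<delta>" for z
  proof -
    have dz: "\<delta> \<le> norm (z - a)" if "a \<in> S" for a
      using infdist_le[of a K z] that S(2) z(2) by (auto simp: dist_norm)
    then have zS: "z \<notin> S" using \<delta>(1) by force
    have "\<delta> * c ^ (N - 1) / (2 * real N) \<le> (\<Prod>y\<in>S. norm (z - y))"
      by (rule near_fekete_lower_bound[OF S(1,3) N(1) c(1) low dz \<delta>(1)])
    then have "ln (\<delta> * c ^ (N - 1) / (2 * real N)) \<le> ln (\<Prod>y\<in>S. norm (z - y))"
      using \<delta>(1) c N(1) by (intro ln_mono) auto
    moreover have "ln (\<Prod>y\<in>S. norm (z - y)) = (\<Sum>y\<in>S. ln (norm (z - y)))"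
      using S(1) zS by (intro ln_prod) auto
    moreover have "ln (\<delta> * c ^ (N - 1) / (2 * real N)) = ln \<delta> + (N - 1) * ln c - ln (2 * real N)"
      using \<delta>(1) c N(1) by (simp add: ln_div ln_mult ln_realpow)
    ultimately have low': "ln \<delta> + (N - 1) * ln c - ln (2 * real N) \<le> (\<Sum>y\<in>S. ln (norm (z - y)))" by simp
    have "ln (norm (of_real (R\<^sup>2) - cnj (a - z0) * (z - z0)) / (R * norm (z - a))) \<le> ln (2 * R) - ln (norm (z - a))"
      (is "ln (?n / _) \<le> _") if a: "a \<in> S" for a
    proof -
      have za: "norm (z - a) > 0" using a zS by auto
      have as: "norm (a - z0) \<le> R" using Ksub[of a] S(2) a R by auto
      have "?n \<le> R\<^sup>2 + norm (a - z0) * norm (z - z0)"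
        using norm_triangle_ineq4[of "of_real (R\<^sup>2)" "cnj (a - z0) * (z - z0)"] by (simp only: norm_mult complex_mod_cnj norm_of_real) simp
      also have "\<dots> \<le> R\<^sup>2 + R * R" using as z(1) R by (intro add_mono mult_mono) auto
      finally have "?n \<le> 2 * R * R" by (simp add: power2_eq_square)
      then have "?n / (R * norm (z - a)) \<le> 2 * R / norm (z - a)" using za R(3) by (simp add: field_simps)
      then have "ln (?n / (R * norm (z - a))) \<le> ln (2 * R / norm (z - a))"
        using numpos[OF a z(1)] za R(3) by (intro ln_mono divide_pos_pos mult_pos_pos) auto
      then show ?thesis using za R(3) by (simp add: ln_div)
    qed
    then have "g z * N \<le> (\<Sum>a\<in>S. ln (2 * R) - ln (norm (z - a)))"
      using lng[OF z(1) zS] N(1) by (simp add: sum_mono)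
    also have "\<dots> = N * ln (2 * R) - (\<Sum>a\<in>S. ln (norm (z - a)))" using S(3) by (simp add: sum_subtractf)
    also have "\<dots> \<le> N * ln (2 * R) - (ln \<delta> + (N - 1) * ln c - ln (2 * real N))" using low' by simp
    also have "\<dots> \<le> N * ln (2 * R) + N - (N - 1) * ln c" using N(2) by simp
    also have "\<dots> \<le> N * ln (2 * R) + N - N * ln c" using c N(1) by (simp add: of_nat_diff algebra_simps)
    also have "\<dots> = Cg * N" unfolding Cg_def by (simp add: algebra_simps)
    finally show ?thesis using N(1) by simp
  qed
  have \<Phi>hol: "\<Phi> holomorphic_on X" if "X \<inter> S = {}" for X
    unfolding \<Phi>_def using that R(3) by (intro holomorphic_intros) auto
  \<comment> \<open>The poles of \<open>g\<close> are cut out together with a neighbourhood of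
    \<open>K\<close> in which \<open>u < - T\<close>; the maximum is sought on what is left.\<close>
  define Q where "Q = {z \<in> cball z0 R. infdist z K \<ge> \<delta>}"
  have QS: "Q \<inter> S = {}" unfolding Q_def using S(2) \<delta>(1) by (force simp: infdist_zero)
  have Qc: "compact Q"
  proof -
    have "Q = cball z0 R \<inter> {z. infdist z K \<ge> \<delta>}" unfolding Q_def by auto
    moreover have "closed {z. infdist z K \<ge> \<delta>}" by (intro closed_Collect_le continuous_intros)
    ultimately show ?thesis by (simp add: compact_Int_closed)
  qed
  define h where "h z = \<mu> * (g z + \<epsilon> * (norm (z - z0))\<^sup>2)" for z
  have conth: "continuous_on X h" if "X \<subseteq> cball z0 R" "X \<inter> S = {}" for X
  proof -
    have "continuous_on X \<Phi>" using \<Phi>hol[OF that(2)] by (rule holomorphic_on_imp_continuous_on)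
    moreover have "\<forall>z\<in>X. norm (\<Phi> z) \<noteq> 0"
    proof
      fix z assume "z \<in> X"
      then have "z \<in> cball z0 R" "z \<notin> S" using that by blast+
      then show "norm (\<Phi> z) \<noteq> 0" using \<Phi>nz[of z] by (simp add: dist_norm norm_minus_commute)
    qed
    ultimately show ?thesis unfolding h_def g_def using N(1) by (intro continuous_intros) auto
  qed
  have Qb: "Q \<subseteq> cball z0 R" unfolding Q_def by auto
  have wV: "w \<notin> V" unfolding V_def using \<omega> T(2) by auto
  then have wQ: "w \<in> Q" unfolding Q_def using ws R \<delta>(2) by (force simp: dist_norm norm_minus_commute)
  have "usc_on Q (\<lambda>z. u z + ereal (h z))"
    by (intro usc_on_add_continuous usc_on_subset[OF usc] conth Qb QS order_trans[OF Qb cbR])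
  then obtain x where x: "x \<in> Q" "\<And>y. y \<in> Q \<Longrightarrow> u y + ereal (h y) \<le> u x + ereal (h x)"
    using usc_on_attains_sup[OF Qc] wQ by blast
  have xR: "norm (x - z0) \<le> R" "infdist x K \<ge> \<delta>" using x(1) unfolding Q_def by (auto simp: dist_norm norm_minus_commute)
  have "ereal (\<omega> + \<mu> * \<kappa>) \<le> u w + ereal (h w)"
  proof -
    have "\<kappa> \<le> g w + \<epsilon> * (norm (w - z0))\<^sup>2" using gw \<epsilon>(1) by (simp add: add_increasing2)
    then show ?thesis using \<mu> unfolding \<omega> h_def by simp
  qed
  then have vx: "ereal (\<omega> + \<mu> * \<kappa>) \<le> u x + ereal (h x)" using x(2)[OF wQ] by (rule order_trans)
  have xb: "x \<in> ball z0 r" using x(1) Qb cbR by auto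
  obtain U where U: "u x = ereal U" using vx uinf[OF xb] by (cases "u x") auto
  have vx': "\<omega> + \<mu> * \<kappa> \<le> U + h x" using vx U by simp
  have eps: "\<epsilon> * (norm (x - z0))\<^sup>2 \<le> \<kappa> / 2"
  proof -
    have "\<epsilon> * (norm (x - z0))\<^sup>2 \<le> \<epsilon> * R\<^sup>2" using xR(1) \<epsilon>(1) by (intro mult_left_mono power_mono) auto
    then show ?thesis using \<epsilon>(2) by simp
  qed
  have xlt: "norm (x - z0) < R"
  proof (rule ccontr)
    assume "\<not> ?thesis"
    then have e: "norm (x - z0) = R" using xR by simp
    have "U \<le> B" using B[of x] x(1) Qb U by auto
    moreover have "h x \<le> \<mu> * (\<kappa> / 2)" unfolding h_def using gR[OF e] eps \<mu> by (intro mult_left_mono) auto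
    ultimately show False using vx' \<mu>2 by linarith
  qed
  have xgt: "infdist x K > \<delta>"
  proof (rule ccontr)
    assume "\<not> ?thesis"
    then have "x \<in> V" using \<delta>(2) by force
    then have "U < - T" unfolding V_def using U by simp
    moreover have "h x \<le> \<mu> * (Cg + \<kappa> / 2)" unfolding h_def using gup[OF xR] eps \<mu> by (intro mult_left_mono) auto
    moreover have "\<mu> * \<kappa> > 0" using \<mu> \<kappa> by simp
    ultimately show False using vx' T(1) by linarith
  qed
  have "open {z \<in> ball z0 R. infdist z K > \<delta>}"
  proof -
    have "{z \<in> ball z0 R. infdist z K > \<delta>} = ball z0 R \<inter> {z. infdist z K > \<delta>}" by auto
    moreover have "open {z. infdist z K > \<delta>}" by (intro open_Collect_less continuous_intros)
    ultimately show ?thesis by (simp add: open_Int)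
  qed
  moreover have "x \<in> {z \<in> ball z0 R. infdist z K > \<delta>}" using xlt xgt by (simp add: dist_norm norm_minus_commute)
  ultimately obtain \<rho>0 where \<rho>0: "\<rho>0 > 0" "ball x \<rho>0 \<subseteq> {z \<in> ball z0 R. infdist z K > \<delta>}" by (rule openE)
  then have \<rho>Q: "ball x \<rho>0 \<subseteq> Q" unfolding Q_def by force
  define \<rho> where "\<rho> = \<rho>0 / 2"
  have \<rho>: "\<rho> > 0" using \<rho>0 unfolding \<rho>_def by simp
  have inb: "x + of_real \<rho> * \<zeta> \<in> ball x \<rho>0" if "norm \<zeta> < 2" for \<zeta>
    using that \<rho> \<rho>0 unfolding \<rho>_def by (simp add: dist_norm norm_mult)
  have mg: "circ_mean (\<lambda>\<zeta>. ln (norm (\<Phi> (x + of_real \<rho> * \<zeta>)))) = ln (norm (\<Phi> (x + of_real \<rho> * 0)))"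
  proof (rule ln_norm_circ_mean[where S = "ball 0 2"])
    have "(\<Phi> \<circ> (\<lambda>\<zeta>. x + of_real \<rho> * \<zeta>)) holomorphic_on ball 0 2"
    proof (rule holomorphic_on_compose_gen[OF _ \<Phi>hol[OF QS]])
      show "(\<lambda>\<zeta>. x + of_real \<rho> * \<zeta>) ` ball 0 2 \<subseteq> Q" using inb \<rho>Q by auto
    qed (intro holomorphic_intros)
    then show "(\<lambda>\<zeta>. \<Phi> (x + of_real \<rho> * \<zeta>)) holomorphic_on ball 0 2" by (simp add: o_def)
    show "\<Phi> (x + of_real \<rho> * \<zeta>) \<noteq> 0" if "\<zeta> \<in> ball 0 2" for \<zeta>
    proof (rule \<Phi>nz)
      have "x + of_real \<rho> * \<zeta> \<in> Q" using inb[of \<zeta>] that \<rho>Q by auto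
      then show "norm (x + of_real \<rho> * \<zeta> - z0) \<le> R" "x + of_real \<rho> * \<zeta> \<notin> S"
        using Qb QS by (auto simp: dist_norm norm_minus_commute)
    qed
  qed auto
  have cph: "continuous_on (sphere 0 1) (\<lambda>\<zeta>. ln (norm (\<Phi> (x + of_real \<rho> * \<zeta>))))"
    "continuous_on (sphere 0 1) (\<lambda>\<zeta>. h (x + of_real \<rho> * \<zeta>))"
  proof -
    have im: "(\<lambda>\<zeta>. x + of_real \<rho> * \<zeta>) ` sphere 0 1 \<subseteq> Q" using inb \<rho>Q by force
    show "continuous_on (sphere 0 1) (\<lambda>\<zeta>. h (x + of_real \<rho> * \<zeta>))"
      by (rule continuous_on_compose2[OF conth[OF Qb QS] _ im]) (intro continuous_intros)
    have "continuous_on Q (\<lambda>z. ln (norm (\<Phi> z)))"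
      using \<Phi>hol[OF QS] \<Phi>nz Qb QS
      by (intro continuous_intros holomorphic_on_imp_continuous_on) (auto simp: dist_norm norm_minus_commute subset_iff)
    then show "continuous_on (sphere 0 1) (\<lambda>\<zeta>. ln (norm (\<Phi> (x + of_real \<rho> * \<zeta>))))"
      by (rule continuous_on_compose2[OF _ _ im]) (intro continuous_intros)
  qed
  have mh: "circ_mean (\<lambda>\<zeta>. h (x + of_real \<rho> * \<zeta>)) = h x + \<mu> * \<epsilon> * \<rho>\<^sup>2"
  proof -
    have "circ_mean (\<lambda>\<zeta>. h (x + of_real \<rho> * \<zeta>)) =
        circ_mean (\<lambda>\<zeta>. \<mu> / N * ln (norm (\<Phi> (x + of_real \<rho> * \<zeta>))) + \<mu> * \<epsilon> * (norm ((x - z0) + of_real \<rho> * \<zeta>))\<^sup>2)"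
      unfolding h_def g_def by (simp add: algebra_simps)
    also have "\<dots> = \<mu> / N * ln (norm (\<Phi> x)) + \<mu> * \<epsilon> * ((norm (x - z0))\<^sup>2 + \<rho>\<^sup>2)"
    proof (subst circ_mean_add)
      show "continuous_on (sphere 0 1) (\<lambda>\<zeta>. \<mu> / N * ln (norm (\<Phi> (x + of_real \<rho> * \<zeta>))))"
        by (intro continuous_on_mult continuous_on_const cph)
      show "continuous_on (sphere 0 1) (\<lambda>\<zeta>. \<mu> * \<epsilon> * (norm ((x - z0) + of_real \<rho> * \<zeta>))\<^sup>2)"
        by (intro continuous_intros)
    qed (simp only: circ_mean_cmult circ_mean_norm_square mg mult_zero_right add_0_right)
    also have "\<dots> = h x + \<mu> * \<epsilon> * \<rho>\<^sup>2" unfolding h_def g_def by (simp add: algebra_simps)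
    finally show ?thesis .
  qed
  \<comment> \<open>Maximality at \<open>x\<close> bounds \<open>u\<close> on a small circle by a
    continuous function whose mean is \<open>U - \<mu> * \<epsilon> * \<rho>\<^sup>2\<close>,
    strictly less than \<open>u x\<close>.\<close>
  have "u x \<le> ereal (integral {0..2*pi} (\<lambda>t. U + h x - h (x + of_real \<rho> * exp (\<i> * of_real t))) / (2*pi))"
  proof (rule submean_le_integral[where u = u and c = x and \<gamma> = "\<lambda>t. x + of_real \<rho> * exp (\<i> * of_real t)"])
    have "cball x \<rho> \<subseteq> ball x \<rho>0" using \<rho>0 unfolding \<rho>_def by auto
    then have "cball x \<rho> \<subseteq> ball z0 r" using \<rho>Q Qb cbR by blast
    then show "submean u x (\<lambda>t. x + of_real \<rho> * exp (\<i> * of_real t))" using sm \<rho> by blast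
    show "continuous_on {0..2*pi} (\<lambda>t. U + h x - h (x + of_real \<rho> * exp (\<i> * of_real t)))"
      by (intro continuous_intros continuous_on_compose2[OF cph(2)]) auto
    fix t :: real
    let ?y = "x + of_real \<rho> * exp (\<i> * of_real t)"
    have "?y \<in> Q" using inb[of "exp (\<i> * of_real t)"] \<rho>Q by auto
    then have "u ?y + ereal (h ?y) \<le> ereal (U + h x)" using x(2)[of ?y] U by simp
    then show "u ?y \<le> ereal (U + h x - h ?y)" by (cases "u ?y") auto
  qed
  also have "integral {0..2*pi} (\<lambda>t. U + h x - h (x + of_real \<rho> * exp (\<i> * of_real t))) / (2*pi) = circ_mean (\<lambda>\<zeta>. (U + h x) - h (x + of_real \<rho> * \<zeta>))"
    unfolding circ_mean_def by simp
  also have "\<dots> = U + h x - (h x + \<mu> * \<epsilon> * \<rho>\<^sup>2)"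
    by (subst circ_mean_diff) (use cph mh in auto)
  finally have "\<mu> * \<epsilon> * \<rho>\<^sup>2 \<le> 0" using U by simp
  moreover have "\<mu> * \<epsilon> * \<rho>\<^sup>2 > 0" using \<mu> \<epsilon>(1) \<rho> by simp
  ultimately show False by simp
qed

text \<open>Polarity is a local condition, so \<open>K\<close> is cut into finitely many compact
  pieces; closed balls of half the radius keep each piece inside the ball on which its subharmonic
  function lives.\<close>

lemma polar_imp_cheb_zero:
  assumes "polar A" "compact K" "K \<subseteq> A"
  shows "cheb_zero K"
proof -
  have "\<exists>r u. r > 0 \<and> subharmonic_on (ball z r) u \<and> (\<exists>w\<in>ball z r. u w \<noteq> -\<infinity>) \<and> A \<inter> ball z r \<subseteq> {w. u w = -\<infinity>}"
    if "z \<in> K" for z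
    using assms(1,3) that unfolding polar_def by (meson subsetD)
  then obtain r u where ru: "\<And>z. z \<in> K \<Longrightarrow> r z > 0" "\<And>z. z \<in> K \<Longrightarrow> subharmonic_on (ball z (r z)) (u z)"
    "\<And>z. z \<in> K \<Longrightarrow> \<exists>w\<in>ball z (r z). u z w \<noteq> -\<infinity>" "\<And>z. z \<in> K \<Longrightarrow> A \<inter> ball z (r z) \<subseteq> {w. u z w = -\<infinity>}"
    by metis
  have "K \<subseteq> (\<Union>z\<in>K. ball z (r z / 2))" using ru(1) by force
  then obtain C where C: "C \<subseteq> K" "finite C" "K \<subseteq> (\<Union>z\<in>C. ball z (r z / 2))"
    using compactE_image[OF assms(2), of K "\<lambda>z. ball z (r z / 2)"] by auto
  have "cheb_zero (K \<inter> cball z (r z / 2))" if z: "z \<in> C" for z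
  proof -
    have zK: "z \<in> K" using z C by auto
    obtain w where w: "w \<in> ball z (r z)" "u z w \<noteq> -\<infinity>" using ru(3)[OF zK] by auto
    have sub: "K \<inter> cball z (r z / 2) \<subseteq> ball z (r z)" using ru(1)[OF zK] by auto
    show ?thesis
    proof (rule cheb_zero_minus_infinity_set[OF _ sub ru(2)[OF zK] w])
      show "compact (K \<inter> cball z (r z / 2))" using assms(2) by (intro compact_Int) auto
      show "u z x = -\<infinity>" if "x \<in> K \<inter> cball z (r z / 2)" for x
        using ru(4)[OF zK] that sub assms(3) by blast
    qed
  qed
  then have "cheb_zero (\<Union>z\<in>C. K \<inter> cball z (r z / 2))"
    using C(2) compact_imp_bounded[OF assms(2)] by (intro cheb_zero_UN) auto
  moreover have "(\<Union>z\<in>C. K \<inter> cball z (r z / 2)) = K"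
  proof
    show "K \<subseteq> (\<Union>z\<in>C. K \<inter> cball z (r z / 2))"
    proof
      fix y assume y: "y \<in> K"
      then obtain z where "z \<in> C" "y \<in> ball z (r z / 2)" using C(3) by blast
      then show "y \<in> (\<Union>z\<in>C. K \<inter> cball z (r z / 2))" using y by (intro UN_I[of z]) auto
    qed
  qed auto
  ultimately show ?thesis by simp
qed

section \<open>Circles that avoid a set of Chebyshev constant zero\<close>

text \<open>A primitive of \<open>ln (y\<^sup>2) / 2\<close>, the logarithm of the modulus written
  without distinguishing signs. Continuity at \<open>0\<close> comes from
  \<open>- ln s \<le> 1 / s\<close> with \<open>s = sqrt \<bar>y\<bar>\<close>.\<close>

lemma continuous_x_ln_square: "continuous_on UNIV (\<lambda>y::real. y * ln (y\<^sup>2) / 2 - y)"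
proof -
  have bound: "\<bar>y * ln (y\<^sup>2)\<bar> \<le> 4 * sqrt \<bar>y\<bar>" if y: "\<bar>y\<bar> \<le> 1" for y :: real
  proof (cases "y = 0")
    case False
    define s where "s = sqrt \<bar>y\<bar>"
    have s: "0 < s" "s \<le> 1" "\<bar>y\<bar> = s\<^sup>2" using False y unfolding s_def by auto
    have "y\<^sup>2 = s ^ 4" using s(3) by (metis power2_abs power_mult numeral_times_numeral semiring_norm(13,12) mult_2 numeral_Bit0)
    then have "ln (y\<^sup>2) = 4 * ln s" using s(1) by (simp add: ln_realpow)
    moreover have "ln s \<le> 0" using s by simp
    ultimately have "\<bar>y * ln (y\<^sup>2)\<bar> = 4 * (s\<^sup>2 * (- ln s))" using s(3) by (simp add: abs_mult)
    moreover have "- ln s \<le> 1 / s" using ln_le_minus_one[of "1 / s"] s(1) by (simp add: ln_div)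
    then have "s\<^sup>2 * (- ln s) \<le> s\<^sup>2 * (1 / s)" by (rule mult_left_mono) simp
    then have "s\<^sup>2 * (- ln s) \<le> s" using s(1) by (simp add: power2_eq_square)
    ultimately show ?thesis unfolding s_def by simp
  qed simp
  have "isCont (\<lambda>y::real. y * ln (y\<^sup>2)) x" for x
  proof (cases "x = 0")
    case True
    have "((\<lambda>y::real. y * ln (y\<^sup>2)) \<longlongrightarrow> 0) (at 0)"
    proof (rule Lim_null_comparison)
      show "eventually (\<lambda>y. norm (y * ln (y\<^sup>2)) \<le> 4 * sqrt \<bar>y\<bar>) (at (0::real))"
        unfolding eventually_at using bound by (intro exI[of _ 1]) (auto simp: dist_norm)
      have "((\<lambda>y::real. 4 * sqrt \<bar>y\<bar>) \<longlongrightarrow> 4 * sqrt \<bar>0\<bar>) (at 0)" by (intro tendsto_intros)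
      then show "((\<lambda>y::real. 4 * sqrt \<bar>y\<bar>) \<longlongrightarrow> 0) (at 0)" by simp
    qed
    then show ?thesis unfolding isCont_def True by simp
  qed (auto intro!: continuous_intros)
  then have c: "continuous_on UNIV (\<lambda>y::real. y * ln (y\<^sup>2))" using continuous_at_imp_continuous_on by blast
  show ?thesis by (intro c continuous_on_diff continuous_on_divide continuous_on_id continuous_on_const) auto
qed

text \<open>The map \<open>dist x\<close> does not increase distances. If its image of
  \<open>K\<close> contained an interval, polynomials small on \<open>K\<close> would give products
  of real linear factors equally small on that interval, but the integral of the logarithm of each
  factor is bounded below.\<close>

lemma cheb_zero_avoids_circle:
  assumes K: "cheb_zero K" "bounded K" and \<rho>: "\<rho> > 0"
  shows "\<exists>r. 0 < r \<and> r < \<rho> \<and> sphere x r \<inter> K = {}"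
proof (rule ccontr)
  assume "\<not> ?thesis"
  then have meet: "\<exists>z\<in>K. dist x z = r" if "0 < r" "r < \<rho>" for r using that by fastforce
  define L where "L = (\<lambda>y::real. y * ln (y\<^sup>2) / 2 - y)"
  obtain B where B: "\<And>a. a \<in> K \<Longrightarrow> dist x a \<le> B" "B \<ge> 0"
  proof -
    obtain e where "\<And>a. a \<in> K \<Longrightarrow> dist x a \<le> e" using K(2) unfolding bounded_any_center[of K x] by auto
    then show ?thesis using that[of "max e 0"] by (simp add: le_max_iff_disj)
  qed
  have contL: "continuous_on S L" for S
    unfolding L_def using continuous_on_subset[OF continuous_x_ln_square] by blast
  have derivL: "(L has_real_derivative ln (y\<^sup>2) / 2) (at y)" if "y \<noteq> 0" for y
  proof -
    have "y\<^sup>2 > 0" using that by simp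
    then show ?thesis unfolding L_def using that
      by (auto intro!: derivative_eq_intros simp: field_simps) (simp add: power2_eq_square)
  qed
  have "bounded (L ` {- B..\<rho>})" by (intro compact_imp_bounded compact_continuous_image contL) auto
  then obtain M where M: "\<And>y. y \<in> {-B..\<rho>} \<Longrightarrow> \<bar>L y\<bar> \<le> M" "M > 0"
    unfolding bounded_pos by (metis imageI real_norm_def)
  \<comment> \<open>Each zero contributes at least \<open>- 2 * M\<close> to the integral of the
    logarithms, whereas smallness on \<open>K\<close> bounds the whole integral by
    \<open>\<rho> * n * ln e\<close>; this \<open>e\<close> makes the latter
    \<open>- n * (2 * M + 1)\<close>.\<close>
  define e where "e = exp (- (2 * M + 1) / \<rho>)"
  have e: "e > 0" "\<rho> * ln e = - (2 * M + 1)" using \<rho> unfolding e_def by simp_all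
  obtain n xs where xs: "n \<ge> 1" "length xs \<le> n" "set xs \<subseteq> K" "\<And>z. z \<in> K \<Longrightarrow> norm (lprod xs z) \<le> e ^ n"
    using K(1) e(1) unfolding cheb_zero_def by metis
  \<comment> \<open>\<open>L\<close> is a primitive of \<open>ln |y|\<close>, so \<open>G\<close> is one of \<open>\<Sum> ln |r - dist x a|\<close>, which is below \<open>n ln e\<close> if all circles meet \<open>K\<close>.\<close>
  define G where "G = (\<lambda>r. \<Sum>a\<leftarrow>xs. L (r - dist x a))"
  define S where "S = (dist x) ` set xs"
  \<comment> \<open>The value at exceptional radii is chosen so that the upper bound
    \<open>n * ln e\<close> holds for every \<open>r\<close>.\<close>
  define G' where "G' = (\<lambda>r. if r \<in> {0<..<\<rho>} - S then (\<Sum>a\<leftarrow>xs. ln ((r - dist x a)\<^sup>2) / 2) else n * ln e)"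
  have G'le: "G' r \<le> n * ln e" for r
  proof (cases "r \<in> {0<..<\<rho>} - S")
    case True
    then obtain z where z: "z \<in> K" "dist x z = r" using meet by auto
    have "(\<Sum>a\<leftarrow>ys. ln ((r - dist x a)\<^sup>2) / 2) \<le> ln (norm (lprod ys z)) \<and> lprod ys z \<noteq> 0" if "set ys \<subseteq> set xs" for ys
      using that
    proof (induction ys)
      case (Cons a ys)
      have ne: "r - dist x a \<noteq> 0" using True Cons.prems unfolding S_def by auto
      have le: "\<bar>r - dist x a\<bar> \<le> norm (z - a)"
        using z(2) dist_triangle[of x z a] dist_triangle[of x a z] by (simp add: dist_norm norm_minus_commute)
      have "ln ((r - dist x a)\<^sup>2) / 2 = ln \<bar>r - dist x a\<bar>"
        using ne by (metis ln_realpow power2_abs zero_less_abs_iff of_nat_numeral nonzero_mult_div_cancel_left zero_neq_numeral)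
      also have "\<dots> \<le> ln (norm (z - a))" using ne le by (intro ln_mono) auto
      finally have "ln ((r - dist x a)\<^sup>2) / 2 \<le> ln (norm (z - a))" .
      moreover have "z \<noteq> a" using le ne by auto
      ultimately show ?case using Cons by (simp add: lprod_Cons norm_mult ln_mult)
    qed (simp add: lprod_Nil)
    from this[OF order_refl] have "G' r \<le> ln (norm (lprod xs z))" "lprod xs z \<noteq> 0"
      using True unfolding G'_def by auto
    moreover have "ln (norm (lprod xs z)) \<le> ln (e ^ n)" using xs(4)[OF z(1)] calculation(2) by (intro ln_mono) auto
    ultimately show ?thesis using e(1) by (simp add: ln_realpow)
  next
    case False
    then show ?thesis unfolding G'_def by (simp only: if_False order_refl)
  qed
  have "(G' has_integral (G \<rho> - G 0)) {0..\<rho>}"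
  proof (rule fundamental_theorem_of_calculus_interior_strong[where S = S])
    show "finite S" unfolding S_def by simp
    show "continuous_on {0..\<rho>} G" unfolding G_def
      by (induction xs) (auto intro!: continuous_intros continuous_on_compose2[OF contL[of UNIV]])
    fix r assume r: "r \<in> {0<..<\<rho>} - S"
    have "((\<lambda>r. \<Sum>a\<leftarrow>ys. L (r - dist x a)) has_real_derivative (\<Sum>a\<leftarrow>ys. ln ((r - dist x a)\<^sup>2) / 2)) (at r)"
      if "set ys \<subseteq> set xs" for ys
      using that
    proof (induction ys)
      case (Cons a ys)
      have ne: "r - dist x a \<noteq> 0" using r Cons.prems unfolding S_def by auto
      have "((\<lambda>r. L (r - dist x a)) has_real_derivative ln ((r - dist x a)\<^sup>2) / 2 * 1) (at r)"
        by (rule DERIV_chain2[where f = L and g = "\<lambda>r. r - dist x a", OF derivL[OF ne]]) (auto intro!: derivative_eq_intros)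
      then show ?case using Cons by (auto intro!: derivative_intros)
    qed simp
    from this[OF order_refl] show "(G has_vector_derivative G' r) (at r)"
      using r unfolding G_def G'_def by (simp add: has_real_derivative_iff_has_vector_derivative)
  qed (use \<rho> in simp)
  moreover have "((\<lambda>_. real n * ln e) has_integral (\<rho> - 0) *\<^sub>R (real n * ln e)) {0..\<rho>}"
    using has_integral_const_real[of "real n * ln e" 0 \<rho>] \<rho> by simp
  ultimately have "G \<rho> - G 0 \<le> \<rho> * (n * ln e)"
    using has_integral_le[of G' _ "{0..\<rho>}" "\<lambda>_. real n * ln e"] G'le by simp
  then have 1: "G \<rho> - G 0 \<le> - n * (2 * M + 1)" unfolding mult.left_commute[of \<rho>] e(2) by (simp add: algebra_simps)
  have "G \<rho> - G 0 \<ge> - 2 * M * length ys" if "set ys \<subseteq> set xs" "G = (\<lambda>r. \<Sum>a\<leftarrow>ys. L (r - dist x a))" for ys G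
    using that
  proof (induction ys arbitrary: G)
    case (Cons a ys)
    have "a \<in> K" using Cons.prems xs(3) by auto
    then have "\<bar>L (\<rho> - dist x a)\<bar> \<le> M" "\<bar>L (0 - dist x a)\<bar> \<le> M" using B(1)[OF \<open>a \<in> K\<close>] B(2) \<rho> zero_le_dist[of x a] by (auto intro!: M(1) simp del: zero_le_dist)
    then have "L (\<rho> - dist x a) - L (0 - dist x a) \<ge> - 2 * M" by linarith
    moreover have "(\<Sum>a\<leftarrow>ys. L (\<rho> - dist x a)) - (\<Sum>a\<leftarrow>ys. L (0 - dist x a)) \<ge> - 2 * M * length ys"
      using Cons.IH[OF _ refl] Cons.prems(1) by simp
    ultimately show ?case unfolding Cons.prems(2) by (simp add: algebra_simps)
  qed simp
  from this[OF order_refl G_def] have "G \<rho> - G 0 \<ge> - 2 * M * length xs" .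
  moreover have "- 2 * M * real (length xs) \<ge> - 2 * M * n" using M(2) xs(2) by simp
  ultimately have "- 2 * M * n \<le> - n * (2 * M + 1)" using 1 by linarith
  then have "real n \<le> 0" by (simp add: algebra_simps)
  then show False using xs(1) by simp
qed

section \<open>Cauchy integrals over circles and annuli\<close>

text \<open>Differentiation under the integral. It serves both the circles here and the polynomial
  paths of the barriers.\<close>

lemma holomorphic_Cauchy_transform:
  assumes "valid_path \<gamma>" "continuous_on (path_image \<gamma>) h"
    "\<And>t. t \<in> {0..1} \<Longrightarrow> norm (vector_derivative \<gamma> (at t)) \<le> B"
    "\<And>w. w \<notin> path_image \<gamma> \<Longrightarrow> (\<lambda>u. h u / (u - w)) contour_integrable_on \<gamma>"
  shows "(\<lambda>w. contour_integral \<gamma> (\<lambda>u. h u / (u - w))) holomorphic_on - path_image \<gamma>"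
proof -
  have "\<exists>D. ((\<lambda>w. contour_integral \<gamma> (\<lambda>u. h u / (u - w))) has_field_derivative D) (at w)" if "w \<in> - path_image \<gamma>" for w
  proof (rule exI, rule Cauchy_next_derivative(2)[where k = 1 and S = UNIV and B = B])
    show "((\<lambda>u. h u / (u - w) ^ 1) has_contour_integral contour_integral \<gamma> (\<lambda>u. h u / (u - w))) \<gamma>"
      if "w \<in> UNIV - path_image \<gamma>" for w using assms(4)[of w] that by (simp add: has_contour_integral_integral)
  qed (use assms that in auto)
  moreover have "open (- path_image \<gamma>)" using closed_valid_path_image[OF assms(1)] by (rule open_Compl)
  ultimately show ?thesis unfolding holomorphic_on_open[OF \<open>open (- path_image \<gamma>)\<close>] by blast
qed

lemma holomorphic_Cauchy_circle:
  assumes "continuous_on (sphere x r) h" "r > 0"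
  shows "(\<lambda>w. contour_integral (circlepath x r) (\<lambda>u. h u / (u - w))) holomorphic_on - sphere x r"
    and "w \<notin> sphere x r \<Longrightarrow> (\<lambda>u. h u / (u - w)) contour_integrable_on circlepath x r"
proof -
  show i: "(\<lambda>u. h u / (u - w)) contour_integrable_on circlepath x r" if "w \<notin> sphere x r" for w
    using assms that by (intro contour_integrable_continuous_circlepath continuous_intros) (auto simp: path_image_circlepath)
  have "(\<lambda>w. contour_integral (circlepath x r) (\<lambda>u. h u / (u - w))) holomorphic_on - path_image (circlepath x r)"
    by (rule holomorphic_Cauchy_transform[where B = "2 * pi * r"])
       (use assms i in \<open>auto simp: vector_derivative_circlepath norm_mult\<close>)
  then show "(\<lambda>w. contour_integral (circlepath x r) (\<lambda>u. h u / (u - w))) holomorphic_on - sphere x r"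
    using assms by simp
qed

lemma Cauchy_circle_bound:
  assumes "continuous_on (sphere x r) h" "r > 0" "d > 0"
    "\<And>u. u \<in> sphere x r \<Longrightarrow> norm (h u) \<le> B" "\<And>u. u \<in> sphere x r \<Longrightarrow> d \<le> norm (u - w)" "0 \<le> B"
  shows "norm (contour_integral (circlepath x r) (\<lambda>u. h u / (u - w)) / (2 * of_real pi * \<i>)) \<le> r / d * B"
proof -
  have w: "w \<notin> sphere x r" using assms(3) assms(5)[of w] by force
  have "norm (contour_integral (circlepath x r) (\<lambda>u. h u / (u - w))) \<le> B / d * (2 * pi * r)"
  proof (rule has_contour_integral_bound_circlepath)
    show "((\<lambda>u. h u / (u - w)) has_contour_integral contour_integral (circlepath x r) (\<lambda>u. h u / (u - w))) (circlepath x r)"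
      using holomorphic_Cauchy_circle(2)[OF assms(1,2) w] by (rule has_contour_integral_integral)
    show "norm (h u / (u - w)) \<le> B / d" if "norm (u - x) = r" for u
    proof -
      have "u \<in> sphere x r" using that by (simp add: dist_norm norm_minus_commute)
      then show ?thesis unfolding norm_divide using assms(3-6) by (intro frac_le) auto
    qed
  qed (use assms in auto)
  then show ?thesis using assms(2) by (simp add: norm_divide norm_mult field_simps)
qed

text \<open>The difference quotient \<open>q\<close> extends holomorphically across
  \<open>z\<close>, so its integrals over the two homotopic circles agree. What remains is
  \<open>h z\<close> times the integral of \<open>1 / (u - z)\<close>, which is
  \<open>2 * pi * \<i>\<close> on the outer circle and \<open>0\<close> on the inner one.\<close>

lemma annulus_Cauchy:
  assumes h: "h holomorphic_on U" "open U" and r: "0 < r1" "r1 < r2"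
    and ann: "\<And>z. r1 \<le> dist x z \<Longrightarrow> dist x z \<le> r2 \<Longrightarrow> z \<in> U"
    and z: "r1 < dist x z" "dist x z < r2"
  shows "2 * of_real pi * \<i> * h z = contour_integral (circlepath x r2) (\<lambda>u. h u / (u - z)) - contour_integral (circlepath x r1) (\<lambda>u. h u / (u - z))"
proof -
  define q where "q u = (if u = z then deriv h z else (h u - h z) / (u - z))" for u
  have zU: "z \<in> U" using ann[of z] z by simp
  have q: "q holomorphic_on U"
    unfolding q_def using pole_theorem_open[of "\<lambda>u. h u - h z" U z] h zU
    by (intro pole_lemma_open[of h U]) auto
  have hom: "homotopic_loops U (circlepath x r2) (circlepath x r1)"
  proof (rule homotopic_loops_linear)
    fix t :: real assume "t \<in> {0..1}"
    show "closed_segment (circlepath x r2 t) (circlepath x r1 t) \<subseteq> U"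
    proof
      fix y assume "y \<in> closed_segment (circlepath x r2 t) (circlepath x r1 t)"
      then obtain s where s: "0 \<le> s" "s \<le> 1" "y = (1 - s) *\<^sub>R circlepath x r2 t + s *\<^sub>R circlepath x r1 t"
        unfolding closed_segment_def by auto
      have "y - x = of_real ((1 - s) * r2 + s * r1) * exp (2 * of_real pi * \<i> * of_real t)"
        unfolding s(3) circlepath by (simp add: scaleR_conv_of_real algebra_simps)
      then have "norm (y - x) = \<bar>(1 - s) * r2 + s * r1\<bar>" by (simp add: norm_mult del: of_real_add of_real_mult of_real_diff)
      moreover have "r1 \<le> (1 - s) * r2 + s * r1" "(1 - s) * r2 + s * r1 \<le> r2"
        using s r mult_left_mono[of r1 r2 "1 - s"] mult_left_mono[of r1 r2 s] by (auto simp: algebra_simps)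
      ultimately show "y \<in> U" using r by (intro ann) (auto simp: dist_norm norm_minus_commute)
    qed
  qed auto
  have qq: "contour_integral (circlepath x r2) q = contour_integral (circlepath x r1) q"
    by (rule Cauchy_theorem_homotopic_loops[OF hom h(2) q]) auto
  have sph: "sphere x r1 \<subseteq> U" "sphere x r2 \<subseteq> U" using ann r by auto
  have ch: "continuous_on (sphere x r) h" if "sphere x r \<subseteq> U" for r
    using h(1) holomorphic_on_imp_continuous_on holomorphic_on_subset that by blast
  have split: "contour_integral (circlepath x r) q = contour_integral (circlepath x r) (\<lambda>u. h u / (u - z)) - h z * contour_integral (circlepath x r) (\<lambda>u. 1 / (u - z))"
    if "sphere x r \<subseteq> U" "r > 0" "z \<notin> sphere x r" for r
  proof -
    have "contour_integral (circlepath x r) q = contour_integral (circlepath x r) (\<lambda>u. h u / (u - z) - h z * (1 / (u - z)))"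
      using that by (intro contour_integral_eq) (auto simp: q_def diff_divide_distrib)
    also have "\<dots> = contour_integral (circlepath x r) (\<lambda>u. h u / (u - z)) - contour_integral (circlepath x r) (\<lambda>u. h z * (1 / (u - z)))"
      using holomorphic_Cauchy_circle(2)[OF ch[OF that(1)] that(2,3)] holomorphic_Cauchy_circle(2)[of x r "\<lambda>_. 1", OF _ that(2,3)]
      by (intro contour_integral_diff contour_integrable_lmul) auto
    also have "contour_integral (circlepath x r) (\<lambda>u. h z * (1 / (u - z))) = h z * contour_integral (circlepath x r) (\<lambda>u. 1 / (u - z))"
      using holomorphic_Cauchy_circle(2)[of x r "\<lambda>_. 1", OF _ that(2,3)] by (intro contour_integral_lmul) auto
    finally show ?thesis .
  qed
  have "((\<lambda>u. 1 / (u - z)) has_contour_integral (2 * of_real pi * \<i>) * 1) (circlepath x r2)"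
    using z(2) by (intro Cauchy_integral_circlepath) (auto simp: dist_norm norm_minus_commute)
  then have i2: "contour_integral (circlepath x r2) (\<lambda>u. 1 / (u - z)) = 2 * of_real pi * \<i>" by (simp add: contour_integral_unique)
  have "((\<lambda>u. 1 / (u - z)) has_contour_integral 0) (circlepath x r1)"
    by (rule Cauchy_theorem_disc_simple[where a = x and e = "dist x z"])
       (use r z in \<open>auto intro!: holomorphic_intros\<close>)
  then have i1: "contour_integral (circlepath x r1) (\<lambda>u. 1 / (u - z)) = 0" by (simp add: contour_integral_unique)
  show ?thesis using qq split[OF sph(1)] split[OF sph(2)] i1 i2 r z by (simp add: algebra_simps)
qed

section \<open>Splitting off singularities\<close>

text \<open>The function \<open>H\<close> is \<open>h\<close> with its singularities in \<open>N\<close> split off, with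
  bounds that are linear in the supremum of \<open>h\<close> over a set \<open>T\<close> away from the singularities.\<close>

definition splits_off :: "complex set \<Rightarrow> complex set \<Rightarrow> complex set \<Rightarrow> complex set \<Rightarrow> real \<Rightarrow> (complex \<Rightarrow> complex) \<Rightarrow> (complex \<Rightarrow> complex) \<Rightarrow> bool" where
  "splits_off U A N T C h H \<longleftrightarrow> H holomorphic_on (U - (A - N)) \<and>
    (\<forall>B\<ge>0. (\<forall>t\<in>T. norm (h t) \<le> B) \<longrightarrow>
      (\<forall>z\<in>N. norm (H z) \<le> C * B) \<and> (\<forall>z\<in>U - A - N. norm (H z - h z) \<le> C * B))"

lemma splits_off_holomorphic: "splits_off U A N T C h H \<Longrightarrow> H holomorphic_on (U - (A - N))"
  unfolding splits_off_def by blast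

lemma splits_off_bound:
  assumes "splits_off U A N T C h H" "0 \<le> B" "\<forall>t\<in>T. norm (h t) \<le> B"
  shows "z \<in> N \<Longrightarrow> norm (H z) \<le> C * B"
    and "z \<in> U \<Longrightarrow> z \<notin> A \<Longrightarrow> z \<notin> N \<Longrightarrow> norm (H z - h z) \<le> C * B"
proof -
  have *: "(\<forall>z\<in>N. norm (H z) \<le> C * B) \<and> (\<forall>z\<in>U - A - N. norm (H z - h z) \<le> C * B)"
    using assms unfolding splits_off_def by simp
  show "z \<in> N \<Longrightarrow> norm (H z) \<le> C * B"
    and "z \<in> U \<Longrightarrow> z \<notin> A \<Longrightarrow> z \<notin> N \<Longrightarrow> norm (H z - h z) \<le> C * B"
    using * by simp_all
qed

text \<open>In the ball \<open>H\<close> is the outer Cauchy integral, outside it is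
  \<open>h\<close> plus the inner one; on the annulus the two agree. The constant reflects the
  distances \<open>r2 - r\<close> and \<open>r - r1\<close> to the circles of integration.\<close>

lemma laurent_split:
  assumes U: "open (U - A)" and h: "h holomorphic_on (U - A)" and r: "0 < r1" "r1 < r" "r < r2"
    and cb: "cball x r2 \<subseteq> U" and ann: "\<And>z. r1 \<le> dist x z \<Longrightarrow> dist x z \<le> r2 \<Longrightarrow> z \<notin> A"
  shows "\<exists>H. splits_off U A (ball x r) {z. r1 \<le> dist x z \<and> dist x z \<le> r2} (r2 / (r2 - r) + r1 / (r - r1)) h H"
proof -
  define I where "I r z = contour_integral (circlepath x r) (\<lambda>u. h u / (u - z)) / (2 * of_real pi * \<i>)" for r z
  define H where "H z = (if z \<in> ball x r then I r2 z else h z + I r1 z)" for z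
  have inUA: "z \<in> U - A" if "r1 \<le> dist x z" "dist x z \<le> r2" for z
    using ann[OF that] cb that(2) by auto
  have sph: "continuous_on (sphere x r1) h" "continuous_on (sphere x r2) h"
    using inUA r holomorphic_on_imp_continuous_on[OF h] by (auto elim!: continuous_on_subset)
  have hol1: "I r1 holomorphic_on - sphere x r1" and hol2: "I r2 holomorphic_on - sphere x r2"
    unfolding I_def using r by (auto intro!: holomorphic_intros holomorphic_Cauchy_circle sph)
  have eq: "I r2 z = h z + I r1 z" if "r1 < dist x z" "dist x z < r2" for z
  proof -
    have "2 * of_real pi * \<i> * h z = contour_integral (circlepath x r2) (\<lambda>u. h u / (u - z)) - contour_integral (circlepath x r1) (\<lambda>u. h u / (u - z))"
      by (rule annulus_Cauchy[OF h U]) (use r inUA that in auto)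
    then show ?thesis unfolding I_def by (simp add: field_simps)
  qed
  let ?O = "U - A - cball x r1"
  have opO: "open ?O" by (rule open_Diff[OF U closed_cball])
  have 1: "H holomorphic_on ball x r"
  proof -
    have "I r2 holomorphic_on ball x r" using r by (intro holomorphic_on_subset[OF hol2]) auto
    then show ?thesis by (rule holomorphic_transform) (simp add: H_def)
  qed
  have 2: "H holomorphic_on ?O"
  proof -
    have "(\<lambda>z. h z + I r1 z) holomorphic_on ?O"
      by (intro holomorphic_on_add holomorphic_on_subset[OF h] holomorphic_on_subset[OF hol1]) auto
    moreover have "h z + I r1 z = H z" if "z \<in> ?O" for z
      using eq[of z] that r by (auto simp: H_def)
    ultimately show ?thesis by (rule holomorphic_transform)
  qed
  have "H holomorphic_on (ball x r \<union> ?O)" using 1 2 opO by (intro holomorphic_on_Un) auto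
  moreover have "U - (A - ball x r) \<subseteq> ball x r \<union> ?O" using r by auto
  ultimately have Hhol: "H holomorphic_on (U - (A - ball x r))" by (rule holomorphic_on_subset)
  have "(\<forall>z\<in>ball x r. norm (H z) \<le> (r2 / (r2 - r) + r1 / (r - r1)) * B) \<and>
      (\<forall>z\<in>U - A - ball x r. norm (H z - h z) \<le> (r2 / (r2 - r) + r1 / (r - r1)) * B)"
    if B: "B \<ge> 0" "\<And>z. r1 \<le> dist x z \<Longrightarrow> dist x z \<le> r2 \<Longrightarrow> norm (h z) \<le> B" for B
  proof (intro conjI ballI)
    have p: "r2 / (r2 - r) \<ge> 0" "r1 / (r - r1) \<ge> 0" using r by simp_all
    fix z assume z: "z \<in> ball x r"
    have "norm (I r2 z) \<le> r2 / (r2 - r) * B"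
      unfolding I_def
    proof (rule Cauchy_circle_bound[OF sph(2)])
      show "norm (h u) \<le> B" if "u \<in> sphere x r2" for u using B(2)[of u] that r by simp
      show "r2 - r \<le> norm (u - z)" if "u \<in> sphere x r2" for u
        using that z dist_triangle[of x u z] by (simp add: dist_norm norm_minus_commute)
    qed (use r B in auto)
    also have "\<dots> \<le> (r2 / (r2 - r) + r1 / (r - r1)) * B" using p B(1) by (intro mult_right_mono) auto
    finally show "norm (H z) \<le> (r2 / (r2 - r) + r1 / (r - r1)) * B" using z by (simp add: H_def)
  next
    have p: "r2 / (r2 - r) \<ge> 0" "r1 / (r - r1) \<ge> 0" using r by simp_all
    fix z assume z: "z \<in> U - A - ball x r"
    have "norm (I r1 z) \<le> r1 / (r - r1) * B"
      unfolding I_def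
    proof (rule Cauchy_circle_bound[OF sph(1)])
      show "norm (h u) \<le> B" if "u \<in> sphere x r1" for u using B(2)[of u] that r by simp
      show "r - r1 \<le> norm (u - z)" if "u \<in> sphere x r1" for u
        using that z dist_triangle[of x z u] by (simp add: dist_norm norm_minus_commute)
    qed (use r B in auto)
    also have "\<dots> \<le> (r2 / (r2 - r) + r1 / (r - r1)) * B" using p B(1) by (intro mult_right_mono) auto
    finally show "norm (H z - h z) \<le> (r2 / (r2 - r) + r1 / (r - r1)) * B" using z by (simp add: H_def)
  qed
  then show ?thesis using Hhol unfolding splits_off_def by (intro exI[of _ H]) simp
qed

lemma circle_gap:
  fixes x :: complex
  assumes "sphere x r \<subseteq> V" "open V" "0 < r"
  obtains r1 r2 where "0 < r1" "r1 < r" "r < r2" "\<And>z. r1 \<le> dist x z \<Longrightarrow> dist x z \<le> r2 \<Longrightarrow> z \<in> V"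
proof -
  have "x + of_real r \<in> sphere x r" using assms(3) by (simp add: dist_norm)
  then have "sphere x r \<noteq> {}" by blast
  then obtain e where e: "e > 0" "{y. infdist y (sphere x r) \<le> e} \<subseteq> V"
    using compact_in_open_separated[of "sphere x r" V] assms by auto
  define d where "d = min e (r / 2)"
  have d: "d > 0" "d \<le> e" "d < r" using e assms unfolding d_def by auto
  show ?thesis
  proof (rule that[of "r - d" "r + d"])
    fix z assume z: "r - d \<le> dist x z" "dist x z \<le> r + d"
    define n where "n = norm (z - x)"
    have n: "n > 0" "r - d \<le> n" "n \<le> r + d" using z d unfolding n_def by (auto simp: dist_norm norm_minus_commute)
    define p where "p = x + of_real (r / n) * (z - x)"
    have "dist x p = r" unfolding p_def using n assms(3) by (simp add: dist_norm norm_mult n_def[symmetric] norm_divide)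
    then have "p \<in> sphere x r" by simp
    then have "infdist z (sphere x r) \<le> dist z p" by (rule infdist_le)
    also have "dist z p = norm (of_real (1 - r / n) * (z - x))"
      unfolding p_def dist_norm by (simp add: algebra_simps)
    also have "\<dots> = \<bar>1 - r / n\<bar> * n" by (simp only: norm_mult norm_of_real n_def)
    also have "\<dots> = \<bar>(1 - r / n) * n\<bar>" using n(1) by (simp only: abs_mult abs_of_pos)
    also have "(1 - r / n) * n = n - r" using n(1) by (simp add: field_simps)
    also have "\<bar>n - r\<bar> \<le> e" using n d by linarith
    finally show "z \<in> V" using e(2) by blast
  qed (use d in auto)
qed

text \<open>The discs may overlap, so they are treated one at a time, each on the function obtained
  so far. On the new annulus that function is bounded by \<open>(C + 1) * B\<close>, whence the new
  constant. \<open>T\<close> and \<open>C\<close> precede \<open>h\<close> because they will serve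
  \<open>p^m * f\<close> for a power \<open>m\<close> chosen afterwards.\<close>

lemma singularity_split:
  assumes D: "open D" "open (D - A)" and W: "open W" "W \<subseteq> D"
    and fin: "finite \<B>" and B: "\<And>x r. (x, r) \<in> \<B> \<Longrightarrow> 0 < r \<and> cball x r \<subseteq> W \<and> sphere x r \<inter> A = {}"
  shows "\<exists>T C. compact T \<and> T \<subseteq> W - A \<and> 0 \<le> C \<and>
    (\<forall>h. h holomorphic_on (D - A) \<longrightarrow> (\<exists>H. splits_off D A (\<Union>(x,r)\<in>\<B>. ball x r) T C h H))"
  using fin B
proof (induction \<B> rule: finite_induct)
  case empty
  have "splits_off D A {} {} 0 h h" if "h holomorphic_on (D - A)" for h
    using that unfolding splits_off_def by simp
  then show ?case by (intro exI[of _ "{}"] exI[of _ 0]) auto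
next
  case (insert b \<B>)
  obtain x r where b: "b = (x, r)" by fastforce
  let ?N = "\<Union>(x,r)\<in>\<B>. ball x r"
  have N': "(\<Union>(x,r)\<in>insert b \<B>. ball x r) = ball x r \<union> ?N" unfolding b by simp
  have xr: "0 < r" "cball x r \<subseteq> W" "sphere x r \<inter> A = {}" using insert.prems[of x r] b by auto
  obtain T C where TC: "compact T" "T \<subseteq> W - A" "0 \<le> C"
    and IH: "\<And>h. h holomorphic_on (D - A) \<Longrightarrow> \<exists>H. splits_off D A ?N T C h H"
    using insert.IH insert.prems by (metis insertCI)
  have NW: "?N \<subseteq> W" using insert.prems by fastforce
  have "open ?N" by auto
  have "W - A = W \<inter> (D - A)" using W by auto
  then have opWA: "open (W - A)" using W D by (simp add: open_Int)
  have "sphere x r \<subseteq> W - A" using xr by auto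
  then obtain r1 r2 where r: "0 < r1" "r1 < r" "r < r2" and gap: "\<And>z. r1 \<le> dist x z \<Longrightarrow> dist x z \<le> r2 \<Longrightarrow> z \<in> W - A"
    using circle_gap[OF _ opWA xr(1)] by metis
  define C' where "C' = r2 / (r2 - r) + r1 / (r - r1)"
  have C': "C' \<ge> 0" using r unfolding C'_def by (intro add_nonneg_nonneg divide_nonneg_nonneg) auto
  define R where "R = {z. r1 \<le> dist x z \<and> dist x z \<le> r2}"
  have "R = cball x r2 - ball x r1" unfolding R_def by auto
  then have Rc: "compact R" by (simp add: compact_diff)
  have RW: "R \<subseteq> W - A" using gap unfolding R_def by auto
  have eqO: "D - (A - ?N) = (D - A) \<union> ?N" using NW W by auto
  have op: "open (D - (A - ?N))" unfolding eqO using D \<open>open ?N\<close> by (intro open_Un)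
  have cb: "cball x r2 \<subseteq> D"
  proof
    fix z assume z: "z \<in> cball x r2"
    show "z \<in> D"
    proof (cases "dist x z \<le> r")
      case True then show ?thesis using xr(2) W(2) by auto
    next
      case False then show ?thesis using gap[of z] z r W(2) by auto
    qed
  qed
  show ?case unfolding N'
  proof (intro exI[of _ "T \<union> R"] exI[of _ "C' * (C + 1) + C"] conjI allI impI)
    show "compact (T \<union> R)" using TC Rc by auto
    show "T \<union> R \<subseteq> W - A" using TC RW by auto
    show "0 \<le> C' * (C + 1) + C" using C' TC by auto
    fix h assume h: "h holomorphic_on (D - A)"
    obtain H where Hs: "splits_off D A ?N T C h H" using IH[OF h] by blast
    note H = splits_off_holomorphic[OF Hs]
    have annA: "z \<notin> A - ?N" if "r1 \<le> dist x z" "dist x z \<le> r2" for z using gap[OF that] by auto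
    obtain H' where Hs': "splits_off D (A - ?N) (ball x r) {z. r1 \<le> dist x z \<and> dist x z \<le> r2} C' H H'"
      using laurent_split[OF op H r cb] annA unfolding C'_def by blast
    note H' = splits_off_holomorphic[OF Hs']
    have "D - (A - ?N - ball x r) = D - (A - (ball x r \<union> ?N))" by auto
    then have hol: "H' holomorphic_on D - (A - (ball x r \<union> ?N))" using H' by simp
    have "(\<forall>z\<in>ball x r \<union> ?N. norm (H' z) \<le> (C' * (C + 1) + C) * B) \<and>
          (\<forall>z\<in>D - A - (ball x r \<union> ?N). norm (H' z - h z) \<le> (C' * (C + 1) + C) * B)"
      if B: "B \<ge> 0" "\<forall>t\<in>T \<union> R. norm (h t) \<le> B" for B
    proof -
      have hT: "\<forall>t\<in>T. norm (h t) \<le> B" using B(2) by simp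
      note Hb = splits_off_bound[OF Hs B(1) hT]
      have "norm (H z) \<le> (C + 1) * B" if z: "r1 \<le> dist x z \<and> dist x z \<le> r2" for z
      proof (cases "z \<in> ?N")
        case True
        then have "norm (H z) \<le> C * B" using Hb(1) by blast
        then show ?thesis using B(1) by (simp add: algebra_simps)
      next
        case False
        have "z \<in> W - A" using gap z by auto
        then have "norm (H z - h z) \<le> C * B" using Hb(2) False W(2) by blast
        moreover have "norm (h z) \<le> B" using B(2) z unfolding R_def by blast
        moreover have "norm (H z) \<le> norm (H z - h z) + norm (h z)" using norm_triangle_ineq[of "H z - h z" "h z"] by simp
        ultimately show ?thesis by (simp add: algebra_simps)
      qed
      then have HR: "\<forall>z\<in>{z. r1 \<le> dist x z \<and> dist x z \<le> r2}. norm (H z) \<le> (C + 1) * B" by blast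
      have CB1: "(C + 1) * B \<ge> 0" using B(1) TC(3) by simp
      have HH: "\<And>z. z \<in> ball x r \<Longrightarrow> norm (H' z) \<le> C' * ((C + 1) * B)"
         "\<And>z. z \<in> D - (A - ?N) - ball x r \<Longrightarrow> norm (H' z - H z) \<le> C' * ((C + 1) * B)"
        using splits_off_bound[OF Hs' CB1 HR] by (blast, blast)
      have CB: "C * B \<ge> 0" "C' * ((C + 1) * B) \<ge> 0" using B(1) TC(3) C' by auto
      have eqC: "(C' * (C + 1) + C) * B = C' * ((C + 1) * B) + C * B" by (simp add: algebra_simps)
      show ?thesis unfolding eqC
      proof (intro conjI ballI)
        fix z assume z: "z \<in> ball x r \<union> ?N"
        show "norm (H' z) \<le> C' * ((C + 1) * B) + C * B"
        proof (cases "z \<in> ball x r")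
          case True
          then show ?thesis using HH(1)[of z] CB by linarith
        next
          case False
          then have zN: "z \<in> ?N" using z by blast
          then have "z \<in> D - (A - ?N) - ball x r" using False NW W(2) by blast
          then have "norm (H' z - H z) \<le> C' * ((C + 1) * B)" by (rule HH(2))
          moreover have "norm (H z) \<le> C * B" using Hb(1)[OF zN] .
          moreover have "norm (H' z) \<le> norm (H' z - H z) + norm (H z)" using norm_triangle_ineq[of "H' z - H z" "H z"] by simp
          ultimately show ?thesis by linarith
        qed
      next
        fix z assume z: "z \<in> D - A - (ball x r \<union> ?N)"
        then have "norm (H' z - H z) \<le> C' * ((C + 1) * B)" by (intro HH(2)) blast
        moreover have "norm (H z - h z) \<le> C * B" using Hb(2)[of z] z by blast
        moreover have "norm (H' z - h z) \<le> norm (H' z - H z) + norm (H z - h z)" using norm_triangle_ineq[of "H' z - H z" "H z - h z"] by simp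
        ultimately show "norm (H' z - h z) \<le> C' * ((C + 1) * B) + C * B" by linarith
      qed
    qed
    then show "\<exists>H. splits_off D A (ball x r \<union> ?N) (T \<union> R) (C' * (C + 1) + C) h H"
      using hol unfolding splits_off_def by (intro exI[of _ H']) simp
  qed
qed

section \<open>Approximation of the graph\<close>

lemma compact_Int_relatively_closed:
  assumes "open (D - A)" "compact L" "L \<subseteq> D"
  shows "compact (A \<inter> L)"
proof -
  have "A \<inter> L = L - (D - A)" using assms(3) by auto
  then show ?thesis using assms by (simp add: compact_diff)
qed

lemma compact_norm_bound:
  fixes f :: "'a::topological_space \<Rightarrow> 'b::real_normed_vector"
  assumes "compact T" "continuous_on T f"
  obtains B where "B \<ge> 0" "\<And>t. t \<in> T \<Longrightarrow> norm (f t) \<le> B"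
proof -
  have "bounded (f ` T)" using assms by (intro compact_imp_bounded compact_continuous_image)
  then obtain b where "b > 0" "\<forall>x\<in>f ` T. norm x \<le> b" unfolding bounded_pos by blast
  then show ?thesis by (intro that[of b]) auto
qed

lemma graph_gap:
  assumes "compact F" "continuous_on (fst ` F) f" "\<And>z w. (z, w) \<in> F \<Longrightarrow> w \<noteq> f z"
  obtains \<tau> :: real where "\<tau> > 0" "\<And>z w. (z, w) \<in> F \<Longrightarrow> \<tau> \<le> norm (w - f z :: complex)"
proof (cases "F = {}")
  case True
  then show ?thesis by (intro that[of 1]) auto
next
  case False
  have "continuous_on F (\<lambda>x. norm (snd x - f (fst x)))"
    by (intro continuous_intros continuous_on_compose2[OF assms(2)]) auto
  from continuous_attains_inf[OF assms(1) False this]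
  obtain x where x: "x \<in> F" "\<forall>y\<in>F. norm (snd x - f (fst x)) \<le> norm (snd y - f (fst y))" by blast
  show ?thesis
  proof (rule that[of "norm (snd x - f (fst x))"])
    show "norm (snd x - f (fst x)) > 0" using assms(3)[of "fst x" "snd x"] x(1) by simp
    show "norm (snd x - f (fst x)) \<le> norm (w - f z)" if "(z, w) \<in> F" for z w using bspec[OF x(2) that] by simp
  qed
qed

text \<open>Bounds for \<open>ln (norm F0) / q\<close>: above by \<open>N1\<close> up to a logarithm
  of \<open>w\<close>, below by \<open>- N2\<close> on \<open>F\<close>, and above by
  \<open>- M\<close> on the graph and over \<open>A\<close>. They are stated through
  \<open>exp\<close> because \<open>ln 0 = 0\<close> would spoil them at zeros of
  \<open>F0\<close>.\<close>

definition approximates :: "complex set \<Rightarrow> complex set \<Rightarrow> complex set \<Rightarrow> (complex \<times> complex) set \<Rightarrow> (complex \<Rightarrow> complex) \<Rightarrow>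
    real \<Rightarrow> real \<Rightarrow> real \<Rightarrow> real \<Rightarrow> nat \<Rightarrow> complex set \<Rightarrow> (complex \<times> complex \<Rightarrow> complex) \<Rightarrow> bool" where
  "approximates A L C F f N1 N2 M k q V F0 \<longleftrightarrow> q \<ge> 1 \<and> open V \<and> L \<subseteq> V \<and> hol_lines (V \<times> UNIV) F0 \<and>
       (\<forall>z\<in>L. \<forall>w. norm (F0 (z, w)) \<le> exp (q * N1) * max 1 (norm w)) \<and>
       (\<forall>x\<in>F. exp (- (q * N2)) \<le> norm (F0 x)) \<and>
       (\<forall>z\<in>C. norm (F0 (z, f z)) \<le> exp (- (q * M))) \<and>
       (\<forall>z\<in>A \<inter> L. \<forall>w. norm w \<le> k \<longrightarrow> norm (F0 (z, w)) \<le> exp (- (q * M)))"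

text \<open>\<open>N1\<close> stems from the diameter of \<open>L2\<close> and \<open>N2\<close>
  from the distance between \<open>K\<close> and the first coordinates of \<open>F\<close>; both
  precede the polynomial \<open>p\<close>, which depends on \<open>M\<close>. The set
  \<open>T\<close> lies in \<open>W\<close>, where \<open>p^m * f\<close> is of order
  \<open>e^q\<close>, so the splitting error is \<open>e^q\<close> times a constant free of
  \<open>m\<close>.\<close>

lemma approximant:
  assumes D: "open D" "open (D - A)" "A \<subseteq> D" and cheb: "\<And>K. compact K \<Longrightarrow> K \<subseteq> A \<Longrightarrow> cheb_zero K"
    and f: "f holomorphic_on (D - A)" and L: "compact L1" "L1 \<subseteq> interior L2" "compact L2" "L2 \<subseteq> D"
    and C1: "compact C1" "C1 \<subseteq> L1 - A" and F: "compact F" "fst ` F \<subseteq> L1 - A" "\<And>z w. (z, w) \<in> F \<Longrightarrow> w \<noteq> f z"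
  shows "\<exists>N1\<ge>1. \<exists>N2\<ge>1. \<forall>M k. \<exists>q V F0. approximates A L1 C1 F f N1 N2 M k q V F0"
proof -
  define K where "K = A \<inter> L2"
  have K: "compact K" "K \<subseteq> A" "K \<subseteq> L2" unfolding K_def using compact_Int_relatively_closed[OF D(2) L(3,4)] by auto
  have chK: "cheb_zero K" using cheb[OF K(1,2)] .
  have L12: "L1 \<subseteq> L2" using L(2) interior_subset by blast
  obtain R where R: "R \<ge> 1" "\<And>x y. x \<in> L2 \<Longrightarrow> y \<in> L2 \<Longrightarrow> norm (x - y) \<le> R"
    using bounded_norm_diff[OF compact_imp_bounded[OF L(3)]] by metis
  have cf: "continuous_on S f" if "S \<subseteq> D - A" for S
    using holomorphic_on_imp_continuous_on[OF f] continuous_on_subset that by blast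
  have F1D: "fst ` F \<subseteq> D - A" using F(2) L12 L(4) by blast
  have "compact (fst ` F)" using F(1) by (intro compact_continuous_image continuous_intros)
  moreover have "fst ` F \<inter> K = {}" using F1D unfolding K_def by blast
  ultimately obtain d where d: "d > 0" "\<And>x y. x \<in> fst ` F \<Longrightarrow> y \<in> K \<Longrightarrow> d \<le> dist x y"
    using separate_compact_closed[OF _ compact_imp_closed[OF K(1)]] by metis
  define \<delta> where "\<delta> = min d 1"
  have \<delta>: "\<delta> > 0" "\<delta> \<le> 1" "\<And>x y. x \<in> fst ` F \<Longrightarrow> y \<in> K \<Longrightarrow> \<delta> \<le> norm (x - y)"
    using d unfolding \<delta>_def by (auto simp: dist_norm min_le_iff_disj)
  obtain \<tau> where \<tau>: "\<tau> > 0" "\<And>z w. (z, w) \<in> F \<Longrightarrow> \<tau> \<le> norm (w - f z)"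
    using graph_gap[OF F(1) cf[OF F1D] F(3)] by metis
  have N1: "ln R + 1 \<ge> 1" using R by simp
  have N2: "- ln \<delta> + 1 \<ge> 1" using \<delta> by simp
  have "\<exists>q V F0. approximates A L1 C1 F f (ln R + 1) (- ln \<delta> + 1) M k q V F0" for M k
  proof -
    \<comment> \<open>The extra \<open>exp (-1)\<close> leaves a factor \<open>exp 1 ^ q\<close> for
      absorbing constants. The bound \<open>\<delta> / 2\<close> keeps the first coordinates of
      \<open>F\<close> outside \<open>W\<close> and the splitting error there below the main
      term.\<close>
    define e where "e = min (exp (- M - 1)) (\<delta> / 2)"
    have e: "e > 0" "e \<le> exp (- M - 1)" "e \<le> \<delta> / 2" "e < 1" using \<delta> unfolding e_def by (auto simp: min_less_iff_disj)
    \<comment> \<open>Asking for \<open>e / 2\<close> on \<open>K\<close> puts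
      \<open>A \<inter> L1\<close> inside the open set where
      \<open>norm (p z) < e ^ n\<close>.\<close>
    obtain n xs where xs: "n \<ge> 1" "length xs \<le> n" "set xs \<subseteq> K" "\<And>z. z \<in> K \<Longrightarrow> norm (lprod xs z) \<le> (e / 2) ^ n"
      using chK e(1) unfolding cheb_zero_def by (metis half_gt_zero)
    define p where "p = lprod xs"
    have contp: "continuous_on S p" for S unfolding p_def by (intro holomorphic_on_imp_continuous_on lprod_holomorphic)
    define W where "W = interior L2 \<inter> {z. norm (p z) < e ^ n}"
    have W: "open W" "W \<subseteq> D" "W \<subseteq> L2"
      unfolding W_def using L(4) interior_subset[of L2]
      by (auto intro!: open_Int open_Collect_less continuous_intros contp)
    have AW: "A \<inter> L1 \<subseteq> W"
    proof
      fix z assume z: "z \<in> A \<inter> L1"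
      then have "z \<in> K" unfolding K_def using L12 by auto
      then have "norm (p z) \<le> (e / 2) ^ n" unfolding p_def by (rule xs(4))
      also have "\<dots> < e ^ n" using e(1) xs(1) by (intro power_strict_mono) auto
      finally show "z \<in> W" unfolding W_def using z L(2) by auto
    qed
    \<comment> \<open>A circle inside \<open>W\<close> stays in \<open>L2\<close>, where
      \<open>A\<close> coincides with \<open>K\<close>, so avoiding \<open>K\<close> is avoiding
      \<open>A\<close>.\<close>
    have "\<exists>r. 0 < r \<and> cball a r \<subseteq> W \<and> sphere a r \<inter> A = {}" if a: "a \<in> A \<inter> L1" for a
    proof -
      have "a \<in> W" using a AW by blast
      then obtain \<rho> where \<rho>: "\<rho> > 0" "cball a \<rho> \<subseteq> W" using W(1) open_contains_cball by blast
      obtain r where r: "0 < r" "r < \<rho>" "sphere a r \<inter> K = {}"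
        using cheb_zero_avoids_circle[OF chK compact_imp_bounded[OF K(1)] \<rho>(1)] by blast
      have cb: "cball a r \<subseteq> W" using r(2) \<rho>(2) subset_cball[of r \<rho> a] by auto
      then have "sphere a r \<subseteq> L2" using W(3) sphere_cball[of a r] by blast
      then have "sphere a r \<inter> A = {}" using r(3) unfolding K_def by blast
      then show ?thesis using r(1) cb by blast
    qed
    then obtain r where r: "\<And>a. a \<in> A \<inter> L1 \<Longrightarrow> 0 < r a \<and> cball a (r a) \<subseteq> W \<and> sphere a (r a) \<inter> A = {}" by metis
    have "compact (A \<inter> L1)" using compact_Int_relatively_closed[OF D(2) L(1)] L12 L(4) by blast
    moreover have "A \<inter> L1 \<subseteq> (\<Union>a\<in>A \<inter> L1. ball a (r a))" using r by force
    ultimately obtain S where S: "S \<subseteq> A \<inter> L1" "finite S" "A \<inter> L1 \<subseteq> (\<Union>a\<in>S. ball a (r a))"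
      using compactE_image[of "A \<inter> L1" "A \<inter> L1" "\<lambda>a. ball a (r a)"] by auto
    define N where "N = (\<Union>a\<in>S. ball a (r a))"
    have N: "open N" "N \<subseteq> W" "A \<inter> L1 \<subseteq> N"
    proof -
      show "open N" unfolding N_def by auto
      show "A \<inter> L1 \<subseteq> N" unfolding N_def by (rule S(3))
      have "ball a (r a) \<subseteq> W" if "a \<in> S" for a
        using r[of a] that S(1) ball_subset_cball[of a "r a"] by blast
      then show "N \<subseteq> W" unfolding N_def by blast
    qed
    have Neq: "N = (\<Union>(x,r)\<in>(\<lambda>a. (a, r a)) ` S. ball x r)" unfolding N_def by simp
    have fin: "finite ((\<lambda>a. (a, r a)) ` S)" using S(2) by simp
    have "\<exists>T C. compact T \<and> T \<subseteq> W - A \<and> 0 \<le> C \<and>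
        (\<forall>h. h holomorphic_on (D - A) \<longrightarrow> (\<exists>H. splits_off D A N T C h H))"
      unfolding Neq by (rule singularity_split[OF D(1,2) W(1,2) fin]) (use r S(1) in auto)
    then obtain T C where TC: "compact T" "T \<subseteq> W - A" "0 \<le> C"
      and split: "\<And>h. h holomorphic_on (D - A) \<Longrightarrow> \<exists>H. splits_off D A N T C h H"
      by blast
    define X where "X = T \<union> C1 \<union> (L1 - N)"
    have X: "compact X" "X \<subseteq> D - A"
    proof -
      show "compact X" unfolding X_def using TC(1) C1(1) L(1) N(1) by (intro compact_Un compact_diff)
      show "X \<subseteq> D - A" unfolding X_def using TC(2) W(2) C1(2) L12 L(4) N(3) by blast
    qed
    obtain Bf where Bf: "Bf \<ge> 0" "\<And>t. t \<in> X \<Longrightarrow> norm (f t) \<le> Bf"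
      using compact_norm_bound[OF X(1) cf[OF X(2)]] by metis
    \<comment> \<open>Everything that \<open>2 ^ q\<close> and \<open>exp 1 ^ q\<close> have to
      beat. \<open>C\<close> and \<open>Bf\<close> depend on \<open>p\<close> and on the circles,
      but not on \<open>m\<close>, which is chosen only now.\<close>
    define Q where "Q = max 1 k + Bf + C * Bf + 2 / \<tau> + 2 * C * Bf / \<tau>"
    obtain m where m: "Q < 2 ^ m" using real_arch_pow[of 2 Q] by auto
    have CBf: "0 \<le> C * Bf" using TC(3) Bf(1) by simp
    have Qs: "max 1 k + Bf + C * Bf \<le> Q" "2 / \<tau> \<le> Q" "2 * C * Bf / \<tau> \<le> Q" "1 \<le> Q"
    proof -
      have "2 / \<tau> \<ge> 0" "2 * C * Bf / \<tau> \<ge> 0" using \<tau>(1) TC(3) Bf(1) by simp_all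
      moreover have "max 1 k \<ge> 1" by simp
      ultimately show "max 1 k + Bf + C * Bf \<le> Q" "2 / \<tau> \<le> Q" "2 * C * Bf / \<tau> \<le> Q" "1 \<le> Q"
        unfolding Q_def using Bf(1) CBf by linarith+
    qed
    have m1: "m \<ge> 1" using m Qs(4) by (cases m) auto
    define q where "q = n * m"
    have q1: "q \<ge> 1" "q \<ge> m" unfolding q_def using m1 xs(1) by simp_all
    have Q2: "Q \<le> 2 ^ q" using m power_increasing[OF q1(2), of "2::real"] by linarith
    have "(2::real) ^ q \<le> exp 1 ^ q" using exp_ge_add_one_self[of 1] by (intro power_mono) auto
    then have Qe: "Q \<le> exp 1 ^ q" using Q2 by simp
    have pL: "norm (p z) ^ m \<le> R ^ q" if "z \<in> L2" for z
    proof -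
      have "norm (p z) \<le> R ^ n" unfolding p_def
        by (rule norm_lprod_le) (use R that xs(2,3) K(3) in auto)
      then show ?thesis unfolding q_def power_mult by (intro power_mono) auto
    qed
    have pW: "norm (p z) ^ m \<le> e ^ q" if "z \<in> W" for z
    proof -
      have "norm (p z) \<le> e ^ n" using that unfolding W_def by simp
      then show ?thesis unfolding q_def power_mult by (intro power_mono) auto
    qed
    have pF: "\<delta> ^ q \<le> norm (p z) ^ m" "z \<notin> W" if "z \<in> fst ` F" for z
    proof -
      have 1: "\<delta> ^ n \<le> norm (p z)" unfolding p_def
        by (rule norm_lprod_ge) (use \<delta> that xs(2,3) in auto)
      then show "\<delta> ^ q \<le> norm (p z) ^ m" unfolding q_def power_mult using \<delta>(1) by (intro power_mono) auto
      have "e ^ n \<le> \<delta> ^ n" using e \<delta>(1) by (intro power_mono) auto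
      then show "z \<notin> W" using 1 unfolding W_def by auto
    qed
    define h where "h z = p z ^ m * f z" for z
    have "h holomorphic_on (D - A)" unfolding h_def p_def by (intro holomorphic_intros f)
    then obtain H where H: "splits_off D A N T C h H" using split by blast
    define B where "B = e ^ q * Bf"
    have B0: "B \<ge> 0" unfolding B_def using e(1) Bf(1) by simp
    have hT: "\<forall>t\<in>T. norm (h t) \<le> B"
    proof
      fix t assume t: "t \<in> T"
      then have "norm (p t) ^ m \<le> e ^ q" using TC(2) by (intro pW) blast
      moreover have "norm (f t) \<le> Bf" using t by (intro Bf(2)) (simp add: X_def)
      ultimately show "norm (h t) \<le> B" unfolding h_def B_def norm_mult norm_power using e(1) by (intro mult_mono) auto
    qed
    note HN = splits_off_bound(1)[OF H B0 hT] and Hd = splits_off_bound(2)[OF H B0 hT]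
    define F0 where "F0 y = p (fst y) ^ m * snd y - H (fst y)" for y
    define O' where "O' = D - (A - N)"
    have "O' = (D - A) \<union> N" unfolding O'_def using N(2) W(2) by blast
    then have opO: "open O'" using D(2) N(1) by (simp add: open_Un)
    have L1O: "L1 \<subseteq> O'" unfolding O'_def using N(3) L12 L(4) by blast
    have holF: "hol_lines (O' \<times> UNIV) F0"
    proof -
      have "H holomorphic_on O'" unfolding O'_def by (rule splits_off_holomorphic[OF H])
      moreover have "(\<lambda>z. p z ^ m) holomorphic_on O'" unfolding p_def by (intro holomorphic_intros)
      ultimately show ?thesis unfolding F0_def using opO
        by (intro hol_lines_diff hol_lines_mult hol_lines_snd hol_lines_fst[of _ O'] hol_lines_fst[of "\<lambda>z. p z ^ m"])
    qed
    have CB: "C * B = e ^ q * (C * Bf)" unfolding B_def by simp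
    have eqs: "e ^ q \<le> R ^ q" "R ^ q \<ge> 0" "e ^ q \<ge> 0" using e R(1) by (auto intro!: power_mono)
    have Rexp: "exp (q * (ln R + 1)) = R ^ q * exp 1 ^ q"
    proof -
      have "exp (ln R + 1) = R * exp 1" using R(1) by (simp add: exp_add)
      then show ?thesis by (simp only: exp_of_nat_mult power_mult_distrib)
    qed
    have Dexp: "exp (- (q * (- ln \<delta> + 1))) = \<delta> ^ q * exp (-1) ^ q"
    proof -
      have "exp (ln \<delta> - 1) = \<delta> * exp (-1)" using \<delta>(1) by (simp add: exp_diff exp_minus field_simps)
      moreover have "- (q * (- ln \<delta> + 1)) = q * (ln \<delta> - 1)" by (simp add: algebra_simps)
      ultimately show ?thesis by (simp only: exp_of_nat_mult power_mult_distrib)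
    qed
    have Mexp: "e ^ q * Q \<le> exp (- (q * M))"
    proof -
      have "e ^ q * Q \<le> exp (- M - 1) ^ q * exp 1 ^ q" using e(1,2) Qe Qs(4) by (intro mult_mono power_mono) auto
      also have "\<dots> = exp (- (q * M))" by (simp add: exp_of_nat_mult[symmetric] exp_add[symmetric] algebra_simps)
      finally show ?thesis .
    qed
    have a: "norm (F0 (z, w)) \<le> exp (q * (ln R + 1)) * max 1 (norm w)" if z: "z \<in> L1" for z w
    proof -
      have HL: "norm (H z) \<le> R ^ q * (Bf + C * Bf)"
      proof (cases "z \<in> N")
        case True
        have "norm (H z) \<le> e ^ q * (C * Bf)" using HN[OF True] CB by simp
        also have "\<dots> \<le> R ^ q * (Bf + C * Bf)" using eqs Bf(1) CBf by (intro mult_mono) auto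
        finally show ?thesis .
      next
        case False
        have zA: "z \<in> D" "z \<notin> A" using z False N(3) L12 L(4) by blast+
        have "norm (H z - h z) \<le> e ^ q * (C * Bf)" using Hd[OF zA False] CB by simp
        also have "\<dots> \<le> R ^ q * (C * Bf)" using eqs CBf by (intro mult_right_mono) auto
        finally have 1: "norm (H z - h z) \<le> R ^ q * (C * Bf)" .
        have "norm (f z) \<le> Bf" using z False by (intro Bf(2)) (simp add: X_def)
        moreover have "norm (p z) ^ m \<le> R ^ q" using z L12 by (intro pL) blast
        ultimately have "norm (h z) \<le> R ^ q * Bf" unfolding h_def norm_mult norm_power using eqs by (intro mult_mono) auto
        moreover have "norm (H z) \<le> norm (H z - h z) + norm (h z)" using norm_triangle_ineq[of "H z - h z" "h z"] by simp
        ultimately show ?thesis using 1 by (simp add: algebra_simps)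
      qed
      have "norm (F0 (z, w)) \<le> norm (p z) ^ m * norm w + norm (H z)"
        unfolding F0_def using norm_triangle_ineq4[of "p z ^ m * w" "H z"] by (simp add: norm_mult norm_power)
      also have "\<dots> \<le> R ^ q * max 1 (norm w) + R ^ q * (Bf + C * Bf)"
        using z L12 eqs by (intro add_mono mult_mono pL HL) auto
      also have "\<dots> \<le> R ^ q * (Q * max 1 (norm w))"
      proof -
        have "Bf + C * Bf \<le> (Q - 1) * max 1 (norm w)"
        proof -
          have "Bf + C * Bf \<le> Q - 1" using Qs(1) by simp
          also have "\<dots> \<le> (Q - 1) * max 1 (norm w)" using Qs(4) mult_left_mono[of 1 "max 1 (norm w)" "Q - 1"] by simp
          finally show ?thesis .
        qed
        then have "max 1 (norm w) + (Bf + C * Bf) \<le> Q * max 1 (norm w)" by (simp add: algebra_simps)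
        then show ?thesis using mult_left_mono[OF _ eqs(2)] by (simp add: distrib_left[symmetric])
      qed
      also have "\<dots> \<le> R ^ q * (exp 1 ^ q * max 1 (norm w))"
        using Qe eqs by (intro mult_left_mono mult_right_mono) auto
      finally show ?thesis unfolding Rexp by (simp add: mult.assoc)
    qed
    have b: "exp (- (q * (- ln \<delta> + 1))) \<le> norm (F0 x)" if x: "x \<in> F" for x
    proof -
      obtain z w where zw: "x = (z, w)" by fastforce
      have zF: "z \<in> fst ` F" using x zw by force
      have zA: "z \<in> D" "z \<notin> A" using zF F1D by blast+
      have zN: "z \<notin> N" using pF(2)[OF zF] N(2) by blast
      have 1: "norm (H z - h z) \<le> e ^ q * (C * Bf)" using Hd[OF zA zN] CB by simp
      have "e ^ q \<le> (\<delta> / 2) ^ q" using e by (intro power_mono) auto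
      then have "e ^ q * (C * Bf) \<le> (\<delta> / 2) ^ q * (C * Bf)" using CBf by (intro mult_right_mono)
      also have "\<dots> \<le> (\<delta> / 2) ^ q * (2 ^ q * (\<tau> / 2))"
      proof (rule mult_left_mono)
        have "2 * C * Bf / \<tau> \<le> 2 ^ q" using Qs(3) Q2 by simp
        then show "C * Bf \<le> 2 ^ q * (\<tau> / 2)" using \<tau>(1) by (simp add: field_simps)
      qed (use \<delta> in simp)
      also have "\<dots> = \<delta> ^ q * (\<tau> / 2)" by (simp add: power_divide)
      finally have 2: "e ^ q * (C * Bf) \<le> \<delta> ^ q * (\<tau> / 2)" .
      have "\<delta> ^ q * \<tau> \<le> norm (p z) ^ m * norm (w - f z)"
        using pF(1)[OF zF] \<tau>(2)[of z w] x zw \<tau>(1) by (intro mult_mono) auto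
      also have "\<dots> = norm (F0 x + (H z - h z))"
        unfolding zw F0_def h_def by (simp add: norm_mult[symmetric] norm_power[symmetric] algebra_simps)
      also have "\<dots> \<le> norm (F0 x) + norm (H z - h z)" by (rule norm_triangle_ineq)
      finally have "\<delta> ^ q * \<tau> \<le> norm (F0 x) + \<delta> ^ q * (\<tau> / 2)" using 1 2 by linarith
      then have 3: "\<delta> ^ q * (\<tau> / 2) \<le> norm (F0 x)" by (simp add: algebra_simps)
      have "2 / \<tau> \<le> exp 1 ^ q" using Qs(2) Qe by simp
      then have "exp (-1) ^ q \<le> \<tau> / 2" using \<tau>(1) by (simp add: exp_minus power_inverse field_simps)
      then have "\<delta> ^ q * exp (-1) ^ q \<le> \<delta> ^ q * (\<tau> / 2)" using \<delta>(1) by (intro mult_left_mono) auto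
      then show ?thesis unfolding Dexp using 3 by simp
    qed
    have c1: "norm (F0 (z, f z)) \<le> exp (- (q * M))" if z: "z \<in> C1" for z
    proof -
      have zA: "z \<in> D" "z \<notin> A" using z C1(2) L12 L(4) by blast+
      have fz: "norm (f z) \<le> Bf" using z by (intro Bf(2)) (simp add: X_def)
      have "norm (F0 (z, f z)) \<le> e ^ q * (Bf + C * Bf)"
      proof (cases "z \<in> N")
        case True
        have "norm (F0 (z, f z)) \<le> norm (p z) ^ m * norm (f z) + norm (H z)"
          unfolding F0_def using norm_triangle_ineq4[of "p z ^ m * f z" "H z"] by (simp add: norm_mult norm_power)
        also have "\<dots> \<le> e ^ q * Bf + e ^ q * (C * Bf)"
        proof (intro add_mono mult_mono pW fz)
          show "norm (H z) \<le> e ^ q * (C * Bf)" using HN[OF True] CB by simp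
        qed (use True N(2) eqs in auto)
        finally show ?thesis by (simp add: algebra_simps)
      next
        case False
        have "norm (F0 (z, f z)) = norm (H z - h z)" unfolding F0_def h_def by (simp add: norm_minus_commute)
        also have "\<dots> \<le> e ^ q * (C * Bf)" using Hd[OF zA False] CB by simp
        also have "\<dots> \<le> e ^ q * (Bf + C * Bf)" using eqs Bf(1) by (intro mult_left_mono) auto
        finally show ?thesis .
      qed
      also have "\<dots> \<le> e ^ q * Q" using Qs(1) eqs by (intro mult_left_mono) auto
      also note Mexp
      finally show ?thesis .
    qed
    have c2: "norm (F0 (z, w)) \<le> exp (- (q * M))" if z: "z \<in> A \<inter> L1" "norm w \<le> k" for z w
    proof -
      have zN: "z \<in> N" using z N(3) by blast
      have "norm (F0 (z, w)) \<le> norm (p z) ^ m * norm w + norm (H z)"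
        unfolding F0_def using norm_triangle_ineq4[of "p z ^ m * w" "H z"] by (simp add: norm_mult norm_power)
      also have "\<dots> \<le> e ^ q * max 1 k + e ^ q * (C * Bf)"
      proof (intro add_mono mult_mono pW)
        show "norm (H z) \<le> e ^ q * (C * Bf)" using HN[OF zN] CB by simp
      qed (use zN N(2) z eqs in auto)
      also have "\<dots> \<le> e ^ q * Q" using Qs(1) Bf(1) eqs by (simp add: distrib_left[symmetric] mult_left_mono)
      also note Mexp
      finally show ?thesis .
    qed
    show ?thesis unfolding approximates_def
      using q1(1) opO L1O holF a b c1 c2 by (intro exI[of _ q] exI[of _ O'] exI[of _ F0]) simp
  qed
  then show ?thesis using N1 N2 by blast
qed

text \<open>For \<open>D = UNIV\<close> the second term is \<open>0\<close>, since \<open>infdist z {} = 0\<close> and \<open>ln 0 = 0\<close>.\<close>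

definition exhaustion :: "complex set \<Rightarrow> complex \<Rightarrow> real" where
  "exhaustion D z = max (norm z) (- ln (infdist z (- D)))"

section \<open>Exhaustion of the domain and the global approximating function\<close>

lemma infdist_complement_pos:
  assumes "open D" "D \<noteq> UNIV" "z \<in> D"
  shows "infdist z (- D) > 0"
proof -
  have "closed (- D)" "- D \<noteq> {}" using assms by auto
  then show ?thesis using in_closed_iff_infdist_zero[of "- D" z] assms(3) infdist_nonneg[of z "- D"] by force
qed

lemma continuous_on_exhaustion:
  assumes "open D"
  shows "continuous_on D (exhaustion D)"
proof (cases "D = UNIV")
  case True
  then have "exhaustion D = (\<lambda>z. max (norm z) 0)" by (auto simp: exhaustion_def fun_eq_iff infdist_def)
  then show ?thesis by (auto intro!: continuous_intros)
next
  case False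
  then have "infdist z (- D) \<noteq> 0" if "z \<in> D" for z using infdist_complement_pos[OF assms False that] by simp
  then show ?thesis unfolding exhaustion_def[abs_def] by (intro continuous_intros) auto
qed

lemma compact_exhaustion_sublevel:
  assumes "open D"
  shows "compact {z \<in> D. exhaustion D z \<le> c}"
proof (cases "D = UNIV")
  case True
  then have "{z \<in> D. exhaustion D z \<le> c} = cball 0 c \<inter> {z. max (norm z) 0 \<le> c}"
    by (auto simp: exhaustion_def infdist_def)
  moreover have "closed {z::complex. max (norm z) 0 \<le> c}" by (intro closed_Collect_le continuous_intros)
  ultimately show ?thesis by (simp add: compact_Int_closed)
next
  case False
  have "{z \<in> D. exhaustion D z \<le> c} = cball 0 c \<inter> {z. exp (- c) \<le> infdist z (- D)}"
  proof (intro set_eqI iffI)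
    fix z assume z: "z \<in> {z \<in> D. exhaustion D z \<le> c}"
    then have "infdist z (- D) > 0" using infdist_complement_pos[OF assms False] by simp
    moreover have "- ln (infdist z (- D)) \<le> c" using z unfolding exhaustion_def by simp
    ultimately have "exp (- c) \<le> infdist z (- D)" by (metis exp_le_cancel_iff exp_ln minus_le_iff)
    then show "z \<in> cball 0 c \<inter> {z. exp (- c) \<le> infdist z (- D)}" using z unfolding exhaustion_def by simp
  next
    fix z assume z: "z \<in> cball 0 c \<inter> {z. exp (- c) \<le> infdist z (- D)}"
    then have e: "exp (- c) \<le> infdist z (- D)" by simp
    have "z \<in> D"
    proof (rule ccontr)
      assume "z \<notin> D"
      then have "infdist z (- D) = 0" by simp
      then show False using e exp_gt_zero[of "- c"] by linarith
    qed
    moreover have "- c \<le> ln (infdist z (- D))"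
      using e by (subst ln_ge_iff) (auto intro: less_le_trans[OF exp_gt_zero])
    ultimately show "z \<in> {z \<in> D. exhaustion D z \<le> c}" using z unfolding exhaustion_def by simp
  qed
  moreover have "closed {z. exp (- c) \<le> infdist z (- D)}" by (intro closed_Collect_le continuous_intros)
  ultimately show ?thesis by (simp add: compact_Int_closed)
qed

lemma open_exhaustion:
  assumes "open D"
  shows "open {z \<in> D. exhaustion D z < c}" "open {z \<in> D. c < exhaustion D z}"
proof -
  have "{z \<in> D. exhaustion D z < c} = D \<inter> exhaustion D -` {..<c}"
    "{z \<in> D. c < exhaustion D z} = D \<inter> exhaustion D -` {c<..}" by auto
  then show "open {z \<in> D. exhaustion D z < c}" "open {z \<in> D. c < exhaustion D z}"
    using continuous_open_preimage[OF continuous_on_exhaustion[OF assms] assms] by simp_all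
qed

text \<open>Both terms have harmonic minorants touching at the point: \<open>Re (s * z)\<close>,
  with \<open>s\<close> rotating the point onto the positive axis, and
  \<open>- ln (norm (z - b))\<close>, with \<open>b\<close> a nearest point of the
  complement.\<close>

lemma cpsh_on_exhaustion:
  assumes D: "open D"
  shows "cpsh_on (D \<times> UNIV) (\<lambda>y. exhaustion D (fst y))"
  unfolding cpsh_on_def
proof (intro conjI ballI)
  show cont: "continuous_on (D \<times> UNIV) (\<lambda>y. exhaustion D (fst y))"
    by (rule continuous_on_compose2[OF continuous_on_exhaustion[OF D]]) (auto intro!: continuous_intros)
  have op: "open (D \<times> (UNIV :: complex set))" using D by (simp add: open_Times)
  fix x :: "complex \<times> complex" assume x: "x \<in> D \<times> UNIV"
  define z where "z = fst x"
  have z: "z \<in> D" using x unfolding z_def by auto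
  show "submean_at (\<lambda>y. exhaustion D (fst y)) x"
  proof (cases "norm z \<ge> - ln (infdist z (- D))")
    case True
    define s where "s = cnj (sgn z)"
    have "norm s \<le> 1" unfolding s_def by (simp add: norm_sgn)
    have "s * z = of_real (norm z)"
    proof (cases "z = 0")
      case False
      have "cnj z * z = of_real ((norm z)\<^sup>2)" using complex_norm_square[of z] by (simp add: mult.commute)
      then show ?thesis using False unfolding s_def sgn_eq by (simp add: power2_eq_square)
    qed simp
    have "hol_lines UNIV (\<lambda>y. s * fst y)"
      unfolding hol_lines_def by (auto intro!: continuous_intros holomorphic_intros)
    then have "submean_at (\<lambda>y. Re (s * fst y)) x" by (rule submean_at_Re) auto
    then show ?thesis
    proof (rule submean_atI_support[OF _ op x cont])
      show "exhaustion D (fst x) \<le> Re (s * fst x)"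
        using True \<open>s * z = of_real (norm z)\<close> unfolding exhaustion_def z_def[symmetric] by simp
      fix y
      have "Re (s * fst y) \<le> norm (s * fst y)" by (rule complex_Re_le_cmod)
      also have "\<dots> \<le> norm (fst y)" using \<open>norm s \<le> 1\<close> by (simp add: norm_mult mult_left_le_one_le)
      finally show "Re (s * fst y) \<le> exhaustion D (fst y)" unfolding exhaustion_def by simp
    qed
  next
    case False
    have ne: "- D \<noteq> {}"
    proof
      assume "- D = {}"
      then have "infdist z (- D) = 0" by (simp add: infdist_def)
      then show False using False by simp
    qed
    then have DU: "D \<noteq> UNIV" by auto
    have "closed (- D)" using D by auto
    then obtain b where b: "b \<in> - D" "infdist z (- D) = dist z b" using infdist_attains_inf[OF _ ne] by metis
    have nz: "fst y - b \<noteq> 0" if "y \<in> D \<times> UNIV" for y :: "complex \<times> complex" using that b(1) by auto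
    have "hol_lines UNIV (\<lambda>y. fst y - b)"
      unfolding hol_lines_def by (auto intro!: continuous_intros holomorphic_intros)
    then have "submean_at (\<lambda>y. - ln (norm (fst y - b))) x" by (rule submean_at_ln_norm(2)) (use nz[OF x] in auto)
    then show ?thesis
    proof (rule submean_atI_support[OF _ op x cont])
      show "exhaustion D (fst x) \<le> - ln (norm (fst x - b))"
        using False b(2) unfolding exhaustion_def z_def[symmetric] by (simp add: dist_norm)
      fix y :: "complex \<times> complex" assume y: "y \<in> D \<times> UNIV"
      then have yD: "fst y \<in> D" by auto
      have "infdist (fst y) (- D) \<le> dist (fst y) b" using b(1) by (rule infdist_le)
      then have "ln (infdist (fst y) (- D)) \<le> ln (dist (fst y) b)"
        using infdist_complement_pos[OF D DU yD] by (intro ln_mono) auto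
      then show "- ln (norm (fst y - b)) \<le> exhaustion D (fst y)" unfolding exhaustion_def by (simp add: dist_norm)
    qed
  qed
qed

lemma cpsh_on_ln_max_snd:
  assumes "c > 0"
  shows "cpsh_on UNIV (\<lambda>y. ln (max c (norm (snd y))))"
  unfolding cpsh_on_def
proof (intro conjI ballI)
  have pos: "max c (norm (snd y)) > 0" for y :: "complex \<times> complex" using assms by (simp add: less_max_iff_disj)
  show cont: "continuous_on UNIV (\<lambda>y::complex \<times> complex. ln (max c (norm (snd y))))"
    using pos by (intro continuous_intros) (metis less_irrefl)
  fix x :: "complex \<times> complex"
  show "submean_at (\<lambda>y. ln (max c (norm (snd y)))) x"
  proof (cases "norm (snd x) > c")
    case True
    then have nz: "snd x \<noteq> 0" using assms by auto
    let ?S = "{y :: complex \<times> complex. 0 < norm (snd y)}"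
    have "submean_at (\<lambda>y. ln (norm (snd y))) x" by (rule submean_at_ln_norm(1)[OF hol_lines_snd[of UNIV]]) (use nz in auto)
    then show ?thesis
    proof (rule submean_atI_support[where S = ?S])
      show "open ?S" by (intro open_Collect_less continuous_intros)
      show "continuous_on ?S (\<lambda>y. ln (max c (norm (snd y))))" by (rule continuous_on_subset[OF cont]) simp
    qed (use True nz in \<open>auto intro!: ln_mono\<close>)
  next
    case False
    show ?thesis
      by (rule submean_atI_support[OF submean_at_const[of "ln c"] open_UNIV UNIV_I cont])
         (use False assms in \<open>auto intro!: ln_mono simp: max_def\<close>)
  qed
qed

lemma cpsh_on_subset: "cpsh_on \<Omega> u \<Longrightarrow> \<Omega>' \<subseteq> \<Omega> \<Longrightarrow> cpsh_on \<Omega>' u"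
  unfolding cpsh_on_def by (meson continuous_on_subset subsetD)

text \<open>The logarithm of \<open>F0\<close>, defined only over part of \<open>D\<close>, is cut
  off from below by a steep multiple of the exhaustion function, which takes over before the edge of
  its domain and lies very low over \<open>P\<close>. The final affine change sends
  \<open>N3\<close> to \<open>0\<close> and \<open>- M\<close> to \<open>-1\<close>; the lower bound
  becomes \<open>- (N2 + N3) / (M + N3)\<close>, which the choice of \<open>M\<close> makes at least
  \<open>- \<eta>\<close>.\<close>

lemma base_function:
  assumes D: "open D" "open (D - A)" "A \<subseteq> D" and cheb: "\<And>K. compact K \<Longrightarrow> K \<subseteq> A \<Longrightarrow> cheb_zero K"
    and f: "f holomorphic_on (D - A)" and L: "compact L" "L \<subseteq> D"
    and C1: "compact C1" "C1 \<subseteq> D - A" and F: "compact F" "fst ` F \<subseteq> D - A" "\<And>z w. (z, w) \<in> F \<Longrightarrow> w \<noteq> f z"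
    and \<eta>: "\<eta> > 0"
  shows "\<exists>u. cpsh_on (D \<times> UNIV) u \<and> (\<forall>z\<in>L. \<forall>w. norm w \<le> k \<longrightarrow> u (z, w) \<le> 0) \<and>
     (\<forall>z\<in>C1. u (z, f z) \<le> -1) \<and> (\<forall>z\<in>A \<inter> L. \<forall>w. norm w \<le> k \<longrightarrow> u (z, w) \<le> -1) \<and> (\<forall>x\<in>F. - \<eta> \<le> u x)"
proof -
  let ?e = "exhaustion D"
  define P where "P = L \<union> C1 \<union> fst ` F"
  have "compact (fst ` F)" using F(1) by (intro compact_continuous_image continuous_intros)
  then have P: "compact P" "P \<subseteq> D" unfolding P_def using L C1 F(2) by auto
  obtain c0 where c0: "c0 \<ge> 0" "\<And>z. z \<in> P \<Longrightarrow> norm (?e z) \<le> c0"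
    using compact_norm_bound[OF P(1) continuous_on_subset[OF continuous_on_exhaustion[OF D(1)] P(2)]] by metis
  define c where "c = c0 + 1"
  have Pc: "?e z \<le> c - 1" if "z \<in> P" for z using c0(2)[OF that] unfolding c_def by simp
  define L1 where "L1 = {z \<in> D. ?e z \<le> c + 1}"
  define L2 where "L2 = {z \<in> D. ?e z \<le> c + 2}"
  have L12: "compact L1" "compact L2" "L2 \<subseteq> D" unfolding L1_def L2_def using compact_exhaustion_sublevel[OF D(1)] by auto
  have "L1 \<subseteq> {z \<in> D. ?e z < c + 2}" unfolding L1_def by auto
  also have "\<dots> \<subseteq> interior L2" by (rule interior_maximal[OF _ open_exhaustion(1)[OF D(1)]]) (auto simp: L2_def)
  finally have L1i: "L1 \<subseteq> interior L2" .
  have PL1: "P \<subseteq> L1" using Pc P(2) unfolding L1_def by force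
  have C1': "C1 \<subseteq> L1 - A" and F': "fst ` F \<subseteq> L1 - A" using C1(2) F(2) PL1 unfolding P_def by blast+
  have "\<exists>N1\<ge>1. \<exists>N2\<ge>1. \<forall>M k. \<exists>q V F0. approximates A L1 C1 F f N1 N2 M k q V F0"
    by (rule approximant[OF D cheb f L12(1) L1i L12(2,3) C1(1) C1' F(1) F' F(3)])
  then obtain N1 N2 where N: "N1 \<ge> 1" "N2 \<ge> 1" and app: "\<And>M k. \<exists>q V F0. approximates A L1 C1 F f N1 N2 M k q V F0"
    by blast
  define N3 where "N3 = N1 + ln (max 1 k)"
  have N3: "N3 \<ge> 1" unfolding N3_def using N(1) by (simp add: add_increasing2)
  define M where "M = (N2 + N3) / \<eta>"
  have M: "M > 0" unfolding M_def using N N3 \<eta> by simp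
  obtain q V F0 where ap: "approximates A L1 C1 F f N1 N2 M k q V F0" using app by blast
  have q: "q \<ge> 1" and V: "open V" "L1 \<subseteq> V" and holF: "hol_lines (V \<times> UNIV) F0"
    using ap unfolding approximates_def by blast+
  have a: "norm (F0 (z, w)) \<le> exp (q * N1) * max 1 (norm w)" if "z \<in> L1" for z w
    using ap that unfolding approximates_def by (elim conjE) simp
  have b: "exp (- (q * N2)) \<le> norm (F0 x)" if "x \<in> F" for x
    using ap that unfolding approximates_def by blast
  have c1: "norm (F0 (z, f z)) \<le> exp (- (q * M))" if "z \<in> C1" for z
    using ap that unfolding approximates_def by (elim conjE) simp
  have c2: "norm (F0 (z, w)) \<le> exp (- (q * M))" if "z \<in> A \<inter> L1" "norm w \<le> k" for z w
    using ap that unfolding approximates_def by (elim conjE) simp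
  have cfC: "continuous_on C1 f" using holomorphic_on_imp_continuous_on[OF f] C1(2) by (rule continuous_on_subset)
  obtain Bf where Bf: "Bf \<ge> 0" "\<And>t. t \<in> C1 \<Longrightarrow> norm (f t) \<le> Bf"
    using compact_norm_bound[OF C1(1) cfC] by metis
  define lp where "lp w = ln (max 1 (norm w))" for w :: complex
  have lp0: "lp w \<ge> 0" for w unfolding lp_def by simp
  have lpm: "lp w \<le> ln (max 1 t)" if "norm w \<le> t" for w t unfolding lp_def using that by (intro ln_mono) auto
  \<comment> \<open>\<open>2 * N1\<close> lets \<open>\<Phi>\<close> dominate from level
    \<open>c + 1/2\<close> on; the other summands push \<open>\<Phi>\<close> below
    \<open>- M\<close> over \<open>P\<close> for \<open>norm w \<le> k\<close> and on the graph over
    \<open>C1\<close>.\<close>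
  define Bc where "Bc = 2 * N1 + M + ln (max 1 k) + ln (max 1 Bf)"
  have ln0: "ln (max 1 k) \<ge> 0" "ln (max 1 Bf) \<ge> 0" by simp_all
  have Bc0: "Bc \<ge> 0" unfolding Bc_def using N M ln0 by linarith
  define \<Phi> where "\<Phi> y = Bc * (?e (fst y) - c) + lp (snd y)" for y :: "complex \<times> complex"
  \<comment> \<open>Taking the maximum inside the logarithm keeps its argument positive at zeros of
    \<open>F0\<close>.\<close>
  define U where "U y = (if ?e (fst y) < c + 1 then ln (max (norm (F0 y)) (exp (q * \<Phi> y))) / q else \<Phi> y)" for y
  have \<Phi>c: "cpsh_on (D \<times> UNIV) \<Phi>"
  proof -
    have 1: "cpsh_on (D \<times> UNIV) (\<lambda>y. Bc * (?e (fst y) + (- c)))"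
      by (intro cpsh_on_cmult cpsh_on_add cpsh_on_exhaustion cpsh_on_const D(1) Bc0)
    have 2: "cpsh_on (D \<times> UNIV) (\<lambda>y. lp (snd y))"
      unfolding lp_def by (rule cpsh_on_subset[OF cpsh_on_ln_max_snd]) auto
    show ?thesis using cpsh_on_add[OF 1 2] unfolding \<Phi>_def[abs_def] by simp
  qed
  have q0: "real q > 0" using q by simp
  have Uge: "\<Phi> y \<le> U y" for y
  proof (cases "?e (fst y) < c + 1")
    case True
    have "ln (exp (q * \<Phi> y)) \<le> ln (max (norm (F0 y)) (exp (q * \<Phi> y)))" by (intro ln_mono) auto
    then show ?thesis using True q0 unfolding U_def by (simp add: field_simps)
  qed (simp add: U_def)
  have Ule: "U y \<le> t" if "fst y \<in> P" "norm (F0 y) \<le> exp (q * t)" "\<Phi> y \<le> t" for y and t :: real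
  proof -
    have lt: "?e (fst y) < c + 1" using Pc[OF that(1)] by simp
    have "max (norm (F0 y)) (exp (q * \<Phi> y)) \<le> exp (q * t)" using that q0 by simp
    then have "ln (max (norm (F0 y)) (exp (q * \<Phi> y))) \<le> ln (exp (q * t))" by (intro ln_mono) (auto simp: less_max_iff_disj)
    then show ?thesis using lt q0 unfolding U_def by (simp add: field_simps)
  qed
  have UeqV: "U y = ln (norm (F0 y)) / q" if "?e (fst y) < c + 1" "norm (F0 y) \<ge> exp (q * \<Phi> y)" for y
    using that unfolding U_def by (simp add: max_def)
  have lpexp: "exp (q * N1) * max 1 (norm w) \<le> exp (q * (N1 + lp w))" for w
  proof -
    have "max 1 (norm w) ^ 1 \<le> max 1 (norm w) ^ q" using q by (intro power_increasing) auto
    moreover have "exp (q * lp w) = max 1 (norm w) ^ q" unfolding lp_def by (simp add: exp_of_nat_mult)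
    ultimately show ?thesis by (simp add: distrib_left exp_add)
  qed
  have Ueq\<Phi>: "U y = \<Phi> y" if "fst y \<in> D" "c + 1/2 < ?e (fst y)" for y
  proof (cases "?e (fst y) < c + 1")
    case True
    then have yL: "fst y \<in> L1" using that unfolding L1_def by simp
    have "norm (F0 y) \<le> exp (q * N1) * max 1 (norm (snd y))" using a[OF yL, of "snd y"] by simp
    also have "\<dots> \<le> exp (q * (N1 + lp (snd y)))" by (rule lpexp)
    also have "\<dots> \<le> exp (q * \<Phi> y)"
    proof -
      have "N1 \<le> Bc * (1/2)" unfolding Bc_def using N M ln0 by simp
      also have "\<dots> \<le> Bc * (?e (fst y) - c)" using that Bc0 by (intro mult_left_mono) auto
      finally show ?thesis unfolding \<Phi>_def using q0 by simp
    qed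
    finally have "max (norm (F0 y)) (exp (q * \<Phi> y)) = exp (q * \<Phi> y)" by (rule max_absorb2)
    then show ?thesis using True q0 unfolding U_def by simp
  qed (simp add: U_def)
  define O1 where "O1 = {z \<in> D. ?e z < c + 1} \<times> (UNIV :: complex set)"
  define O2 where "O2 = {z \<in> D. c + 1/2 < ?e z} \<times> (UNIV :: complex set)"
  have op: "open O1" "open O2" unfolding O1_def O2_def using open_exhaustion[OF D(1)] by (simp_all add: open_Times)
  have Oun: "D \<times> UNIV = O1 \<union> O2" unfolding O1_def O2_def by auto
  have O1V: "O1 \<subseteq> V \<times> UNIV" unfolding O1_def using V(2) unfolding L1_def by auto
  have OD: "O1 \<subseteq> D \<times> UNIV" "O2 \<subseteq> D \<times> UNIV" unfolding Oun by auto
  have contF: "continuous_on O1 F0" using holF O1V unfolding hol_lines_def by (blast intro: continuous_on_subset)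
  have cont\<Phi>: "continuous_on S \<Phi>" if "S \<subseteq> D \<times> UNIV" for S
    using \<Phi>c that unfolding cpsh_on_def by (blast intro: continuous_on_subset)
  have cU1: "continuous_on O1 U"
  proof -
    have "continuous_on O1 (\<lambda>y. ln (max (norm (F0 y)) (exp (q * \<Phi> y))) / q)"
    proof (intro continuous_on_divide continuous_on_ln continuous_on_max continuous_on_norm continuous_on_exp
        continuous_on_mult continuous_on_const contF cont\<Phi> OD(1) ballI)
      fix y
      have "max (norm (F0 y)) (exp (q * \<Phi> y)) > 0" by (simp add: less_max_iff_disj)
      then show "max (norm (F0 y)) (exp (q * \<Phi> y)) \<noteq> 0" by linarith
      show "real q \<noteq> 0" using q0 by simp
    qed
    then show ?thesis by (rule iffD1[OF continuous_on_cong[OF refl], rotated]) (auto simp: U_def O1_def)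
  qed
  have cU2: "continuous_on O2 U"
    using cont\<Phi>[OF OD(2)] by (rule iffD1[OF continuous_on_cong[OF refl], rotated]) (use Ueq\<Phi> in \<open>auto simp: O2_def\<close>)
  have contU: "continuous_on (D \<times> UNIV) U" unfolding Oun by (rule continuous_on_open_Un[OF op cU1 cU2])
  have opD: "open (D \<times> (UNIV :: complex set))" using D(1) by (simp add: open_Times)
  have cpshU: "cpsh_on (D \<times> UNIV) U"
    unfolding cpsh_on_def
  proof (intro conjI ballI contU)
    fix x assume x: "x \<in> D \<times> (UNIV :: complex set)"
    show "submean_at U x"
    proof (cases "U x \<le> \<Phi> x")
      case True
      have "submean_at \<Phi> x" using \<Phi>c x unfolding cpsh_on_def by blast
      then show ?thesis by (rule submean_atI_support[OF _ opD x contU]) (use True Uge in auto)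
    next
      case False
      have e: "?e (fst x) < c + 1"
      proof (rule ccontr)
        assume "\<not> ?thesis"
        then have "U x = \<Phi> x" by (simp add: U_def)
        then show False using False by simp
      qed
      then have xO: "x \<in> O1" using x unfolding O1_def by auto
      have gt: "norm (F0 x) > exp (q * \<Phi> x)"
      proof (rule ccontr)
        assume "\<not> ?thesis"
        then have "max (norm (F0 x)) (exp (q * \<Phi> x)) = exp (q * \<Phi> x)" by simp
        then have "U x = \<Phi> x" using e q0 unfolding U_def by simp
        then show False using False by simp
      qed
      then have nz: "F0 x \<noteq> 0" using exp_gt_zero[of "q * \<Phi> x"] by auto
      have hl: "hol_lines O1 F0" by (rule hol_lines_subset[OF holF O1V])
      define S where "S = O1 \<inter> F0 -` (- {0})"
      have S: "open S" unfolding S_def using contF op(1) by (intro continuous_open_preimage) auto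
      have "submean_at (\<lambda>y. (1 / q) * ln (norm (F0 y))) x"
        by (intro submean_at_cmult submean_at_ln_norm(1)[OF hl op(1) xO nz]) simp
      then show ?thesis
      proof (rule submean_atI_support[OF _ S])
        show "x \<in> S" unfolding S_def using xO nz by simp
        show "continuous_on S U" using cU1 by (rule continuous_on_subset) (simp add: S_def)
        show "U x \<le> (1 / q) * ln (norm (F0 x))" using UeqV[OF e] gt by simp
        fix y assume y: "y \<in> S"
        then have "?e (fst y) < c + 1" "norm (F0 y) > 0" unfolding S_def O1_def by auto
        moreover have "ln (norm (F0 y)) \<le> ln (max (norm (F0 y)) (exp (q * \<Phi> y)))"
          using \<open>norm (F0 y) > 0\<close> by (intro ln_mono) auto
        ultimately show "(1 / q) * ln (norm (F0 y)) \<le> U y" using q0 unfolding U_def by (simp add: divide_right_mono)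
      qed
    qed
  qed
  have MN: "M + N3 > 0" using M N3 by simp
  define u where "u y = (1 / (M + N3)) * (U y + (- N3))" for y
  have \<Phi>P: "\<Phi> y \<le> - Bc + lp (snd y)" if "fst y \<in> P" for y
  proof -
    have "Bc * (?e (fst y) - c) \<le> Bc * (-1)" using Pc[OF that] Bc0 by (intro mult_left_mono) auto
    then show ?thesis unfolding \<Phi>_def by simp
  qed
  have small: "u y \<le> -1" if "U y \<le> - M" for y
  proof -
    have "u y \<le> (1 / (M + N3)) * (- M + (- N3))" unfolding u_def using that MN by (intro mult_left_mono) auto
    also have "\<dots> = -1" using MN by (simp add: field_simps)
    finally show ?thesis .
  qed
  show ?thesis
  proof (intro exI[of _ u] conjI ballI allI impI)
    show "cpsh_on (D \<times> UNIV) u" unfolding u_def[abs_def]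
      using MN by (intro cpsh_on_cmult cpsh_on_add cpshU cpsh_on_const) simp
  next
    fix z w :: complex assume z: "z \<in> L" and w: "norm w \<le> k"
    have zP: "z \<in> P" using z unfolding P_def by simp
    have "U (z, w) \<le> N3"
    proof (rule Ule[of "(z, w)" N3])
      show "fst (z, w) \<in> P" using zP by simp
      have "norm (F0 (z, w)) \<le> exp (q * N1) * max 1 (norm w)" using zP PL1 by (intro a) blast
      also have "\<dots> \<le> exp (q * (N1 + lp w))" by (rule lpexp)
      also have "\<dots> \<le> exp (q * N3)" unfolding N3_def using lpm[OF w] q0 by simp
      finally show "norm (F0 (z, w)) \<le> exp (q * N3)" .
      show "\<Phi> (z, w) \<le> N3" using \<Phi>P[of "(z, w)"] zP lpm[OF w] Bc0 N(1) unfolding N3_def by simp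
    qed
    then show "u (z, w) \<le> 0" unfolding u_def using MN by (simp add: mult_nonneg_nonpos divide_nonpos_pos)
  next
    fix z assume z: "z \<in> C1"
    have zP: "z \<in> P" using z unfolding P_def by simp
    show "u (z, f z) \<le> -1"
    proof (intro small Ule)
      show "fst (z, f z) \<in> P" using zP by simp
      show "norm (F0 (z, f z)) \<le> exp (q * (- M))" using c1[OF z] by simp
      have "\<Phi> (z, f z) \<le> - Bc + lp (f z)" using \<Phi>P[of "(z, f z)"] zP by simp
      then show "\<Phi> (z, f z) \<le> - M" using lpm[OF Bf(2)[OF z]] N(1) ln0 unfolding Bc_def by linarith
    qed
  next
    fix z w :: complex assume z: "z \<in> A \<inter> L" and w: "norm w \<le> k"
    have zP: "z \<in> P" using z unfolding P_def by simp
    show "u (z, w) \<le> -1"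
    proof (intro small Ule)
      show "fst (z, w) \<in> P" using zP by simp
      have "z \<in> A \<inter> L1" using z zP PL1 by blast
      then show "norm (F0 (z, w)) \<le> exp (q * (- M))" using c2[OF _ w] by simp
      have "\<Phi> (z, w) \<le> - Bc + lp w" using \<Phi>P[of "(z, w)"] zP by simp
      then show "\<Phi> (z, w) \<le> - M" using lpm[OF w] N(1) ln0 unfolding Bc_def by linarith
    qed
  next
    fix x assume x: "x \<in> F"
    have e: "?e (fst x) < c + 1" using Pc[of "fst x"] x unfolding P_def by force
    have "ln (exp (- (q * N2))) \<le> ln (max (norm (F0 x)) (exp (q * \<Phi> x)))" using b[OF x] by (intro ln_mono) (auto simp: le_max_iff_disj)
    then have "- N2 \<le> U x" using e q0 unfolding U_def by (simp add: field_simps)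
    then have "(1 / (M + N3)) * (- N2 + (- N3)) \<le> u x" unfolding u_def using MN by (intro mult_left_mono) auto
    moreover have "- \<eta> \<le> (1 / (M + N3)) * (- N2 + (- N3))"
    proof -
      have "N2 + N3 = M * \<eta>" unfolding M_def using \<eta> by simp
      also have "\<dots> \<le> (M + N3) * \<eta>" using N3 \<eta> by (intro mult_right_mono) auto
      finally show ?thesis using MN by (simp add: field_simps)
    qed
    ultimately show "- \<eta> \<le> u x" by simp
  qed
qed

section \<open>Barriers at unbounded isolated singularities\<close>

text \<open>If \<open>f\<close> were bounded by \<open>B\<close> on the component near
  \<open>a\<close>, the maximum principle would apply to \<open>(f / R)^n * (z - a) / s\<close> on
  the component minus a tiny disc: elsewhere on the frontier \<open>norm (f z) \<le> R\<close>, and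
  the factor \<open>z - a\<close> makes the tiny circle harmless. Letting \<open>n\<close> grow
  contradicts \<open>R < norm (f z1)\<close>.\<close>

lemma unbounded_on_component:
  assumes f: "f holomorphic_on (ball a \<rho> - {a})" and s: "0 < s" "s < \<rho>" and R: "1 \<le> R" "\<And>z. dist a z = s \<Longrightarrow> norm (f z) \<le> R"
    and G: "G = {z \<in> ball a s - {a}. R < norm (f z)}" and z1: "z1 \<in> G" and t: "0 < t"
  shows "\<exists>z\<in>connected_component_set G z1. dist a z < t \<and> B < norm (f z)"
proof (rule ccontr)
  assume "\<not> ?thesis"
  then have bd: "norm (f z) \<le> B" if "z \<in> connected_component_set G z1" "dist a z < t" for z using that by force
  let ?V = "connected_component_set G z1"
  have contf: "continuous_on S f" if "S \<subseteq> ball a \<rho> - {a}" for S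
    using holomorphic_on_imp_continuous_on[OF f] that by (rule continuous_on_subset)
  have sub: "ball a s - {a} \<subseteq> ball a \<rho> - {a}" using s by auto
  have opG: "open G"
  proof -
    have "open (ball a s - {a})" by (intro open_Diff) auto
    moreover have "open {w::complex. R < norm w}" by (intro open_Collect_less continuous_intros)
    ultimately have "open ((ball a s - {a}) \<inter> f -` {w. R < norm w})"
      by (rule continuous_open_preimage[OF contf[OF sub]])
    moreover have "G = (ball a s - {a}) \<inter> f -` {w. R < norm w}" unfolding G by blast
    ultimately show ?thesis by simp
  qed
  have opV: "open ?V" using opG by (rule open_connected_component)
  have VG: "?V \<subseteq> G" by (rule connected_component_subset)
  have z1V: "z1 \<in> ?V" using z1 by simp
  have d1: "0 < dist a z1" "dist a z1 < s" "R < norm (f z1)" using z1 unfolding G by auto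
  have bound: "(norm (f z1) / R) ^ n * (dist a z1 / s) \<le> 1" for n
  proof -
    define K where "K = (\<bar>B\<bar> / R) ^ n / s"
    have K0: "K \<ge> 0" unfolding K_def using R(1) s by simp
    \<comment> \<open>The radius depends on \<open>n\<close>: on this circle the test function is at
      most \<open>K * \<tau> \<le> 1\<close>.\<close>
    define \<tau> where "\<tau> = min (min (t / 2) (dist a z1 / 2)) (1 / (K + 1))"
    have \<tau>: "0 < \<tau>" "\<tau> < t" "\<tau> < dist a z1" "K * \<tau> \<le> 1"
    proof -
      show "0 < \<tau>" "\<tau> < t" "\<tau> < dist a z1" unfolding \<tau>_def using t d1 K0 by (auto simp: min_less_iff_disj)
      have "K * \<tau> \<le> K * (1 / (K + 1))" unfolding \<tau>_def using K0 by (intro mult_left_mono) auto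
      also have "\<dots> \<le> 1" using K0 by (simp add: field_simps)
      finally show "K * \<tau> \<le> 1" .
    qed
    define S where "S = ?V - cball a \<tau>"
    define F where "F z = (f z / of_real R) ^ n * ((z - a) / of_real s)" for z
    have nF: "norm (F z) = (norm (f z) / R) ^ n * (dist a z / s)" for z
      unfolding F_def using R(1) s by (simp add: norm_mult norm_power norm_divide dist_norm norm_minus_commute)
    have opS: "open S" unfolding S_def using opV by (intro open_Diff) auto
    have "S \<subseteq> cball a s - ball a \<tau>" unfolding S_def using VG unfolding G by auto
    moreover have "closed (cball a s - ball a \<tau>)" by (intro closed_Diff) auto
    ultimately have cl: "closure S \<subseteq> cball a s - ball a \<tau>" by (rule closure_minimal)
    have cl\<rho>: "cball a s - ball a \<tau> \<subseteq> ball a \<rho> - {a}" using s \<tau> by auto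
    have clV: "closure S \<subseteq> closure ?V" unfolding S_def by (intro closure_mono) auto
    have "norm (F z1) \<le> 1"
    proof (rule maximum_modulus_frontier[where f = F and S = S])
      have "S \<subseteq> ball a \<rho> - {a}" using cl cl\<rho> closure_subset[of S] by blast
      then have "F holomorphic_on S" unfolding F_def using R(1) s
        by (intro holomorphic_intros holomorphic_on_subset[OF f]) auto
      then show "F holomorphic_on interior S" using opS by (simp add: interior_open)
      show "continuous_on (closure S) F" unfolding F_def using R(1) s cl cl\<rho>
        by (intro continuous_intros contf) auto
      show "bounded S" using cl closure_subset[of S] bounded_cball[of a s] by (meson Diff_subset bounded_subset order_trans)
      show "z1 \<in> S" unfolding S_def using z1V \<tau> by simp
      fix y assume y: "y \<in> frontier S"
      then have yc: "y \<in> closure S" and yS: "y \<notin> S" using opS by (auto simp: frontier_def interior_open)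
      have dy: "\<tau> \<le> dist a y" "dist a y \<le> s" using cl yc by auto
      have clos: "y \<in> closure ?V" using clV yc by blast
      have y\<rho>: "y \<in> ball a \<rho> - {a}" using cl yc cl\<rho> by blast
      have oq: "open (ball a \<rho> - {a})" by (intro open_Diff) auto
      have near: "\<exists>v\<in>?V. dist v y < e" if "e > 0" for e using clos that unfolding closure_approachable by blast
      show "norm (F y) \<le> 1"
      proof (cases "dist a y = \<tau>")
        case True
        have "norm (f y) \<le> \<bar>B\<bar>"
        proof (rule ccontr)
          assume "\<not> ?thesis"
          then have "B < norm (f y)" by linarith
          define O' where "O' = (ball a \<rho> - {a}) \<inter> f -` {w. B < norm w} \<inter> ball a t"
          have "open {w::complex. B < norm w}" by (intro open_Collect_less continuous_intros)
          then have "open ((ball a \<rho> - {a}) \<inter> f -` {w. B < norm w})"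
            by (rule continuous_open_preimage[OF contf[OF order_refl] oq])
          then have "open O'" unfolding O'_def by (rule open_Int[OF _ open_ball])
          moreover have "y \<in> O'" unfolding O'_def using \<open>B < norm (f y)\<close> y\<rho> True \<tau> by simp
          ultimately obtain e where "e > 0" "ball y e \<subseteq> O'" by (meson openE)
          then obtain v where "v \<in> ?V" "v \<in> O'" using near[of e] by (auto simp: dist_commute subset_iff)
          then show False using bd[of v] unfolding O'_def by auto
        qed
        then have "(norm (f y) / R) ^ n * (dist a y / s) \<le> (\<bar>B\<bar> / R) ^ n * (\<tau> / s)"
          using True R(1) s \<tau> by (intro mult_mono power_mono divide_right_mono) auto
        also have "\<dots> = K * \<tau>" unfolding K_def by simp
        finally show ?thesis using nF \<tau> by simp
      next
        case False
        then have gt: "dist a y > \<tau>" using dy by simp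
        then have yV: "y \<notin> ?V" using yS unfolding S_def by auto
        have "norm (f y) \<le> R"
        proof (cases "dist a y = s")
          case True
          then show ?thesis by (rule R(2))
        next
          case False
          show ?thesis
          proof (rule ccontr)
            assume "\<not> ?thesis"
            then have yG: "y \<in> G" unfolding G using False dy gt \<tau> by auto
            have "open (connected_component_set G y)" using opG by (rule open_connected_component)
            moreover have "y \<in> connected_component_set G y" using yG by simp
            ultimately obtain e where "e > 0" "ball y e \<subseteq> connected_component_set G y" by (meson openE)
            then obtain v where "v \<in> ?V" "v \<in> connected_component_set G y" using near[of e] by (auto simp: dist_commute subset_iff)
            then have "connected_component_set G y = ?V"
              using connected_component_eq[of v G y] connected_component_eq[of v G z1] by simp
            then show False using yV \<open>y \<in> connected_component_set G y\<close> by simp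
          qed
        qed
        then have "(norm (f y) / R) ^ n * (dist a y / s) \<le> 1 ^ n * 1"
          using R(1) s dy by (intro mult_mono power_mono) auto
        then show ?thesis using nF by simp
      qed
    qed
    then show ?thesis using nF by simp
  qed
  define x where "x = norm (f z1) / R"
  have x: "x > 1" unfolding x_def using d1(3) R(1) by simp
  obtain n where "s / dist a z1 < x ^ n" using real_arch_pow[OF x] by blast
  then have "1 < x ^ n * (dist a z1 / s)" using d1 s by (simp add: field_simps)
  then show False using bound[of n] unfolding x_def by simp
qed

text \<open>The integral is a holomorphic branch of the logarithm of
  \<open>(y - z) / (x - z)\<close> off the path.\<close>

lemma path_logarithm:
  assumes S: "open S" "connected S" and xy: "x \<in> S" "y \<in> S"
  obtains \<gamma> where "valid_path \<gamma>" "path_image \<gamma> \<subseteq> S" "pathstart \<gamma> = x" "pathfinish \<gamma> = y"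
    "(\<lambda>z. contour_integral \<gamma> (\<lambda>u. 1 / (u - z))) holomorphic_on - path_image \<gamma>"
    "\<And>z. z \<notin> path_image \<gamma> \<Longrightarrow> exp (contour_integral \<gamma> (\<lambda>u. 1 / (u - z))) * (x - z) = y - z"
proof -
  obtain \<gamma> where g: "polynomial_function \<gamma>" "path_image \<gamma> \<subseteq> S" "pathstart \<gamma> = x" "pathfinish \<gamma> = y"
    using connected_open_polynomial_connected[OF S xy] by blast
  have v: "valid_path \<gamma>" using g(1) by (rule valid_path_polynomial_function)
  obtain p' where p': "polynomial_function p'" "\<And>t. (\<gamma> has_vector_derivative p' t) (at t)"
    using has_vector_derivative_polynomial_function[OF g(1)] by metis
  have "continuous_on {0..1} p'" using p'(1) by (rule continuous_on_polymonial_function)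
  then obtain B where B: "B \<ge> 0" "\<And>t. t \<in> {0..1} \<Longrightarrow> norm (p' t) \<le> B"
    using compact_norm_bound[of "{0..1}" p'] by (metis compact_Icc)
  show ?thesis
  proof (rule that[OF v g(2-4)])
    show "(\<lambda>z. contour_integral \<gamma> (\<lambda>u. 1 / (u - z))) holomorphic_on - path_image \<gamma>"
    proof (rule holomorphic_Cauchy_transform[OF v])
      show "norm (vector_derivative \<gamma> (at t)) \<le> B" if "t \<in> {0..1}" for t
        using B(2)[OF that] vector_derivative_at[OF p'(2)] by simp
      show "(\<lambda>u. 1 / (u - w)) contour_integrable_on \<gamma>" if "w \<notin> path_image \<gamma>" for w
        using v that by (rule contour_integrable_inversediff)
    qed auto
    show "exp (contour_integral \<gamma> (\<lambda>u. 1 / (u - z))) * (x - z) = y - z" if "z \<notin> path_image \<gamma>" for z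
      using winding_number_exp_2pi[OF valid_path_imp_path[OF v] that] winding_number_valid_path[OF v that] g(3,4)
      by (simp add: mult.commute)
  qed
qed

text \<open>In the disc the integrand has a primitive with derivative bounded by
  \<open>1 / s\<close>, so only the distance of the endpoints counts, not the length of the
  path.\<close>

lemma contour_integral_inverse_bound:
  assumes \<gamma>: "valid_path \<gamma>" "path_image \<gamma> \<subseteq> ball a s" and z: "2 * s \<le> dist a z" and s: "s > 0"
  shows "norm (contour_integral \<gamma> (\<lambda>u. 1 / (u - z))) \<le> 2"
proof -
  have nz: "s \<le> norm (u - z)" if "u \<in> ball a s" for u
  proof -
    have "dist a z \<le> dist a u + dist u z" by (rule dist_triangle)
    then show ?thesis using that z by (simp add: dist_norm)
  qed
  have hol: "(\<lambda>u. 1 / (u - z)) holomorphic_on ball a s"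
    using nz s by (intro holomorphic_intros) force
  obtain P where P: "\<And>u. u \<in> ball a s \<Longrightarrow> (P has_field_derivative 1 / (u - z)) (at u within ball a s)"
    using holomorphic_convex_primitive'[OF convex_ball open_ball hol] by metis
  have "contour_integral \<gamma> (\<lambda>u. 1 / (u - z)) = P (pathfinish \<gamma>) - P (pathstart \<gamma>)"
    using contour_integral_primitive[OF P \<gamma>] by (rule contour_integral_unique)
  moreover have "norm (P (pathfinish \<gamma>) - P (pathstart \<gamma>)) \<le> 1 / s * norm (pathfinish \<gamma> - pathstart \<gamma>)"
  proof (rule field_differentiable_bound[OF convex_ball P])
    show "norm (1 / (u - z)) \<le> 1 / s" if "u \<in> ball a s" for u
      using nz[OF that] s by (simp add: norm_divide frac_le)
    show "pathfinish \<gamma> \<in> ball a s" "pathstart \<gamma> \<in> ball a s" using \<gamma>(2) by auto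
  qed
  moreover have "norm (pathfinish \<gamma> - pathstart \<gamma>) \<le> 2 * s"
  proof -
    have "pathfinish \<gamma> \<in> ball a s" "pathstart \<gamma> \<in> ball a s" using \<gamma>(2) by auto
    then show ?thesis using dist_triangle[of "pathfinish \<gamma>" "pathstart \<gamma>" a] by (simp add: dist_norm norm_minus_commute)
  qed
  then have "1 / s * norm (pathfinish \<gamma> - pathstart \<gamma>) \<le> 1 / s * (2 * s)" using s by (intro mult_left_mono) auto
  ultimately show ?thesis using s by simp
qed

text \<open>The path consists of two parts. The first one is fixed before \<open>\<delta>'\<close> and bounds the logarithm
  on the circle of radius \<open>\<delta>\<close>; the second one runs in a small disc and changes it on that circle by at
  most \<open>2\<close>. So \<open>\<delta>'\<close> does not depend on \<open>d\<close>, that is, on how close to \<open>a\<close> the path ends.\<close>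

lemma barrier:
  assumes f: "f holomorphic_on (ball a \<rho> - {a})" and \<rho>: "\<rho> > 0" and \<kappa>: "\<kappa> > 0"
    and unb: "\<And>t B. t > 0 \<Longrightarrow> \<exists>z. 0 < dist a z \<and> dist a z < t \<and> B < norm (f z)"
  shows "\<exists>\<delta> \<delta>'. 0 < \<delta>' \<and> \<delta>' < \<delta> \<and> \<delta> < \<rho> \<and> (\<forall>d. 0 < d \<and> d < \<delta>' \<longrightarrow>
    (\<exists>V g. open V \<and> g holomorphic_on V \<and>
      (\<forall>z. d \<le> dist a z \<and> dist a z \<le> \<delta> \<and> norm (f z) \<le> R \<longrightarrow>
        z \<in> V \<and> Re (g z) < 0 \<and> (dist a z = \<delta> \<longrightarrow> Re (g z) \<le> -2) \<and> (dist a z \<le> \<delta>' \<longrightarrow> - \<kappa> \<le> Re (g z)))))"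
proof -
  have contf: "continuous_on S f" if "S \<subseteq> ball a \<rho> - {a}" for S
    using holomorphic_on_imp_continuous_on[OF f] that by (rule continuous_on_subset)
  have level: "\<exists>B. 1 \<le> B \<and> c \<le> B \<and> (\<forall>z. dist a z = s \<longrightarrow> norm (f z) \<le> B)" if "0 < s" "s < \<rho>" for s c
  proof -
    have "sphere a s \<subseteq> ball a \<rho> - {a}" using that by auto
    then obtain B where "\<And>z. z \<in> sphere a s \<Longrightarrow> norm (f z) \<le> B"
      using compact_norm_bound[OF compact_sphere contf] by metis
    then show ?thesis by (intro exI[of _ "max 1 (max c B)"]) (auto simp: le_max_iff_disj)
  qed
  have opG: "open {z \<in> ball a s - {a}. B < norm (f z)}" if "s < \<rho>" for s B
  proof -
    have "open (ball a s - {a})" by (intro open_Diff) auto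
    moreover have "open {w::complex. B < norm w}" by (intro open_Collect_less continuous_intros)
    moreover have "ball a s - {a} \<subseteq> ball a \<rho> - {a}" using that by auto
    ultimately have "open ((ball a s - {a}) \<inter> f -` {w. B < norm w})"
      using continuous_open_preimage[OF contf] by blast
    moreover have "{z \<in> ball a s - {a}. B < norm (f z)} = (ball a s - {a}) \<inter> f -` {w. B < norm w}" by blast
    ultimately show ?thesis by simp
  qed
  obtain R1 where R1: "1 \<le> R1" "R \<le> R1" "\<And>z. dist a z = \<rho> / 2 \<Longrightarrow> norm (f z) \<le> R1"
    using level[of "\<rho> / 2" R] \<rho> by auto
  obtain z1 where z1: "0 < dist a z1" "dist a z1 < \<rho> / 2" "R1 < norm (f z1)" using unb[of "\<rho> / 2" R1] \<rho> by auto
  define G1 where "G1 = {z \<in> ball a (\<rho> / 2) - {a}. R1 < norm (f z)}"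
  have z1G: "z1 \<in> G1" unfolding G1_def using z1 by auto
  define V1 where "V1 = connected_component_set G1 z1"
  \<comment> \<open>With the factor \<open>4\<close>,
    \<open>norm (z1 - z) \<ge> 3 * \<delta>\<close> for \<open>dist a z \<le> \<delta>\<close>,
    against \<open>norm (z3 - z) \<le> 2 * dist a z\<close>; the ratio \<open>3/2\<close> is the
    source of \<open>l\<close>.\<close>
  define \<delta> where "\<delta> = dist a z1 / 4"
  have \<delta>: "0 < \<delta>" "\<delta> < \<rho>" "dist a z1 = 4 * \<delta>" unfolding \<delta>_def using z1 \<rho> by auto
  \<comment> \<open>The circle of radius \<open>\<delta>\<close> is then twice as far from
    \<open>a\<close> as the disc containing the second path.\<close>
  define s2 where "s2 = \<delta> / 2"
  have s2: "0 < s2" "s2 < \<rho>" "2 * s2 = \<delta>" unfolding s2_def using \<delta> by auto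
  obtain R2 where R2: "1 \<le> R2" "R1 \<le> R2" "\<And>z. dist a z = s2 \<Longrightarrow> norm (f z) \<le> R2"
    using level[of s2 R1] s2 by auto
  obtain z2 where z2: "z2 \<in> V1" "dist a z2 < s2" "R2 < norm (f z2)"
    using unbounded_on_component[OF f _ _ R1(1) R1(3) G1_def z1G s2(1), of R2] \<rho> unfolding V1_def by auto
  define G2 where "G2 = {z \<in> ball a s2 - {a}. R2 < norm (f z)}"
  have V1G: "V1 \<subseteq> G1" unfolding V1_def by (rule connected_component_subset)
  have z2G: "z2 \<in> G2" unfolding G2_def using z2 V1G unfolding G1_def by auto
  define V2 where "V2 = connected_component_set G2 z2"
  have V2G: "V2 \<subseteq> G2" unfolding V2_def by (rule connected_component_subset)
  have V1: "open V1" "connected V1" "z1 \<in> V1"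
  proof -
    have "open G1" unfolding G1_def using \<rho> by (intro opG) simp
    then show "open V1" unfolding V1_def by (rule open_connected_component)
  qed (use z1G in \<open>auto simp: V1_def\<close>)
  have V2: "open V2" "connected V2" "z2 \<in> V2"
  proof -
    have "open G2" unfolding G2_def by (rule opG[OF s2(2)])
    then show "open V2" unfolding V2_def by (rule open_connected_component)
  qed (use z2G in \<open>auto simp: V2_def\<close>)
  obtain \<gamma>1 where \<gamma>1: "valid_path \<gamma>1" "path_image \<gamma>1 \<subseteq> V1"
    and J1h: "(\<lambda>z. contour_integral \<gamma>1 (\<lambda>u. 1 / (u - z))) holomorphic_on - path_image \<gamma>1"
    and J1e: "\<And>z. z \<notin> path_image \<gamma>1 \<Longrightarrow> exp (contour_integral \<gamma>1 (\<lambda>u. 1 / (u - z))) * (z1 - z) = z2 - z"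
    using path_logarithm[OF V1 z2(1)] by metis
  define J1 where "J1 z = contour_integral \<gamma>1 (\<lambda>u. 1 / (u - z))" for z
  have off1: "z \<notin> path_image \<gamma>1" if "norm (f z) \<le> R" for z
    using \<gamma>1(2) V1G R1(2) that unfolding G1_def by force
  define X1 where "X1 = {z. dist a z = \<delta> \<and> norm (f z) \<le> R}"
  have "compact X1"
  proof -
    have sub: "sphere a \<delta> \<subseteq> ball a \<rho> - {a}" using \<delta> by auto
    have "closed (sphere a \<delta> \<inter> f -` cball 0 R)"
      by (rule continuous_closed_preimage[OF contf[OF sub] closed_sphere closed_cball])
    moreover have "X1 = sphere a \<delta> \<inter> (sphere a \<delta> \<inter> f -` cball 0 R)" unfolding X1_def by auto
    ultimately show ?thesis by (metis compact_Int_closed compact_sphere)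
  qed
  moreover have "continuous_on X1 J1"
    using holomorphic_on_imp_continuous_on[OF J1h] off1 unfolding J1_def[abs_def] X1_def
    by (auto elim!: continuous_on_subset)
  ultimately obtain Y1 where Y1: "Y1 \<ge> 0" "\<And>z. z \<in> X1 \<Longrightarrow> norm (J1 z) \<le> Y1"
    using compact_norm_bound by metis
  define Y where "Y = Y1 + 2"
  define l where "l = ln (3/2 :: real)"
  have l: "l > 0" unfolding l_def by simp
  \<comment> \<open>On the circle of radius \<open>\<delta>\<close> the real part of
    \<open>1 / h\<close> is at least \<open>l / Y\<^sup>2\<close>, so this multiple turns it into at
    least \<open>2\<close>.\<close>
  define \<Lambda> where "\<Lambda> = 2 * Y\<^sup>2 / l"
  have Y: "Y > 0" unfolding Y_def using Y1 by simp
  have \<Lambda>: "\<Lambda> > 0" unfolding \<Lambda>_def using Y l by simp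
  \<comment> \<open>Within this radius \<open>Re (h z) \<ge> \<Lambda> / \<kappa>\<close>, hence the
    barrier is at least \<open>- \<kappa>\<close>.\<close>
  define \<delta>' where "\<delta>' = min (\<delta> / 2) (3 * \<delta> / 2 * exp (- (\<Lambda> / \<kappa>)))"
  have \<delta>': "0 < \<delta>'" "\<delta>' < \<delta>" unfolding \<delta>'_def using \<delta> by (auto simp: min_less_iff_disj)
  have \<delta>'ln: "\<Lambda> / \<kappa> \<le> ln (3 * \<delta> / (2 * \<delta>'))"
  proof -
    have "\<delta>' \<le> 3 * \<delta> / 2 * exp (- (\<Lambda> / \<kappa>))" unfolding \<delta>'_def by simp
    then have "exp (\<Lambda> / \<kappa>) \<le> 3 * \<delta> / (2 * \<delta>')" using \<delta>' by (simp add: exp_minus field_simps)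
    then show ?thesis using \<delta>' \<delta> by (simp add: ln_ge_iff)
  qed
  show ?thesis
  proof (rule exI[of _ \<delta>], rule exI[of _ \<delta>'], intro conjI allI impI)
    fix d assume d: "0 < d \<and> d < \<delta>'"
    obtain z3 where z3: "z3 \<in> V2" "dist a z3 < d"
      using unbounded_on_component[OF f s2(1,2) R2(1) R2(3) G2_def z2G, of d 0] d unfolding V2_def by auto
    obtain \<gamma>2 where \<gamma>2: "valid_path \<gamma>2" "path_image \<gamma>2 \<subseteq> V2"
      and J2h: "(\<lambda>z. contour_integral \<gamma>2 (\<lambda>u. 1 / (u - z))) holomorphic_on - path_image \<gamma>2"
      and J2e: "\<And>z. z \<notin> path_image \<gamma>2 \<Longrightarrow> exp (contour_integral \<gamma>2 (\<lambda>u. 1 / (u - z))) * (z2 - z) = z3 - z"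
      using path_logarithm[OF V2 z3(1)] by metis
    define J2 where "J2 z = contour_integral \<gamma>2 (\<lambda>u. 1 / (u - z))" for z
    have off2: "z \<notin> path_image \<gamma>2" if "norm (f z) \<le> R" for z
      using \<gamma>2(2) V2G R1(2) R2(2) that unfolding G2_def by force
    define O1 where "O1 = - (path_image \<gamma>1 \<union> path_image \<gamma>2)"
    have opO1: "open O1" unfolding O1_def
      using closed_valid_path_image[OF \<gamma>1(1)] closed_valid_path_image[OF \<gamma>2(1)] by (intro open_Compl closed_Un)
    \<comment> \<open>A branch of the logarithm of \<open>(z1 - z) / (z3 - z)\<close>. Its real part
      is positive where needed and large near \<open>a\<close>, so \<open>- \<Lambda> / h\<close>
      has a negative real part that is small there.\<close>
    define h where "h z = - (J1 z + J2 z)" for z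
    have hh: "h holomorphic_on O1"
    proof -
      have "J1 holomorphic_on O1" "J2 holomorphic_on O1"
        using holomorphic_on_subset[OF J1h, of O1] holomorphic_on_subset[OF J2h, of O1]
        unfolding J1_def[abs_def] J2_def[abs_def] O1_def by auto
      then show ?thesis unfolding h_def[abs_def] by (intro holomorphic_on_minus holomorphic_on_add)
    qed
    define V where "V = O1 \<inter> h -` (- {0})"
    have opV: "open V" unfolding V_def
      using holomorphic_on_imp_continuous_on[OF hh] opO1 by (intro continuous_open_preimage) auto
    have "(\<lambda>z. - of_real \<Lambda> / h z) holomorphic_on V"
      by (intro holomorphic_on_divide holomorphic_on_const holomorphic_on_subset[OF hh]) (auto simp: V_def)
    moreover have "z \<in> V \<and> Re (- of_real \<Lambda> / h z) < 0 \<and> (dist a z = \<delta> \<longrightarrow> Re (- of_real \<Lambda> / h z) \<le> -2) \<and>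
        (dist a z \<le> \<delta>' \<longrightarrow> - \<kappa> \<le> Re (- of_real \<Lambda> / h z))"
      if z: "d \<le> dist a z" "dist a z \<le> \<delta>" "norm (f z) \<le> R" for z
    proof -
      have zO: "z \<in> O1" unfolding O1_def using off1[OF z(3)] off2[OF z(3)] by simp
      have d1: "3 * \<delta> \<le> norm (z1 - z)" using dist_triangle[of a z1 z] \<delta>(3) z(2) by (simp add: dist_norm norm_minus_commute)
      have d3: "norm (z3 - z) \<le> 2 * dist a z" using dist_triangle[of z3 z a] z3(2) z(1) by (simp add: dist_norm norm_minus_commute)
      have z3z: "norm (z3 - z) > 0"
      proof -
        have "z3 \<noteq> z" using z3(2) z(1) by auto
        then show ?thesis by simp
      qed
      have az: "dist a z > 0" using d z(1) by linarith
      have "exp (J1 z + J2 z) * (z1 - z) = exp (J2 z) * (exp (J1 z) * (z1 - z))" by (simp add: exp_add)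
      also have "\<dots> = z3 - z"
        using J1e[OF off1[OF z(3)]] J2e[OF off2[OF z(3)]] unfolding J1_def J2_def by simp
      finally have "exp (J1 z + J2 z) * (z1 - z) = z3 - z" .
      then have "norm (exp (J1 z + J2 z)) * norm (z1 - z) = norm (z3 - z)" by (metis norm_mult)
      moreover have z1z: "norm (z1 - z) > 0" using d1 \<delta>(1) by linarith
      ultimately have "exp (Re (J1 z + J2 z)) = norm (z3 - z) / norm (z1 - z)" by (simp only: norm_exp_eq_Re eq_divide_eq) simp
      then have "Re (J1 z + J2 z) = ln (norm (z3 - z) / norm (z1 - z))" by (metis ln_exp)
      then have Reh: "Re (h z) = ln (norm (z1 - z) / norm (z3 - z))"
        unfolding h_def uminus_complex.simps
        using ln_divide_pos[OF z3z z1z] ln_divide_pos[OF z1z z3z] by linarith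
      have "3 * \<delta> / (2 * dist a z) \<le> norm (z1 - z) / norm (z3 - z)" using d1 d3 z3z \<delta>(1) az by (intro frac_le) auto
      then have Reh2: "ln (3 * \<delta> / (2 * dist a z)) \<le> Re (h z)" unfolding Reh using \<delta>(1) az by (intro ln_mono) auto
      have "3/2 \<le> 3 * \<delta> / (2 * dist a z)" using z(2) az by (simp add: field_simps)
      then have "l \<le> ln (3 * \<delta> / (2 * dist a z))" unfolding l_def by (intro ln_mono) auto
      then have Rel: "l \<le> Re (h z)" using Reh2 by simp
      then have hnz: "h z \<noteq> 0" using l by auto
      have nh: "0 < norm (h z)" "Re (h z) \<le> norm (h z)" using hnz complex_Re_le_cmod by auto
      have Reg: "Re (- of_real \<Lambda> / h z) = - (\<Lambda> * (Re (h z) / (norm (h z))\<^sup>2))"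
        by (simp add: Re_divide cmod_power2)
      have pos: "Re (h z) / (norm (h z))\<^sup>2 > 0" using Rel l nh by simp
      have c1: "Re (- of_real \<Lambda> / h z) < 0" unfolding Reg using mult_pos_pos[OF \<Lambda> pos] by linarith
      have c2: "Re (- of_real \<Lambda> / h z) \<le> -2" if dz: "dist a z = \<delta>"
      proof -
        have "norm (J1 z) \<le> Y1" using Y1(2)[of z] dz z(3) unfolding X1_def by simp
        moreover have "norm (J2 z) \<le> 2" unfolding J2_def
        proof (rule contour_integral_inverse_bound[OF \<gamma>2(1)])
          show "path_image \<gamma>2 \<subseteq> ball a s2" using \<gamma>2(2) V2G unfolding G2_def by auto
        qed (use s2 dz in auto)
        ultimately have "norm (h z) \<le> Y" unfolding h_def Y_def using norm_triangle_ineq[of "J1 z" "J2 z"] by (simp only: norm_minus_cancel)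
        then have "(norm (h z))\<^sup>2 \<le> Y\<^sup>2" by (intro power_mono) auto
        then have "l / Y\<^sup>2 \<le> Re (h z) / (norm (h z))\<^sup>2" using Rel l nh by (intro frac_le) auto
        then have "\<Lambda> * (l / Y\<^sup>2) \<le> \<Lambda> * (Re (h z) / (norm (h z))\<^sup>2)" using \<Lambda> by (intro mult_left_mono) auto
        moreover have "\<Lambda> * (l / Y\<^sup>2) = 2" unfolding \<Lambda>_def using l Y by simp
        ultimately show ?thesis unfolding Reg by simp
      qed
      have c3: "- \<kappa> \<le> Re (- of_real \<Lambda> / h z)" if dz: "dist a z \<le> \<delta>'"
      proof -
        have "3 * \<delta> / (2 * \<delta>') \<le> 3 * \<delta> / (2 * dist a z)" using dz az \<delta>(1) by (intro frac_le) auto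
        then have "ln (3 * \<delta> / (2 * \<delta>')) \<le> ln (3 * \<delta> / (2 * dist a z))" using \<delta>(1) \<delta>'(1) by (intro ln_mono) auto
        then have "\<Lambda> / \<kappa> \<le> Re (h z)" using \<delta>'ln Reh2 by linarith
        then have "\<Lambda> \<le> \<kappa> * Re (h z)" using \<kappa> by (simp add: field_simps)
        have "Re (h z) * Re (h z) \<le> (norm (h z))\<^sup>2" unfolding power2_eq_square
          using nh Rel l by (intro mult_mono) auto
        then have "\<kappa> * (Re (h z) * Re (h z)) \<le> \<kappa> * (norm (h z))\<^sup>2" using \<kappa> by (intro mult_left_mono) auto
        moreover have "\<Lambda> * Re (h z) \<le> \<kappa> * Re (h z) * Re (h z)"
          using \<open>\<Lambda> \<le> \<kappa> * Re (h z)\<close> Rel l by (intro mult_right_mono) auto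
        ultimately have "\<Lambda> * Re (h z) \<le> \<kappa> * (norm (h z))\<^sup>2" by linarith
        then have "\<Lambda> * (Re (h z) / (norm (h z))\<^sup>2) \<le> \<kappa>" using nh by (simp add: field_simps)
        then show ?thesis unfolding Reg by simp
      qed
      show ?thesis using zO hnz c1 c2 c3 unfolding V_def by simp
    qed
    ultimately show "\<exists>V g. open V \<and> g holomorphic_on V \<and> (\<forall>z. d \<le> dist a z \<and> dist a z \<le> \<delta> \<and> norm (f z) \<le> R \<longrightarrow>
        z \<in> V \<and> Re (g z) < 0 \<and> (dist a z = \<delta> \<longrightarrow> Re (g z) \<le> -2) \<and> (dist a z \<le> \<delta>' \<longrightarrow> - \<kappa> \<le> Re (g z)))"
      using opV by (intro exI[of _ V] exI[of _ "\<lambda>z. - of_real \<Lambda> / h z"]) blast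
  qed (use \<delta> \<delta>' in auto)
qed

section \<open>Peeling off isolated vertical lines\<close>

lemma cpsh_onI:
  assumes "open \<Omega>" "\<And>x. x \<in> \<Omega> \<Longrightarrow> submean_at u x"
  shows "cpsh_on \<Omega> u"
proof -
  have "isCont u x" if x: "x \<in> \<Omega>" for x
  proof -
    obtain r where "r > 0" "continuous_on (ball x r) u" using assms(2)[OF x] unfolding submean_at_def by blast
    then show ?thesis by (simp add: continuous_on_eq_continuous_at)
  qed
  then show ?thesis unfolding cpsh_on_def using assms(2) continuous_at_imp_continuous_on by blast
qed

text \<open>\<open>J\<close> lists the points whose vertical lines are freed from the pole set;
  \<open>C\<close> and \<open>F\<close> test the graph and its complement on compact sets.\<close>

definition peels :: "complex set \<Rightarrow> complex set \<Rightarrow> (complex \<Rightarrow> complex) \<Rightarrow> complex set \<Rightarrow> complex set \<Rightarrow> real \<Rightarrow> (complex \<times> complex) set \<Rightarrow>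
    complex set \<Rightarrow> real \<Rightarrow> (complex \<times> complex \<Rightarrow> real) \<Rightarrow> bool" where
  "peels D A f J L k F C \<eta> u \<longleftrightarrow> cpsh_on (D \<times> UNIV) u \<and> (\<forall>z\<in>L. \<forall>w. norm w \<le> k \<longrightarrow> u (z, w) \<le> 0) \<and> (\<forall>z\<in>C. u (z, f z) \<le> -1) \<and>
       (\<forall>z\<in>(A - J) \<inter> L. \<forall>w. norm w \<le> k \<longrightarrow> u (z, w) \<le> -1) \<and> (\<forall>x\<in>F. - \<eta> \<le> u x) \<and>
       (\<forall>a\<in>J. \<forall>w. norm w \<le> k \<longrightarrow> - \<eta> \<le> u (a, w))"

lemma peelsD:
  assumes "peels D A f J L k F C \<eta> u"
  shows "cpsh_on (D \<times> UNIV) u" and "z \<in> L \<Longrightarrow> norm w \<le> k \<Longrightarrow> u (z, w) \<le> 0" and "z \<in> C \<Longrightarrow> u (z, f z) \<le> -1"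
    and "z \<in> A \<Longrightarrow> z \<notin> J \<Longrightarrow> z \<in> L \<Longrightarrow> norm w \<le> k \<Longrightarrow> u (z, w) \<le> -1" and "x \<in> F \<Longrightarrow> - \<eta> \<le> u x"
    and "a \<in> J \<Longrightarrow> norm w \<le> k \<Longrightarrow> - \<eta> \<le> u (a, w)"
  using assms unfolding peels_def by blast+

text \<open>All data are quantified because freeing one more line calls the previous construction
  with other values of \<open>k\<close>, \<open>F\<close> and \<open>\<eta>\<close>.\<close>

definition peelable :: "complex set \<Rightarrow> complex set \<Rightarrow> (complex \<Rightarrow> complex) \<Rightarrow> complex set \<Rightarrow> bool" where
  "peelable D A f J \<longleftrightarrow> (\<forall>L k F C \<eta>. compact L \<longrightarrow> L \<subseteq> D \<longrightarrow> compact C \<longrightarrow> C \<subseteq> D - A \<longrightarrow> compact F \<longrightarrow> fst ` F \<subseteq> D - A \<longrightarrow>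
     (\<forall>z w. (z, w) \<in> F \<longrightarrow> w \<noteq> f z) \<longrightarrow> 0 < \<eta> \<longrightarrow> (\<exists>u. peels D A f J L k F C \<eta> u))"

lemma peelable_empty:
  assumes "open D" "open (D - A)" "A \<subseteq> D" "\<And>K. compact K \<Longrightarrow> K \<subseteq> A \<Longrightarrow> cheb_zero K" "f holomorphic_on (D - A)"
  shows "peelable D A f {}"
  unfolding peelable_def
proof (intro allI impI)
  fix L C :: "complex set" and k \<eta> :: real and F :: "(complex \<times> complex) set"
  assume L: "compact L" "L \<subseteq> D" and C: "compact C" "C \<subseteq> D - A" and F: "compact F" "fst ` F \<subseteq> D - A" "\<forall>z w. (z, w) \<in> F \<longrightarrow> w \<noteq> f z"
    and \<eta>: "0 < \<eta>"
  have "\<exists>u. cpsh_on (D \<times> UNIV) u \<and> (\<forall>z\<in>L. \<forall>w. norm w \<le> k \<longrightarrow> u (z, w) \<le> 0) \<and>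
     (\<forall>z\<in>C. u (z, f z) \<le> -1) \<and> (\<forall>z\<in>A \<inter> L. \<forall>w. norm w \<le> k \<longrightarrow> u (z, w) \<le> -1) \<and> (\<forall>x\<in>F. - \<eta> \<le> u x)"
    by (rule base_function[OF assms(1-3) assms(4) assms(5) L C F(1,2) _ \<eta>]) (use F(3) in auto)
  then show "\<exists>u. peels D A f {} L k F C \<eta> u" unfolding peels_def by simp
qed

text \<open>Where \<open>|f|\<close> is close to \<open>R\<close> the graph is outside \<open>|w| \<le> W\<close>, so there \<open>T2\<close> exceeds the barrier and
  the maximum of the two glues with \<open>T2\<close>. The small multiple \<open>\<beta>\<close> of \<open>ln |z - a|\<close> pushes the barrier below
  the constant \<open>-3\<kappa>\<close> close to \<open>a\<close>, where the barrier is no longer defined.\<close>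

lemma peelable_insert:
  assumes D: "open D" "open (D - A)" "A \<subseteq> D" and f: "f holomorphic_on (D - A)"
    and J: "peelable D A f J" "finite J" and a: "a \<in> A" "a \<notin> J"
    and iso: "\<rho>0 > 0" "\<And>z. z \<in> A \<Longrightarrow> dist a z < \<rho>0 \<Longrightarrow> z = a"
    and unb: "\<And>t B. t > 0 \<Longrightarrow> \<exists>z. 0 < dist a z \<and> dist a z < t \<and> B < norm (f z)"
  shows "peelable D A f (insert a J)"
  unfolding peelable_def
proof (intro allI impI)
  fix L C :: "complex set" and k \<eta> :: real and F :: "(complex \<times> complex) set"
  assume L: "compact L" "L \<subseteq> D" and C: "compact C" "C \<subseteq> D - A" and F: "compact F" "fst ` F \<subseteq> D - A" "\<forall>z w. (z, w) \<in> F \<longrightarrow> w \<noteq> f z"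
    and \<eta>: "0 < \<eta>"
  \<comment> \<open>The line over \<open>a\<close> receives the value \<open>- 3 * \<kappa>\<close>.
    Where this constant must give way again, \<open>\<beta>\<close> and \<open>P\<close> are each at
    least \<open>- \<kappa>\<close>, so the maximum has already switched.\<close>
  define \<kappa> where "\<kappa> = \<eta> / 4"
  have \<kappa>: "\<kappa> > 0" using \<eta> unfolding \<kappa>_def by simp
  have contf: "continuous_on S f" if "S \<subseteq> D - A" for S
    using holomorphic_on_imp_continuous_on[OF f] that by (rule continuous_on_subset)
  define Q where "Q = C \<union> fst ` F \<union> J"
  have "compact (fst ` F)" using F(1) by (intro compact_continuous_image continuous_intros)
  then have "compact Q" unfolding Q_def using C(1) finite_imp_compact[OF J(2)] by (intro compact_Un)
  then have "open (D \<inter> - Q)" using D(1) by (intro open_Int open_Compl compact_imp_closed)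
  moreover have "a \<in> D \<inter> - Q" unfolding Q_def using a D(3) C(2) F(2) by blast
  ultimately obtain \<rho>1 where \<rho>1: "\<rho>1 > 0" "ball a \<rho>1 \<subseteq> D \<inter> - Q" using openE by blast
  define \<rho> where "\<rho> = min \<rho>0 \<rho>1"
  have \<rho>: "\<rho> > 0" unfolding \<rho>_def using \<rho>1 iso by simp
  have \<rho>D: "z \<in> D - A" if "0 < dist a z" "dist a z < \<rho>" for z
    using that iso(2)[of z] \<rho>1(2) unfolding \<rho>_def by (auto simp: subset_iff)
  have farQ: "\<rho> \<le> dist a z" if "z \<in> Q" for z
    using that \<rho>1(2) unfolding \<rho>_def by (force simp: subset_iff min_le_iff_disj)
  have farA: "\<rho> \<le> dist a z" if "z \<in> A" "z \<noteq> a" for z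
    using that iso(2)[of z] unfolding \<rho>_def by force
  have fh: "f holomorphic_on (ball a \<rho> - {a})" by (rule holomorphic_on_subset[OF f]) (use \<rho>D in auto)
  obtain Bf where Bf: "Bf \<ge> 0" "\<And>z. z \<in> C \<Longrightarrow> norm (f z) \<le> Bf" using compact_norm_bound[OF C(1) contf[OF C(2)]] by metis
  define k0 where "k0 = max 1 (max k Bf)"
  have k0: "k0 \<ge> 1" "k \<le> k0" "Bf \<le> k0" unfolding k0_def by auto
  \<comment> \<open>Since \<open>ln 3 \<ge> 1\<close>, the term \<open>lp\<close> reaches
    \<open>1\<close> for \<open>norm w \<ge> W\<close>.\<close>
  define W where "W = 3 * k0"
  define R where "R = W + 2"
  obtain \<delta> \<delta>' where \<delta>: "0 < \<delta>'" "\<delta>' < \<delta>" "\<delta> < \<rho>"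
    and bar: "\<And>d. 0 < d \<Longrightarrow> d < \<delta>' \<Longrightarrow> \<exists>V g. open V \<and> g holomorphic_on V \<and>
      (\<forall>z. d \<le> dist a z \<and> dist a z \<le> \<delta> \<and> norm (f z) \<le> R \<longrightarrow>
        z \<in> V \<and> Re (g z) < 0 \<and> (dist a z = \<delta> \<longrightarrow> Re (g z) \<le> -2) \<and> (dist a z \<le> \<delta>' \<longrightarrow> - \<kappa> \<le> Re (g z)))"
    using barrier[OF fh \<rho> \<kappa> unb, of R] by blast
  have "continuous_on (L \<union> C) (\<lambda>z. z - a)" by (intro continuous_intros)
  then obtain BL where BL: "BL \<ge> 0" "\<And>z. z \<in> L \<union> C \<Longrightarrow> norm (z - a) \<le> BL"
    using compact_norm_bound[OF compact_Un[OF L(1) C(1)]] by metis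
  define c where "c = ln (max BL \<rho> + 1)"
  have cpos: "max BL \<rho> + 1 > 0" using \<rho> by (simp add: max_def)
  have cle: "ln (norm (z - a)) \<le> c" if "z \<in> L \<union> C \<or> dist a z < \<rho>" "z \<noteq> a" for z
  proof -
    have "norm (z - a) \<le> max BL \<rho> + 1" using that BL(2)[of z] by (auto simp: dist_norm norm_minus_commute max_def)
    then show ?thesis unfolding c_def using that(2) by (intro ln_mono) auto
  qed
  have c\<delta>: "ln (\<delta>' / 2) < c" unfolding c_def using \<delta> cpos by (subst ln_less_cancel_iff) (auto simp: max_def)
  \<comment> \<open>Makes \<open>\<beta>\<close> equal to \<open>- \<kappa>\<close> at distance
    \<open>\<delta>' / 2\<close> from \<open>a\<close>, while \<open>c\<close> makes it nonpositive
    over \<open>L\<close>, \<open>C\<close> and the disc of radius \<open>\<rho>\<close>.\<close>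
  define \<epsilon> where "\<epsilon> = \<kappa> / (c - ln (\<delta>' / 2))"
  have \<epsilon>: "\<epsilon> > 0" unfolding \<epsilon>_def using \<kappa> c\<delta> by simp
  define \<beta> where "\<beta> z = \<epsilon> * (ln (norm (z - a)) + (- c))" for z
  have \<beta>le: "\<beta> z \<le> 0" if "z \<in> L \<union> C \<or> dist a z < \<rho>" "z \<noteq> a" for z
    unfolding \<beta>_def using cle[OF that] \<epsilon> by (simp add: mult_nonneg_nonpos)
  have \<beta>ge: "- \<kappa> \<le> \<beta> z" if "\<delta>' / 2 \<le> dist a z" for z
  proof -
    have "ln (\<delta>' / 2) \<le> ln (norm (z - a))" using that \<delta> by (intro ln_mono) (auto simp: dist_norm norm_minus_commute)
    then have "\<epsilon> * (ln (\<delta>' / 2) + (- c)) \<le> \<beta> z" unfolding \<beta>_def using \<epsilon> by (intro mult_left_mono) auto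
    moreover have "\<epsilon> * (ln (\<delta>' / 2) + (- c)) = - \<kappa>" unfolding \<epsilon>_def using c\<delta> by (simp add: field_simps)
    ultimately show ?thesis by simp
  qed
  have \<beta>small: "\<beta> z \<le> - m" if "z \<noteq> a" "dist a z \<le> exp (c - m / \<epsilon>)" for z m
  proof -
    have "ln (norm (z - a)) \<le> ln (exp (c - m / \<epsilon>))" using that by (intro ln_mono) (auto simp: dist_norm norm_minus_commute)
    then have "\<beta> z \<le> \<epsilon> * (c - m / \<epsilon> + (- c))" unfolding \<beta>_def using \<epsilon> by (intro mult_left_mono) auto
    then show ?thesis using \<epsilon> by simp
  qed
  \<comment> \<open>Within \<open>2 * d\<close> of \<open>a\<close> one has
    \<open>\<beta> \<le> - 4 * \<kappa>\<close>, so a negative barrier is invisible beside the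
    constant \<open>- 3 * \<kappa>\<close>; it is needed only from \<open>d\<close>
    outwards.\<close>
  define d where "d = min (\<delta>' / 8) (exp (c - 4 * \<kappa> / \<epsilon>) / 2)"
  have d: "0 < d" "d < \<delta>'" "2 * d < \<delta>' / 2" "2 * d \<le> exp (c - 4 * \<kappa> / \<epsilon>)" unfolding d_def using \<delta> by (auto simp: min_def)
  obtain V g where V: "open V" "g holomorphic_on V"
    and g: "\<And>z. d \<le> dist a z \<Longrightarrow> dist a z \<le> \<delta> \<Longrightarrow> norm (f z) \<le> R \<Longrightarrow>
        z \<in> V \<and> Re (g z) < 0 \<and> (dist a z = \<delta> \<longrightarrow> Re (g z) \<le> -2) \<and> (dist a z \<le> \<delta>' \<longrightarrow> - \<kappa> \<le> Re (g z))"
    using bar[OF d(1,2)] by blast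
  define An where "An = cball a \<delta> - ball a d"
  have An: "compact An" "An \<subseteq> D - A" "\<And>z. z \<in> An \<longleftrightarrow> d \<le> dist a z \<and> dist a z \<le> \<delta>"
  proof -
    show "compact An" unfolding An_def by (simp add: compact_diff)
    show iff: "z \<in> An \<longleftrightarrow> d \<le> dist a z \<and> dist a z \<le> \<delta>" for z unfolding An_def by auto
    show "An \<subseteq> D - A"
    proof
      fix z assume "z \<in> An"
      then have "0 < dist a z" "dist a z < \<rho>" using iff[of z] \<delta>(3) d(1) by linarith+
      then show "z \<in> D - A" by (rule \<rho>D)
    qed
  qed
  define X where "X = {z \<in> An. norm (f z) \<le> R}"
  have Xc: "compact X"
  proof -
    have "closed (An \<inter> f -` cball 0 R)"
      by (rule continuous_closed_preimage[OF contf[OF An(2)] compact_imp_closed[OF An(1)] closed_cball])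
    moreover have "X = An \<inter> (An \<inter> f -` cball 0 R)" unfolding X_def by auto
    ultimately show ?thesis using An(1) by (metis compact_Int_closed)
  qed
  have XV: "X \<subseteq> V" unfolding X_def using g An(3) by blast
  obtain \<eta>g where \<eta>g: "\<eta>g > 0" "\<And>z. z \<in> X \<Longrightarrow> Re (g z) \<le> - \<eta>g"
  proof (cases "X = {}")
    case True then show ?thesis by (intro that[of 1]) auto
  next
    case False
    have "continuous_on X (\<lambda>z. Re (g z))"
      by (intro continuous_intros continuous_on_subset[OF holomorphic_on_imp_continuous_on[OF V(2)] XV])
    then obtain x where x: "x \<in> X" "\<forall>y\<in>X. Re (g y) \<le> Re (g x)" using continuous_attains_sup[OF Xc False] by blast
    have "Re (g x) < 0" using x(1) g[of x] An(3) unfolding X_def by blast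
    then show ?thesis using x(2) by (intro that[of "- Re (g x)"]) auto
  qed
  \<comment> \<open>Smaller than the distance of \<open>Re g\<close> from \<open>0\<close> on
    \<open>X\<close>, so that \<open>T2\<close> beats the barrier wherever it is at least
    \<open>- \<eta>'\<close>.\<close>
  define \<eta>' where "\<eta>' = min \<kappa> (\<eta>g / 2)"
  have \<eta>': "\<eta>' > 0" "\<eta>' \<le> \<kappa>" "\<eta>' < \<eta>g" unfolding \<eta>'_def using \<kappa> \<eta>g by (auto simp: min_def)
  define Fa where "Fa = {z \<in> An. R - 1 \<le> norm (f z)} \<times> cball (0::complex) W"
  have Fac: "compact Fa"
  proof -
    have "closed {w::complex. R - 1 \<le> norm w}" by (intro closed_Collect_le continuous_intros)
    then have "closed (An \<inter> f -` {w. R - 1 \<le> norm w})"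
      by (rule continuous_closed_preimage[OF contf[OF An(2)] compact_imp_closed[OF An(1)]])
    moreover have "{z \<in> An. R - 1 \<le> norm (f z)} = An \<inter> (An \<inter> f -` {w. R - 1 \<le> norm w})" by auto
    ultimately have "compact {z \<in> An. R - 1 \<le> norm (f z)}" using An(1) by (metis compact_Int_closed)
    then show ?thesis unfolding Fa_def by (intro compact_Times) auto
  qed
  have FF: "compact (F \<union> Fa)" "fst ` (F \<union> Fa) \<subseteq> D - A" "\<And>z w. (z, w) \<in> F \<union> Fa \<Longrightarrow> w \<noteq> f z"
  proof -
    show "compact (F \<union> Fa)" using F(1) Fac by (rule compact_Un)
    show "fst ` (F \<union> Fa) \<subseteq> D - A" using F(2) An(2) unfolding Fa_def by auto
    show "w \<noteq> f z" if "(z, w) \<in> F \<union> Fa" for z w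
      using that F(3) unfolding Fa_def R_def by auto
  qed
  obtain T where Tp: "peels D A f J L W (F \<union> Fa) C \<eta>' T"
    using J(1)[unfolded peelable_def, rule_format, OF L C FF(1,2) FF(3) \<eta>'(1)] by blast
  note T = peelsD[OF Tp]
  define lp where "lp w = ln (max k0 (norm w)) + (- ln k0)" for w :: complex
  have lp0: "lp w \<ge> 0" for w unfolding lp_def using k0(1) by simp
  have lp1: "lp w = 0" if "norm w \<le> k0" for w unfolding lp_def using that by (simp add: max_def)
  have lpW: "lp w \<ge> 1" if "norm w \<ge> W" for w
  proof -
    have "(1::real) \<le> ln 3" using ln_ge_iff[of 3 1] exp_le by simp
    moreover have "ln (3 * k0) \<le> ln (max k0 (norm w))" using that k0(1) unfolding W_def by (intro ln_mono) auto
    moreover have "ln (3 * k0) = ln 3 + ln k0" using k0(1) by (simp add: ln_mult)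
    ultimately show ?thesis unfolding lp_def by linarith
  qed
  \<comment> \<open>Truncation at \<open>-1\<close> makes \<open>T2\<close> exceed the barrier on
    the circle of radius \<open>\<delta>\<close>, where that is at most \<open>-2\<close>. For large
    \<open>w\<close>, where nothing is known about \<open>T\<close>, the term \<open>lp\<close>
    offsets the \<open>-1\<close>.\<close>
  define T2 where "T2 y = max (T y) (-1) + lp (snd y)" for y
  have cpT2: "cpsh_on (D \<times> UNIV) T2"
  proof -
    have "cpsh_on (D \<times> UNIV) (\<lambda>y. ln (max k0 (norm (snd y))))"
      using k0(1) by (intro cpsh_on_subset[OF cpsh_on_ln_max_snd]) auto
    then show ?thesis unfolding T2_def[abs_def] lp_def by (intro cpsh_on_add cpsh_on_max T(1) cpsh_on_const)
  qed
  have T2m1: "-1 \<le> T2 y" for y unfolding T2_def using lp0[of "snd y"] max.cobounded2[of "-1" "T y"] by linarith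
  have T2T: "T y \<le> T2 y" for y unfolding T2_def using lp0[of "snd y"] by simp
  have T2a: "- \<eta>' \<le> T2 (z, w)" if "z \<in> An" "R - 1 \<le> norm (f z)" for z w
  proof (cases "norm w \<le> W")
    case True
    then have "(z, w) \<in> Fa" unfolding Fa_def using that by simp
    then show ?thesis using T(5)[of "(z, w)"] T2T[of "(z, w)"] by simp
  next
    case False
    then have "lp w \<ge> 1" by (intro lpW) simp
    then show ?thesis unfolding T2_def using \<eta>'(1) max.cobounded2[of "-1" "T (z, w)"] by simp
  qed
  define P where "P y = (if d < dist a (fst y) \<and> dist a (fst y) < \<delta> \<and> norm (f (fst y)) < R then max (T2 y) (Re (g (fst y))) else T2 y)" for y
  \<comment> \<open>The line over \<open>a\<close> is a separate case because
    \<open>ln 0 = 0\<close> gives \<open>\<beta>\<close> a finite value there.\<close>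
  define U where "U y = (if \<delta>' / 2 < dist a (fst y) then \<beta> (fst y) + P y
     else if fst y = a then - 3 * \<kappa> else max (- 3 * \<kappa>) (\<beta> (fst y) + P y))" for y
  have smT2: "submean_at T2 x" if "fst x \<in> D" for x
    using cpT2 that unfolding cpsh_on_def by (cases x) auto
  have opd: "open {y::complex \<times> complex. r < dist a (fst y)}" "open {y::complex \<times> complex. dist a (fst y) < r}" for r
    by (intro open_Collect_less continuous_intros)+
  have opf: "open {y::complex \<times> complex. fst y \<in> D - A \<and> r < norm (f (fst y))}" "open {y::complex \<times> complex. fst y \<in> D - A \<and> norm (f (fst y)) < r}" for r
  proof -
    have "continuous_on ((D - A) \<times> (UNIV::complex set)) (\<lambda>y. norm (f (fst y)))"
      by (intro continuous_intros continuous_on_compose2[OF contf[OF order_refl]]) auto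
    moreover have "open ((D - A) \<times> (UNIV::complex set))" using D(2) by (simp add: open_Times)
    ultimately have "open (((D - A) \<times> (UNIV::complex set)) \<inter> (\<lambda>y. norm (f (fst y))) -` {r<..})"
      "open (((D - A) \<times> (UNIV::complex set)) \<inter> (\<lambda>y. norm (f (fst y))) -` {..<r})"
      by (auto intro!: continuous_open_preimage)
    moreover have "((D - A) \<times> (UNIV::complex set)) \<inter> (\<lambda>y. norm (f (fst y))) -` {r<..} = {y. fst y \<in> D - A \<and> r < norm (f (fst y))}"
      "((D - A) \<times> (UNIV::complex set)) \<inter> (\<lambda>y. norm (f (fst y))) -` {..<r} = {y. fst y \<in> D - A \<and> norm (f (fst y)) < r}" by auto
    ultimately show "open {y::complex \<times> complex. fst y \<in> D - A \<and> r < norm (f (fst y))}" "open {y::complex \<times> complex. fst y \<in> D - A \<and> norm (f (fst y)) < r}"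
      by simp_all
  qed
  have smP: "submean_at P x" if x: "fst x \<in> D" "d < dist a (fst x)" for x
  proof -
    define z where "z = fst x"
    \<comment> \<open>In the second and third cases \<open>T2\<close> dominates the barrier nearby,
      so \<open>P\<close> is locally \<open>T2\<close>; only in the last one is \<open>P\<close> a
      genuine maximum.\<close>
    consider "\<delta> < dist a z" | "dist a z \<le> \<delta>" "R \<le> norm (f z)" | "dist a z = \<delta>" "norm (f z) < R" | "dist a z < \<delta>" "norm (f z) < R"
      by linarith
    then show ?thesis
    proof cases
      case 1
      show ?thesis
        by (rule submean_at_cong[OF smT2[OF x(1)] opd(1)[of \<delta>]]) (use 1 in \<open>auto simp: P_def z_def\<close>)
    next
      case 2
      have zDA: "z \<in> D - A" using An(2) An(3)[of z] 2 x(2) unfolding z_def by auto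
      show ?thesis
      proof (rule submean_at_cong[OF smT2[OF x(1)]])
        show "open ({y::complex \<times> complex. d < dist a (fst y)} \<inter> {y. fst y \<in> D - A \<and> R - 1 < norm (f (fst y))})"
          by (intro open_Int opd opf)
        show "x \<in> {y. d < dist a (fst y)} \<inter> {y. fst y \<in> D - A \<and> R - 1 < norm (f (fst y))}"
          using x(2) zDA 2 unfolding z_def by simp
        fix y assume y: "y \<in> {y::complex \<times> complex. d < dist a (fst y)} \<inter> {y. fst y \<in> D - A \<and> R - 1 < norm (f (fst y))}"
        show "T2 y = P y"
        proof (cases "dist a (fst y) < \<delta> \<and> norm (f (fst y)) < R")
          case True
          then have yA: "fst y \<in> An" "fst y \<in> X" using y An(3) unfolding X_def by auto
          have "- \<eta>' \<le> T2 y" using T2a[OF yA(1), of "snd y"] y by simp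
          then have "Re (g (fst y)) \<le> T2 y" using \<eta>g(2)[OF yA(2)] \<eta>'(3) by linarith
          then show ?thesis unfolding P_def by (simp add: max_def)
        qed (auto simp: P_def)
      qed
    next
      case 3
      have zX: "z \<in> X" unfolding X_def using An(3) 3 x(2) by (simp add: z_def)
      then have zV: "z \<in> V" using XV by blast
      have g2: "Re (g z) \<le> -2" using g[of z] 3 x(2) unfolding z_def by auto
      have "continuous_on V (\<lambda>z. Re (g z))" by (intro continuous_intros holomorphic_on_imp_continuous_on V(2))
      then have "open (V \<inter> (\<lambda>z. Re (g z)) -` {..< -1})" using V(1) by (rule continuous_open_preimage) auto
      then have "open ((V \<inter> (\<lambda>z. Re (g z)) -` {..< -1}) \<times> (UNIV::complex set))" by (simp add: open_Times)
      then show ?thesis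
      proof (rule submean_at_cong[OF smT2[OF x(1)]])
        show "x \<in> (V \<inter> (\<lambda>z. Re (g z)) -` {..< -1}) \<times> UNIV" using zV g2 unfolding z_def by (simp add: mem_Times_iff)
        fix y assume "y \<in> (V \<inter> (\<lambda>z. Re (g z)) -` {..< -1}) \<times> (UNIV::complex set)"
        then have "Re (g (fst y)) \<le> T2 y" using T2m1[of y] by auto
        then show "T2 y = P y" unfolding P_def by (simp add: max_def)
      qed
    next
      case 4
      have zX: "z \<in> X" unfolding X_def using An(3) 4 x(2) by (simp add: z_def)
      then have zV: "z \<in> V" and zDA: "z \<in> D - A" using XV An(2) unfolding X_def by auto
      have "hol_lines (V \<times> UNIV) (\<lambda>y. g (fst y))" by (rule hol_lines_fst[OF V(2,1)])
      then have "submean_at (\<lambda>y. Re (g (fst y))) x"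
        by (rule submean_at_Re) (use zV V(1) in \<open>auto simp: open_Times z_def mem_Times_iff\<close>)
      then have "submean_at (\<lambda>y. max (T2 y) (Re (g (fst y)))) x" by (rule submean_at_max[OF smT2[OF x(1)]])
      then show ?thesis
      proof (rule submean_at_cong)
        let ?S = "{y::complex \<times> complex. d < dist a (fst y)} \<inter> {y. dist a (fst y) < \<delta>} \<inter> {y. fst y \<in> D - A \<and> norm (f (fst y)) < R}"
        show "open ?S" by (intro open_Int opd opf)
        show "x \<in> ?S" using x 4 zDA unfolding z_def by simp
        show "max (T2 y) (Re (g (fst y))) = P y" if "y \<in> ?S" for y using that unfolding P_def by simp
      qed
    qed
  qed
  have sm\<beta>: "submean_at (\<lambda>y. \<beta> (fst y)) x" if "fst x \<noteq> a" for x :: "complex \<times> complex"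
  proof -
    have "hol_lines UNIV (\<lambda>y. fst y - a)"
      unfolding hol_lines_def by (auto intro!: continuous_intros holomorphic_intros)
    then have "submean_at (\<lambda>y. ln (norm (fst y - a))) x" by (rule submean_at_ln_norm(1)) (use that in auto)
    then show ?thesis unfolding \<beta>_def using \<epsilon> by (intro submean_at_cmult submean_at_add submean_at_const) auto
  qed
  have opD: "open (D \<times> (UNIV::complex set))" using D(1) by (simp add: open_Times)
  have Pge: "- 3 * \<kappa> \<le> \<beta> (fst y) + P y" if "\<delta>' / 2 < dist a (fst y)" "dist a (fst y) < \<delta>'" for y
  proof -
    have yA: "fst y \<in> An" using that An(3) d \<delta> by auto
    have "- \<kappa> \<le> \<beta> (fst y)" using that by (intro \<beta>ge) auto
    moreover have "- \<kappa> \<le> P y"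
    proof (cases "norm (f (fst y)) < R")
      case True
      then have "- \<kappa> \<le> Re (g (fst y))" using g[of "fst y"] that yA An(3) by auto
      moreover have "P y = max (T2 y) (Re (g (fst y)))" unfolding P_def using True that d \<delta> by auto
      ultimately show ?thesis by simp
    next
      case False
      then have "- \<eta>' \<le> T2 y" using T2a[OF yA, of "snd y"] by simp
      moreover have "P y = T2 y" using False unfolding P_def by simp
      ultimately show ?thesis using \<eta>'(2) by simp
    qed
    ultimately show ?thesis using \<kappa> by linarith
  qed
  have Umax: "U y = max (- 3 * \<kappa>) (\<beta> (fst y) + P y)" if "fst y \<noteq> a" "dist a (fst y) < \<delta>'" for y
    using that Pge[of y] unfolding U_def by (auto simp: max_def)
  have Pclose: "max (- 3 * \<kappa>) (\<beta> (fst y) + P y) = max (- 3 * \<kappa>) (\<beta> (fst y) + T2 y)"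
    if "fst y \<noteq> a" "dist a (fst y) < 2 * d" for y
  proof (cases "d < dist a (fst y) \<and> dist a (fst y) < \<delta> \<and> norm (f (fst y)) < R")
    case True
    have "\<beta> (fst y) \<le> - (4 * \<kappa>)" using that d(4) by (intro \<beta>small) auto
    moreover have "Re (g (fst y)) < 0" using g[of "fst y"] True by auto
    ultimately have "\<beta> (fst y) + Re (g (fst y)) < - 3 * \<kappa>" using \<kappa> by linarith
    then show ?thesis using True unfolding P_def by (auto simp: max_def)
  next
    case False
    then show ?thesis unfolding P_def by auto
  qed
  have cpU: "cpsh_on (D \<times> UNIV) U"
  proof (rule cpsh_onI[OF opD])
    fix x assume "x \<in> D \<times> (UNIV::complex set)"
    then have xD: "fst x \<in> D" by auto
    consider "fst x = a" | "fst x \<noteq> a" "dist a (fst x) < 2 * d" | "d < dist a (fst x)" "dist a (fst x) < \<delta>'" | "\<delta>' / 2 < dist a (fst x)"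
      using d(1,3) \<delta>(1) by linarith
    then show "submean_at U x"
    proof cases
      case 1
      obtain r0 where r0: "r0 > 0" "continuous_on (ball x r0) T2" using smT2[OF xD] unfolding submean_at_def by blast
      \<comment> \<open>A local upper bound of \<open>T2\<close>; sufficiently close to
        \<open>a\<close> the logarithm outweighs it and \<open>U\<close> is the constant
        \<open>- 3 * \<kappa>\<close>.\<close>
      define B where "B = T2 x + 1"
      have "open (ball x r0 \<inter> T2 -` {..<B})" using r0(2) by (intro continuous_open_preimage) auto
      then have op: "open ((ball x r0 \<inter> T2 -` {..<B}) \<inter> {y. dist a (fst y) < min (2 * d) (exp (c - (\<bar>B\<bar> + 3 * \<kappa>) / \<epsilon>))})" (is "open ?S")
        by (rule open_Int[OF _ opd(2)])
      show ?thesis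
      proof (rule submean_at_cong[OF submean_at_const[of "- 3 * \<kappa>"] op])
        show "x \<in> ?S" using r0(1) 1 d(1) unfolding B_def by simp
        fix y assume y: "y \<in> ?S"
        show "- 3 * \<kappa> = U y"
        proof (cases "fst y = a")
          case True
          then show ?thesis unfolding U_def using \<delta>(1) by simp
        next
          case False
          have yd: "dist a (fst y) < 2 * d" using y by simp
          have "\<beta> (fst y) \<le> - (\<bar>B\<bar> + 3 * \<kappa>)" using False y by (intro \<beta>small) auto
          moreover have "T2 y < B" using y by simp
          ultimately have "\<beta> (fst y) + T2 y \<le> - 3 * \<kappa>" by linarith
          then have "max (- 3 * \<kappa>) (\<beta> (fst y) + T2 y) = - 3 * \<kappa>" by simp
          then show ?thesis using Umax[OF False] Pclose[OF False yd] yd d \<delta> by simp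
        qed
      qed
    next
      case 2
      have "submean_at (\<lambda>y. max (- 3 * \<kappa>) (\<beta> (fst y) + T2 y)) x"
        by (intro submean_at_max submean_at_const submean_at_add sm\<beta> smT2 2 xD)
      then show ?thesis
      proof (rule submean_at_cong)
        show "open ({y::complex \<times> complex. 0 < dist a (fst y)} \<inter> {y. dist a (fst y) < 2 * d})" by (intro open_Int opd)
        show "x \<in> {y. 0 < dist a (fst y)} \<inter> {y. dist a (fst y) < 2 * d}" using 2 by simp
        fix y assume "y \<in> {y::complex \<times> complex. 0 < dist a (fst y)} \<inter> {y. dist a (fst y) < 2 * d}"
        then have y: "fst y \<noteq> a" "dist a (fst y) < 2 * d" by auto
        then show "max (- 3 * \<kappa>) (\<beta> (fst y) + T2 y) = U y" using Umax[OF y(1)] Pclose[OF y] d \<delta> by simp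
      qed
    next
      case 3
      have xa: "fst x \<noteq> a" using 3 d(1) by auto
      have "submean_at (\<lambda>y. max (- 3 * \<kappa>) (\<beta> (fst y) + P y)) x"
        by (intro submean_at_max submean_at_const submean_at_add sm\<beta> smP 3 xD xa)
      then show ?thesis
      proof (rule submean_at_cong)
        show "open ({y::complex \<times> complex. d < dist a (fst y)} \<inter> {y. dist a (fst y) < \<delta>'})" by (intro open_Int opd)
        show "x \<in> {y. d < dist a (fst y)} \<inter> {y. dist a (fst y) < \<delta>'}" using 3 by simp
        fix y assume "y \<in> {y::complex \<times> complex. d < dist a (fst y)} \<inter> {y. dist a (fst y) < \<delta>'}"
        then have y: "fst y \<noteq> a" "dist a (fst y) < \<delta>'" using d(1) by auto
        then show "max (- 3 * \<kappa>) (\<beta> (fst y) + P y) = U y" using Umax by simp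
      qed
    next
      case 4
      have xa: "fst x \<noteq> a" "d < dist a (fst x)" using 4 d \<delta>(1) by auto
      have "submean_at (\<lambda>y. \<beta> (fst y) + P y) x"
        by (intro submean_at_add sm\<beta> smP xa xD)
      then show ?thesis
        by (rule submean_at_cong[OF _ opd(1)[of "\<delta>' / 2"]]) (use 4 in \<open>auto simp: U_def\<close>)
    qed
  qed
  have far: "U (z, w) = \<beta> z + T2 (z, w)" if "\<rho> \<le> dist a z" for z w
    using that \<delta> unfolding U_def P_def by auto
  have \<rho>\<delta>: "\<delta>' / 2 < \<rho>" using \<delta> by linarith
  have kW: "k \<le> W" "k0 \<le> W" unfolding W_def using k0 by auto
  have low: "- \<eta> \<le> U (z, w)" if "\<rho> \<le> dist a z" "- \<eta>' \<le> T (z, w)" for z w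
  proof -
    have "- \<kappa> \<le> \<beta> z" using that(1) \<rho>\<delta> by (intro \<beta>ge) simp
    moreover have "- \<eta>' \<le> T2 (z, w)" using that(2) T2T[of "(z, w)"] by linarith
    moreover have "\<eta> = 4 * \<kappa>" unfolding \<kappa>_def by simp
    ultimately show ?thesis unfolding far[OF that(1)] using \<eta>'(2) \<kappa> by linarith
  qed
  show "\<exists>u. peels D A f (insert a J) L k F C \<eta> u" unfolding peels_def
  proof (intro exI[of _ U] conjI ballI allI impI cpU)
    fix z w :: complex assume z: "z \<in> L" and w: "norm w \<le> k"
    show "U (z, w) \<le> 0"
    proof (cases "z = a")
      case True
      then show ?thesis unfolding U_def using \<kappa> \<delta>(1) by simp
    next
      case False
      have "T (z, w) \<le> 0" using T(2)[OF z] w kW by simp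
      moreover have "lp w = 0" using w k0 by (intro lp1) simp
      ultimately have T20: "T2 (z, w) \<le> 0" unfolding T2_def by simp
      have "P (z, w) \<le> 0"
        using T20 g[of z] unfolding P_def by auto
      moreover have "\<beta> z \<le> 0" using z False by (intro \<beta>le) auto
      ultimately show ?thesis unfolding U_def using \<kappa> False by auto
    qed
  next
    fix z assume z: "z \<in> C"
    have fz: "\<rho> \<le> dist a z" using z by (intro farQ) (simp add: Q_def)
    have "lp (f z) = 0" using Bf(2)[OF z] k0 by (intro lp1) simp
    then have "T2 (z, f z) = -1" unfolding T2_def using T(3)[OF z] by simp
    moreover have "\<beta> z \<le> 0" using z fz \<rho> by (intro \<beta>le) auto
    ultimately show "U (z, f z) \<le> -1" using far[OF fz, of "f z"] by simp
  next
    show "U (z, w) \<le> -1" if "z \<in> (A - insert a J) \<inter> L" "norm w \<le> k" for z w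
    proof -
      have fz: "\<rho> \<le> dist a z" using that by (intro farA) auto
      have "T (z, w) \<le> -1" using that kW by (intro T(4)) auto
      moreover have "lp w = 0" using that k0 by (intro lp1) simp
      ultimately have "T2 (z, w) = -1" unfolding T2_def by simp
      moreover have "\<beta> z \<le> 0" using that a by (intro \<beta>le) auto
      ultimately show ?thesis using far[OF fz, of w] by simp
    qed
  next
    fix x assume x: "x \<in> F"
    have "\<rho> \<le> dist a (fst x)" using x by (intro farQ) (auto simp: Q_def)
    then show "- \<eta> \<le> U x" using low[of "fst x" "snd x"] T(5)[of x] x by simp
  next
    fix b w assume b: "b \<in> insert a J" and w: "norm (w::complex) \<le> k"
    show "- \<eta> \<le> U (b, w)"
    proof (cases "b = a")
      case True
      have "\<eta> = 4 * \<kappa>" unfolding \<kappa>_def by simp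
      then show ?thesis unfolding U_def using True \<kappa> \<delta>(1) by simp
    next
      case False
      then have "b \<in> J" using b by simp
      then have "\<rho> \<le> dist a b" by (intro farQ) (simp add: Q_def)
      then show ?thesis using T(6)[OF \<open>b \<in> J\<close>] w kW by (intro low) auto
    qed
  qed
qed

definition unbounded_isolated :: "complex set \<Rightarrow> (complex \<Rightarrow> complex) \<Rightarrow> complex \<Rightarrow> bool" where
  "unbounded_isolated A f a \<longleftrightarrow> (\<exists>\<rho>>0. \<forall>z\<in>A. dist a z < \<rho> \<longrightarrow> z = a) \<and>
     (\<forall>t>0. \<forall>B. \<exists>z. 0 < dist a z \<and> dist a z < t \<and> B < norm (f z))"

lemma peelable_finite:
  assumes D: "open D" "open (D - A)" "A \<subseteq> D" and cheb: "\<And>K. compact K \<Longrightarrow> K \<subseteq> A \<Longrightarrow> cheb_zero K" and f: "f holomorphic_on (D - A)"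
    and J: "finite J" "J \<subseteq> A" "\<And>a. a \<in> J \<Longrightarrow> unbounded_isolated A f a"
  shows "peelable D A f J"
  using J
proof (induction J rule: finite_induct)
  case empty
  show ?case by (rule peelable_empty[OF D cheb f])
next
  case (insert a J)
  have ui: "unbounded_isolated A f a" using insert.prems by simp
  then obtain \<rho> where \<rho>: "\<rho> > 0" "\<And>z. z \<in> A \<Longrightarrow> dist a z < \<rho> \<Longrightarrow> z = a" unfolding unbounded_isolated_def by blast
  have unb: "\<exists>z. 0 < dist a z \<and> dist a z < t \<and> B < norm (f z)" if "t > 0" for t B
    using ui that unfolding unbounded_isolated_def by blast
  have "peelable D A f J" using insert.IH insert.prems by simp
  then show ?case
    by (rule peelable_insert[OF D f _ insert.hyps(1) _ insert.hyps(2) \<rho> unb]) (use insert.prems in auto)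
qed

section \<open>Assembling the series\<close>

lemma exhaustion_mono:
  assumes "open D"
  shows "{z \<in> D. exhaustion D z \<le> real k} \<subseteq> interior {z \<in> D. exhaustion D z \<le> real (Suc k)}"
proof -
  have "{z \<in> D. exhaustion D z \<le> real k} \<subseteq> {z \<in> D. exhaustion D z < real (Suc k)}" by auto
  also have "\<dots> \<subseteq> interior {z \<in> D. exhaustion D z \<le> real (Suc k)}"
    by (rule interior_maximal[OF _ open_exhaustion(1)[OF assms]]) auto
  finally show ?thesis .
qed

lemma exhaustion_cover:
  assumes "open D" "compact K" "K \<subseteq> D"
  obtains j where "K \<subseteq> {z \<in> D. exhaustion D z \<le> real j}"
proof -
  obtain B where B: "\<And>z. z \<in> K \<Longrightarrow> norm (exhaustion D z) \<le> B"
    using compact_norm_bound[OF assms(2) continuous_on_subset[OF continuous_on_exhaustion[OF assms(1)] assms(3)]] by metis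
  obtain j where "B \<le> real j" using real_arch_simple by blast
  then show ?thesis using B assms(3) by (intro that[of j]) force
qed

text \<open>The \<open>k\<close>-th term frees the lines over \<open>J k\<close>. A point of
  \<open>I\<close> belongs to \<open>J k\<close> for all large \<open>k\<close>, a point of
  \<open>A - I\<close> never does; likewise \<open>C k\<close> and \<open>F k\<close> eventually
  contain each point to be tested.\<close>

lemma complete_pluripolar_graph_union:
  assumes D: "open D" "open (D - A)" "A \<subseteq> D" and cheb: "\<And>K. compact K \<Longrightarrow> K \<subseteq> A \<Longrightarrow> cheb_zero K" and f: "f holomorphic_on (D - A)"
    and I: "I \<subseteq> A" "\<And>a. a \<in> I \<Longrightarrow> unbounded_isolated A f a"
  shows "complete_pluripolar (D \<times> UNIV) ({(z, f z) | z. z \<in> D - A} \<union> ((A - I) \<times> UNIV))"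
proof -
  define L where "L k = {z \<in> D. exhaustion D z \<le> real k}" for k
  define C where "C k = {z \<in> D - A. exhaustion (D - A) z \<le> real k}" for k
  define F where "F k = {y \<in> C k \<times> cball 0 (real k). 1 / real (Suc k) \<le> norm (snd y - f (fst y))}" for k
  define J where "J k = {a \<in> I. a \<in> L k \<and> (\<forall>b\<in>A. dist a b < 1 / real (Suc k) \<longrightarrow> b = a)}" for k
  have Lc: "compact (L k)" "L k \<subseteq> D" for k unfolding L_def using compact_exhaustion_sublevel[OF D(1)] by auto
  have Cc: "compact (C k)" "C k \<subseteq> D - A" for k unfolding C_def using compact_exhaustion_sublevel[OF D(2)] by auto
  have Fc: "compact (F k)" for k
  proof -
    have c: "compact (C k \<times> cball (0::complex) (real k))" using Cc by (intro compact_Times) auto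
    have "continuous_on (C k \<times> cball (0::complex) (real k)) (\<lambda>y. norm (snd y - f (fst y)))"
      by (intro continuous_intros continuous_on_compose2[OF continuous_on_subset[OF holomorphic_on_imp_continuous_on[OF f] Cc(2)]]) auto
    then have cl: "closed (C k \<times> cball (0::complex) (real k) \<inter> (\<lambda>y. norm (snd y - f (fst y))) -` {1 / real (Suc k)..})"
      using compact_imp_closed[OF c] by (rule continuous_closed_preimage) auto
    have eq: "F k = C k \<times> cball 0 (real k) \<inter> (C k \<times> cball (0::complex) (real k) \<inter> (\<lambda>y. norm (snd y - f (fst y))) -` {1 / real (Suc k)..})"
      unfolding F_def by auto
    show ?thesis unfolding eq by (rule compact_Int_closed[OF c cl])
  qed
  have F1: "fst ` F k \<subseteq> D - A" for k unfolding F_def using Cc(2)[of k] by auto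
  have F2: "w \<noteq> f z" if "(z, w) \<in> F k" for z w k
  proof
    assume "w = f z"
    then have "1 / real (Suc k) \<le> 0" using that unfolding F_def by simp
    then show False by (simp add: field_simps)
  qed
  \<comment> \<open>Distinct points of \<open>J k\<close> are at least
    \<open>1 / real (Suc k)\<close> apart and lie in a bounded set.\<close>
  have Jfin: "finite (J k)" for k
  proof -
    have "bounded (J k)" by (rule bounded_subset[OF compact_imp_bounded[OF Lc(1)[of k]]]) (auto simp: J_def)
    moreover have "uniform_discrete (J k)" unfolding uniform_discrete_def J_def
      using I(1) by (intro exI[of _ "1 / real (Suc k)"]) auto
    ultimately show ?thesis using uniform_discrete_finite_iff[of "J k"] by blast
  qed
  have JI: "J k \<subseteq> I" for k unfolding J_def by auto
  have "\<exists>u. peels D A f (J k) (L k) (real k) (F k) (C k) ((1/2)^k) u" for k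
  proof -
    have "peelable D A f (J k)"
      by (rule peelable_finite[OF D cheb f Jfin]) (use JI I in auto)
    then show ?thesis unfolding peelable_def using Lc Cc Fc F1 F2 by simp
  qed
  then obtain u where u: "\<And>k. peels D A f (J k) (L k) (real k) (F k) (C k) ((1/2)^k) (u k)" by metis
  note uD = peelsD[OF u]
  have Lev: "eventually (\<lambda>k. z \<in> L k) sequentially" if "z \<in> D" for z
  proof -
    obtain j where "exhaustion D z \<le> real j" using real_arch_simple by blast
    then show ?thesis unfolding eventually_sequentially L_def using that by (intro exI[of _ j]) force
  qed
  have Cev: "eventually (\<lambda>k. z \<in> C k) sequentially" if "z \<in> D - A" for z
  proof -
    obtain j where "exhaustion (D - A) z \<le> real j" using real_arch_simple by blast
    then show ?thesis unfolding eventually_sequentially C_def using that by (intro exI[of _ j]) force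
  qed
  have nev: "eventually (\<lambda>k. c \<le> real k) sequentially" for c
    using filterlim_real_sequentially unfolding filterlim_at_top by blast
  have invev: "eventually (\<lambda>k. 1 / real (Suc k) < c) sequentially" if "c > 0" for c
  proof -
    have "(\<lambda>k. 1 / real (Suc k)) \<longlonglongrightarrow> 0" using LIMSEQ_inverse_real_of_nat by (simp add: inverse_eq_divide)
    then show ?thesis using that by (rule order_tendstoD(2))
  qed
  show ?thesis
  proof (rule complete_pluripolar_series[where X = "\<lambda>k. L k \<times> cball 0 (real k)" and u = u])
    show "open (D \<times> (UNIV::complex set))" using D(1) by (simp add: open_Times)
    show "L k \<times> cball (0::complex) (real k) \<subseteq> interior (L (Suc k) \<times> cball 0 (real (Suc k)))" for k
    proof -
      have "cball (0::complex) (real k) \<subseteq> interior (cball 0 (real (Suc k)))" by auto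
      then show ?thesis unfolding interior_Times L_def using exhaustion_mono[OF D(1), of k] by (intro Sigma_mono) auto
    qed
    show "\<exists>k. K \<subseteq> L k \<times> cball 0 (real k)" if K: "compact K" "K \<subseteq> D \<times> UNIV" for K :: "(complex \<times> complex) set"
    proof -
      have "compact (fst ` K)" "compact (snd ` K)" using K(1) by (auto intro!: compact_continuous_image continuous_intros)
      moreover have "fst ` K \<subseteq> D" using K(2) by auto
      ultimately obtain j1 where j1: "fst ` K \<subseteq> L j1" using exhaustion_cover[OF D(1)] unfolding L_def by metis
      obtain B where B: "\<And>x. x \<in> snd ` K \<Longrightarrow> norm x \<le> B" using compact_imp_bounded[OF \<open>compact (snd ` K)\<close>] unfolding bounded_iff by blast
      obtain j2 where j2: "B \<le> real j2" using real_arch_simple by blast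
      define j where "j = max j1 j2"
      have "L j1 \<subseteq> L j" unfolding L_def j_def by auto
      moreover have "norm x \<le> real j" if "x \<in> snd ` K" for x using B[OF that] j2 unfolding j_def by simp
      ultimately have "K \<subseteq> L j \<times> cball 0 (real j)" using j1 by (force simp: mem_Times_iff)
      then show ?thesis by blast
    qed
    show "cpsh_on (D \<times> UNIV) (u k)" for k by (rule uD(1))
    show "u k x \<le> 0" if "x \<in> L k \<times> cball 0 (real k)" for k x using that uD(2) by (cases x) auto
    show "{(z, f z) | z. z \<in> D - A} \<union> ((A - I) \<times> UNIV) \<subseteq> D \<times> UNIV" using D(3) by auto
  next
    fix x assume "x \<in> {(z, f z) | z. z \<in> D - A} \<union> ((A - I) \<times> UNIV)"
    then consider z where "x = (z, f z)" "z \<in> D - A" | z w where "x = (z, w)" "z \<in> A - I" by auto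
    then show "eventually (\<lambda>k. u k x \<le> -1) sequentially"
    proof cases
      case (1 z)
      show ?thesis using Cev[OF 1(2)] by eventually_elim (use uD(3) 1(1) in blast)
    next
      case (2 z w)
      have zD: "z \<in> D" using 2 D(3) by auto
      show ?thesis using Lev[OF zD] nev[of "norm w"]
      proof eventually_elim
        case (elim k)
        then show ?case unfolding 2(1) using 2(2) JI by (intro uD(4)) auto
      qed
    qed
  next
    fix x assume x: "x \<in> D \<times> UNIV - ({(z, f z) | z. z \<in> D - A} \<union> ((A - I) \<times> UNIV))"
    obtain z w where zw: "x = (z, w)" by fastforce
    show "eventually (\<lambda>k. - ((1/2)^k) \<le> u k x) sequentially"
    proof (cases "z \<in> A")
      case True
      then have zI: "z \<in> I" and zD: "z \<in> D" using x zw by auto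
      obtain \<rho> where \<rho>: "\<rho> > 0" "\<And>b. b \<in> A \<Longrightarrow> dist z b < \<rho> \<Longrightarrow> b = z"
        using I(2)[OF zI] unfolding unbounded_isolated_def by blast
      show ?thesis using Lev[OF zD] nev[of "norm w"] invev[OF \<rho>(1)]
      proof eventually_elim
        case (elim k)
        have "z \<in> J k" unfolding J_def using zI elim \<rho>(2) by force
        then show ?case unfolding zw using elim by (intro uD(6))
      qed
    next
      case False
      then have zDA: "z \<in> D - A" and ne: "w \<noteq> f z" using x zw by auto
      have pos: "norm (w - f z) > 0" using ne by simp
      show ?thesis using Cev[OF zDA] nev[of "norm w"] invev[OF pos]
      proof eventually_elim
        case (elim k)
        then have "x \<in> F k" unfolding F_def zw by simp
        then show ?case by (rule uD(5))
      qed
    qed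
  qed
qed

text \<open>Riemann's theorem on removable singularities: near an isolated point a bounded
  \<open>f\<close> would extend.\<close>

lemma nonextendable_imp_unbounded_isolated:
  assumes "open D" "A \<subseteq> D" "f holomorphic_on (D - A)" "a \<in> A" "\<not> a islimpt A"
    and ne: "\<not> (\<exists>r>0. \<exists>g. ball a r \<subseteq> D \<and> g holomorphic_on ball a r \<and> (\<forall>z\<in>ball a r - A. g z = f z))"
  shows "unbounded_isolated A f a"
proof -
  obtain \<rho>1 where \<rho>1: "\<rho>1 > 0" "\<And>z. z \<in> A \<Longrightarrow> dist z a < \<rho>1 \<Longrightarrow> z = a"
    using assms(5) unfolding islimpt_approachable by blast
  have "a \<in> D" using assms(2,4) by auto
  then obtain \<rho>2 where \<rho>2: "\<rho>2 > 0" "ball a \<rho>2 \<subseteq> D" using assms(1) openE by blast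
  define \<rho> where "\<rho> = min \<rho>1 \<rho>2"
  have \<rho>: "\<rho> > 0" "ball a \<rho> \<subseteq> D" "ball a \<rho> \<inter> A = {a}"
    unfolding \<rho>_def using \<rho>1 \<rho>2 assms(4) by (auto simp: dist_commute)
  have eq: "ball a \<rho> - A = ball a \<rho> - {a}" using \<rho>(3) by blast
  have fh: "f holomorphic_on (ball a \<rho> - {a})"
    unfolding eq[symmetric] by (rule holomorphic_on_subset[OF assms(3)]) (use \<rho>(2) in auto)
  have "\<exists>z. 0 < dist a z \<and> dist a z < t \<and> B < norm (f z)" if "t > 0" for t B
  proof (rule ccontr)
    assume "\<not> ?thesis"
    then have b: "norm (f z) \<le> B" if "0 < dist a z" "dist a z < t" for z using that by force
    have ev: "eventually (\<lambda>z. norm (f z) \<le> B) (at a)"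
      unfolding eventually_at
    proof (intro exI[of _ t] conjI ballI impI)
      show "t > 0" by fact
      show "norm (f z) \<le> B" if "z \<noteq> a \<and> dist z a < t" for z using b[of z] that by (auto simp: dist_commute)
    qed
    have int: "a \<in> interior (ball a \<rho>)" using \<rho>(1) by (simp add: interior_open)
    have "\<exists>g. g holomorphic_on ball a \<rho> \<and> (\<forall>z\<in>ball a \<rho> - {a}. g z = f z)"
      by (rule iffD2[OF holomorphic_on_extend_bounded[OF fh int]]) (rule exI, rule ev)
    then obtain g where g: "g holomorphic_on ball a \<rho>" "\<forall>z\<in>ball a \<rho> - {a}. g z = f z" by blast
    then have "\<forall>z\<in>ball a \<rho> - A. g z = f z" unfolding eq by simp
    then show False using ne \<rho>(1,2) g(1) by blast
  qed
  moreover have "\<exists>\<rho>>0. \<forall>z\<in>A. dist a z < \<rho> \<longrightarrow> z = a" using \<rho>1 by (auto simp: dist_commute)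
  ultimately show ?thesis unfolding unbounded_isolated_def by blast
qed

theorem theorem1p1:
  fixes D A :: "complex set" and f :: "complex \<Rightarrow> complex"
  assumes "open D" and "connected D"
    and "A \<subseteq> D" and "closedin (top_of_set D) A" and "polar A"
    and "f holomorphic_on (D - A)"
  shows "complete_pluripolar (D \<times> UNIV) ({(z, f z) | z. z \<in> D - A} \<union> (A \<times> UNIV))
    \<and> ((\<forall>a\<in>A. \<not> (\<exists>r>0. \<exists>g. ball a r \<subseteq> D \<and> g holomorphic_on ball a r \<and>
                         (\<forall>z\<in>ball a r - A. g z = f z)))
       \<longrightarrow> complete_pluripolar (D \<times> UNIV)
             ({(z, f z) | z. z \<in> D - A} \<union> ({a\<in>D. a islimpt A} \<times> UNIV)))"
proof (intro conjI impI)
  have "openin (top_of_set D) (D - A)" using assms(4) by (simp add: closedin_def)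
  then have DA: "open (D - A)" using assms(1) by (simp add: openin_open_eq)
  have cheb: "cheb_zero K" if "compact K" "K \<subseteq> A" for K using polar_imp_cheb_zero[OF assms(5) that] .
  show "complete_pluripolar (D \<times> UNIV) ({(z, f z) | z. z \<in> D - A} \<union> (A \<times> UNIV))"
    using complete_pluripolar_graph_union[OF assms(1) DA assms(3) cheb assms(6), of "{}"] by simp
  assume ne: "\<forall>a\<in>A. \<not> (\<exists>r>0. \<exists>g. ball a r \<subseteq> D \<and> g holomorphic_on ball a r \<and> (\<forall>z\<in>ball a r - A. g z = f z))"
  define I where "I = {a \<in> A. \<not> a islimpt A}"
  \<comment> \<open>Relative closedness puts the accumulation points lying in \<open>D\<close> into
    \<open>A\<close>, so they are what is left after removing the isolated points.\<close>
  have "a \<in> A" if "a \<in> D" "a islimpt A" for a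
    using assms(4) that unfolding closedin_limpt by blast
  then have "A - I = {a \<in> D. a islimpt A}" unfolding I_def using assms(3) by blast
  moreover have "unbounded_isolated A f a" if "a \<in> I" for a
    using that ne nonextendable_imp_unbounded_isolated[OF assms(1,3,6), of a] unfolding I_def by blast
  then have "complete_pluripolar (D \<times> UNIV) ({(z, f z) | z. z \<in> D - A} \<union> ((A - I) \<times> UNIV))"
    by (intro complete_pluripolar_graph_union[OF assms(1) DA assms(3) cheb assms(6)]) (auto simp: I_def)
  ultimately show "complete_pluripolar (D \<times> UNIV) ({(z, f z) | z. z \<in> D - A} \<union> ({a\<in>D. a islimpt A} \<times> UNIV))"
    by simp
qed

end
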